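(* Let $q\in\mathbb{C}$ with $0<|q|<1$. The Haar state $h$ of the compact quantum group $U_q(2)$ is faithful on the $C^*$-algebra $C(U_q(2))$; that is, if $x\in C(U_q(2))$ and $h(x^*x)=0$, then $x=0$.
   Context: For $q\in\mathbb{C}\setminus\{0\}$, $C(U_q(2))$ is the universal unital $C^*$-algebra generated by $a,b,D$ subject to $$ba=qab,\quad a^*b=qba^*,\quad bb^*=b^*b,\quad aa^*+bb^*=1,\quad aD=Da,\quad bD=q^2|q|^{-2}Db,\quad DD^*=D^*D=1,\quad a^*a+|q|^2b^*b=1.$$ It is a compact quantum group (in the sense of Woronowicz) with comultiplication $\Delta:C(U_q(2))\to C(U_q(2))\otimes C(U_q(2))$, $$\Delta(a)=a\otimes a-\bar q\,b\otimes Db^*,\qquad \Delta(b)=a\otimes b+b\otimes Da^*,\qquad \Delta(D)=D\otimes D.$$ The Haar state $h$ is the unique state on $C(U_q(2))$ with $(h\otimes\mathrm{id})\Delta(x)=h(x)1=(\mathrm{id}\otimes h)\Delta(x)$ for all $x$. *)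

theory Defs
  imports "HOL-Analysis.Analysis" "HOL-Library.Poly_Mapping"
begin

section \<open>Unital complex star-algebras and C*-algebras\<close>

class star =
  fixes star :: "'a \<Rightarrow> 'a"  ("_\<^sup>\<star>" [1000] 999)

class complex_star_algebra_1 = ring_1 + star +
  fixes scaleC :: "complex \<Rightarrow> 'a \<Rightarrow> 'a"  (infixr "*\<^sub>C" 75)
  assumes scaleC_add_right: "c *\<^sub>C (x + y) = c *\<^sub>C x + c *\<^sub>C y"
    and scaleC_add_left: "(c + d) *\<^sub>C x = c *\<^sub>C x + d *\<^sub>C x"
    and scaleC_scaleC: "c *\<^sub>C (d *\<^sub>C x) = (c * d) *\<^sub>C x"
    and scaleC_one: "1 *\<^sub>C x = x"
    and mult_scaleC_left: "(c *\<^sub>C x) * y = c *\<^sub>C (x * y)"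
    and mult_scaleC_right: "x * (c *\<^sub>C y) = c *\<^sub>C (x * y)"
    and star_star: "(x\<^sup>\<star>)\<^sup>\<star> = x"
    and star_add: "(x + y)\<^sup>\<star> = x\<^sup>\<star> + y\<^sup>\<star>"
    and star_scaleC: "(c *\<^sub>C x)\<^sup>\<star> = cnj c *\<^sub>C x\<^sup>\<star>"
    and star_mult: "(x * y)\<^sup>\<star> = y\<^sup>\<star> * x\<^sup>\<star>"
begin

lemma scaleC_zero_left: "0 *\<^sub>C x = 0"
  using scaleC_add_left[of 0 0 x] by simp

lemma scaleC_zero_right: "c *\<^sub>C 0 = 0"
  using scaleC_add_right[of c 0 0] by simp

lemma scaleC_minus1: "(- 1) *\<^sub>C x = - x"
  using scaleC_add_left[of "-1" 1 x]
  by (simp add: scaleC_one scaleC_zero_left eq_neg_iff_add_eq_0)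

lemma star_zero: "0\<^sup>\<star> = 0"
  using star_add[of 0 0] by simp

lemma star_one: "1\<^sup>\<star> = 1"
  using star_mult[of "1\<^sup>\<star>" 1] by (simp add: star_star)

end

class cstar_algebra = complex_star_algebra_1 + real_normed_algebra_1 + banach +
  assumes scaleR_scaleC: "r *\<^sub>R x = of_real r *\<^sub>C x"
    and norm_scaleC: "norm (c *\<^sub>C x) = cmod c * norm x"
    and cstar_identity: "norm (x\<^sup>\<star> * x) = (norm x)\<^sup>2"

instantiation complex :: cstar_algebra
begin
definition "c *\<^sub>C (z :: complex) = c * z"
definition "(z :: complex)\<^sup>\<star> = cnj z"
instance
  by standard
    (auto simp: scaleC_complex_def star_complex_def algebra_simps norm_mult power2_eq_square
      scaleR_conv_of_real)
end

definition clinear_map :: "('a::complex_star_algebra_1 \<Rightarrow> 'b::complex_star_algebra_1) \<Rightarrow> bool" where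
  "clinear_map f \<longleftrightarrow> (\<forall>x y. f (x + y) = f x + f y) \<and> (\<forall>c x. f (c *\<^sub>C x) = c *\<^sub>C f x)"

definition star_hom :: "('a::complex_star_algebra_1 \<Rightarrow> 'b::complex_star_algebra_1) \<Rightarrow> bool" where
  "star_hom f \<longleftrightarrow> clinear_map f \<and> (\<forall>x y. f (x * y) = f x * f y) \<and> (\<forall>x. f (x\<^sup>\<star>) = (f x)\<^sup>\<star>) \<and> f 1 = 1"

definition cstar_seminorm_on :: "'a::complex_star_algebra_1 set \<Rightarrow> ('a \<Rightarrow> real) \<Rightarrow> bool" where
  "cstar_seminorm_on S p \<longleftrightarrow>
     (\<forall>x\<in>S. 0 \<le> p x) \<and>
     (\<forall>x\<in>S. \<forall>y\<in>S. p (x + y) \<le> p x + p y) \<and>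
     (\<forall>x\<in>S. \<forall>c. p (c *\<^sub>C x) = cmod c * p x) \<and>
     (\<forall>x\<in>S. \<forall>y\<in>S. p (x * y) \<le> p x * p y) \<and>
     (\<forall>x\<in>S. p (x\<^sup>\<star> * x) = (p x)\<^sup>2)"

definition cstar_norm_on :: "'a::complex_star_algebra_1 set \<Rightarrow> ('a \<Rightarrow> real) \<Rightarrow> bool" where
  "cstar_norm_on S p \<longleftrightarrow> cstar_seminorm_on S p \<and> (\<forall>x\<in>S. p x = 0 \<longrightarrow> x = 0)"

text \<open>A state is a positive linear functional of norm one.\<close>

definition state :: "('a::cstar_algebra \<Rightarrow> complex) \<Rightarrow> bool" where
  "state h \<longleftrightarrow> clinear_map h \<and> bounded_linear h \<and> (\<forall>x. h (x\<^sup>\<star> * x) \<in> \<real>\<^sub>\<ge>\<^sub>0) \<and> onorm h = 1"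

section \<open>Free unital star-algebras\<close>

text \<open>
  Words in the letters \<open>g\<close> (encoded as \<open>(g, False)\<close>) and \<open>g\<^sup>\<star>\<close> (encoded as \<open>(g, True)\<close>),
  with concatenation written additively because \<^theory>\<open>HOL-Library.Poly_Mapping\<close> expects the
  monoid of exponents to be additive. The free unital star-algebra is its monoid algebra over
  the complex numbers, with the conjugate-linear involution that reverses words.
\<close>

datatype 'g word = Word (letters: "('g \<times> bool) list")

class star_monoid_add = monoid_add + star +
  assumes star_star_monoid: "(v\<^sup>\<star>)\<^sup>\<star> = v"
    and star_plus_monoid: "(v + w)\<^sup>\<star> = w\<^sup>\<star> + v\<^sup>\<star>"

instantiation word :: (type) star_monoid_add
begin
definition "0 = Word []"
definition "v + w = Word (letters v @ letters w)"
definition "w\<^sup>\<star> = Word (rev (map (\<lambda>(g, s). (g, \<not> s)) (letters w)))"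
instance
  by standard
    (auto simp: zero_word_def plus_word_def star_word_def rev_map comp_def case_prod_unfold)
end

lemma poly_mapping_add_induct [case_names zero single add]:
  assumes "P 0" "\<And>k c. P (Poly_Mapping.single k c)" "\<And>f g. P f \<Longrightarrow> P g \<Longrightarrow> P (f + g)"
  shows "P (f :: 'k \<Rightarrow>\<^sub>0 'b::monoid_add)"
proof (induction f rule: update_induct)
  case const
  then show ?case by (rule assms)
next
  case (update f a b)
  have "Poly_Mapping.update a b f = f + Poly_Mapping.single a b"
    using update by (intro poly_mapping_eqI)
      (auto simp: lookup_update lookup_add lookup_single in_keys_iff when_def)
  then show ?case using assms update by simp
qed

instantiation poly_mapping :: (star_monoid_add, complex_star_algebra_1) complex_star_algebra_1
begin

lift_definition scaleC_poly_mapping :: "complex \<Rightarrow> ('a \<Rightarrow>\<^sub>0 'b) \<Rightarrow> ('a \<Rightarrow>\<^sub>0 'b)"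
  is "\<lambda>c f w. c *\<^sub>C f w"
  by (erule rev_finite_subset) (auto simp: scaleC_zero_right)

lift_definition star_poly_mapping :: "('a \<Rightarrow>\<^sub>0 'b) \<Rightarrow> ('a \<Rightarrow>\<^sub>0 'b)"
  is "\<lambda>f w. (f (w\<^sup>\<star>))\<^sup>\<star>"
proof -
  fix f :: "'a \<Rightarrow> 'b" assume "finite {w. f w \<noteq> 0}"
  then have "finite (star ` {w. f w \<noteq> 0})" by simp
  then show "finite {w. (f (w\<^sup>\<star>))\<^sup>\<star> \<noteq> 0}"
  proof (rule rev_finite_subset)
    show "{w. (f (w\<^sup>\<star>))\<^sup>\<star> \<noteq> 0} \<subseteq> star ` {w. f w \<noteq> 0}"
    proof
      fix w assume "w \<in> {w. (f (w\<^sup>\<star>))\<^sup>\<star> \<noteq> 0}"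
      then have "w\<^sup>\<star> \<in> {w. f w \<noteq> 0}" by (auto simp: star_zero)
      then have "(w\<^sup>\<star>)\<^sup>\<star> \<in> star ` {w. f w \<noteq> 0}" by (rule imageI)
      then show "w \<in> star ` {w. f w \<noteq> 0}" by (simp only: star_star_monoid)
    qed
  qed
qed

instance
proof
  fix c d :: complex and x y z :: "'a \<Rightarrow>\<^sub>0 'b"
  show add_right: "c *\<^sub>C (x + y) = c *\<^sub>C x + c *\<^sub>C y" for c and x y :: "'a \<Rightarrow>\<^sub>0 'b"
    by transfer (simp add: scaleC_add_right)
  show "(c + d) *\<^sub>C x = c *\<^sub>C x + d *\<^sub>C x"
    by transfer (simp add: scaleC_add_left)
  show "c *\<^sub>C (d *\<^sub>C x) = (c * d) *\<^sub>C x"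
    by transfer (simp add: scaleC_scaleC)
  show "1 *\<^sub>C x = x"
    by transfer (simp add: scaleC_one)
  have scaleC_single: "c *\<^sub>C Poly_Mapping.single k b = Poly_Mapping.single k (c *\<^sub>C b)"
    for c and k :: 'a and b :: 'b
    by transfer (auto simp: when_def scaleC_zero_right)
  have zero: "c *\<^sub>C (0 :: 'a \<Rightarrow>\<^sub>0 'b) = 0" for c
    by transfer (simp add: scaleC_zero_right)
  show "(c *\<^sub>C x) * y = c *\<^sub>C (x * y)"
  proof (induction x rule: poly_mapping_add_induct)
    case (single k b)
    show ?case
      by (induction y rule: poly_mapping_add_induct)
        (simp_all add: scaleC_single mult_single mult_scaleC_left zero add_right ring_distribs)
  qed (simp_all add: zero add_right ring_distribs)
  show "x * (c *\<^sub>C y) = c *\<^sub>C (x * y)"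
  proof (induction x rule: poly_mapping_add_induct)
    case (single k b)
    show ?case
      by (induction y rule: poly_mapping_add_induct)
        (simp_all add: scaleC_single mult_single mult_scaleC_right zero add_right ring_distribs)
  qed (simp_all add: zero add_right ring_distribs)
  show "(x\<^sup>\<star>)\<^sup>\<star> = x"
    by transfer (simp add: star_star_monoid star_star)
  show star_add': "(x + y)\<^sup>\<star> = x\<^sup>\<star> + y\<^sup>\<star>" for x y :: "'a \<Rightarrow>\<^sub>0 'b"
    by transfer (simp add: star_add)
  show "(c *\<^sub>C x)\<^sup>\<star> = cnj c *\<^sub>C x\<^sup>\<star>"
    by transfer (simp add: star_scaleC)
  have star_single: "(Poly_Mapping.single k b)\<^sup>\<star> = Poly_Mapping.single (k\<^sup>\<star>) (b\<^sup>\<star>)"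
    for k :: 'a and b :: 'b
    by transfer (auto simp: when_def star_zero star_star_monoid fun_eq_iff)
  have star_zero': "(0 :: 'a \<Rightarrow>\<^sub>0 'b)\<^sup>\<star> = 0"
    by transfer (simp add: star_zero)
  show "(x * y)\<^sup>\<star> = y\<^sup>\<star> * x\<^sup>\<star>"
  proof (induction x rule: poly_mapping_add_induct)
    case (single k b)
    show ?case
      by (induction y rule: poly_mapping_add_induct)
        (simp_all add: star_single mult_single star_mult star_plus_monoid star_zero' star_add'
          ring_distribs)
  qed (simp_all add: star_zero' star_add' ring_distribs)
qed

end

type_synonym 'g free_star_algebra = "'g word \<Rightarrow>\<^sub>0 complex"

definition gen :: "'g \<Rightarrow> 'g free_star_algebra" where
  "gen i = Poly_Mapping.single (Word [(i, False)]) 1"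

definition eval_word :: "('g \<Rightarrow> 'a::complex_star_algebra_1) \<Rightarrow> 'g word \<Rightarrow> 'a" where
  "eval_word u w = prod_list (map (\<lambda>(i, s). if s then (u i)\<^sup>\<star> else u i) (letters w))"

definition eval_free :: "('g \<Rightarrow> 'a::complex_star_algebra_1) \<Rightarrow> 'g free_star_algebra \<Rightarrow> 'a" where
  "eval_free u x = (\<Sum>w\<in>Poly_Mapping.keys x. Poly_Mapping.lookup x w *\<^sub>C eval_word u w)"

lemma scaleC_single: "c *\<^sub>C Poly_Mapping.single k b = Poly_Mapping.single k (c *\<^sub>C b)"
  by transfer (auto simp: when_def scaleC_zero_right)

lemma star_single: "(Poly_Mapping.single k b)\<^sup>\<star> = Poly_Mapping.single (k\<^sup>\<star>) (b\<^sup>\<star>)"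
  by transfer (auto simp: when_def star_zero star_star_monoid fun_eq_iff)

lemma eval_word_zero: "eval_word u 0 = 1"
  by (simp add: eval_word_def zero_word_def)

lemma eval_word_plus: "eval_word u (v + w) = eval_word u v * eval_word u w"
  by (simp add: eval_word_def plus_word_def)

lemma eval_word_star: "eval_word u (w\<^sup>\<star>) = (eval_word u w)\<^sup>\<star>"
proof (cases w)
  case (Word l)
  have "prod_list (map (\<lambda>(i, s). if s then (u i)\<^sup>\<star> else u i) (rev (map (\<lambda>(g, s). (g, \<not> s)) l)))
      = (prod_list (map (\<lambda>(i, s). if s then (u i)\<^sup>\<star> else u i) l))\<^sup>\<star>"
    by (induction l) (auto simp: star_one star_mult star_star)
  then show ?thesis by (simp add: Word eval_word_def star_word_def)
qed

lemma eval_free_superset: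
  assumes "finite W" "Poly_Mapping.keys x \<subseteq> W"
  shows "eval_free u x = (\<Sum>w\<in>W. Poly_Mapping.lookup x w *\<^sub>C eval_word u w)"
  unfolding eval_free_def
  by (rule sum.mono_neutral_left) (use assms in \<open>auto simp: in_keys_iff scaleC_zero_left\<close>)

lemma eval_free_zero: "eval_free u 0 = 0"
  by (simp add: eval_free_def)

lemma eval_free_single: "eval_free u (Poly_Mapping.single w c) = c *\<^sub>C eval_word u w"
  by (subst eval_free_superset[of "{w}"]) auto

lemma eval_free_add: "eval_free u (x + y) = eval_free u x + eval_free u y"
proof -
  let ?W = "Poly_Mapping.keys x \<union> Poly_Mapping.keys y"
  have "eval_free u z = (\<Sum>w\<in>?W. Poly_Mapping.lookup z w *\<^sub>C eval_word u w)"
    if "z = x \<or> z = y \<or> z = x + y" for z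
    by (rule eval_free_superset) (use that Poly_Mapping.keys_add[of x y] in auto)
  then show ?thesis
    by (simp add: lookup_add scaleC_add_left sum.distrib)
qed

lemma eval_free_scaleC: "eval_free u (c *\<^sub>C x) = c *\<^sub>C eval_free u x"
  by (induction x rule: poly_mapping_add_induct)
    (simp_all add: eval_free_zero eval_free_single eval_free_add scaleC_zero_right
      scaleC_single scaleC_add_right scaleC_scaleC scaleC_complex_def)

lemma eval_free_mult: "eval_free u (x * y) = eval_free u x * eval_free u y"
proof (induction x rule: poly_mapping_add_induct)
  case (single v b)
  show ?case
    by (induction y rule: poly_mapping_add_induct)
      (simp_all add: eval_free_zero eval_free_single eval_free_add eval_word_plus mult_single
        mult_scaleC_left mult_scaleC_right scaleC_scaleC ring_distribs mult.commute)
qed (simp_all add: eval_free_zero eval_free_add ring_distribs)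

lemma eval_free_star: "eval_free u (x\<^sup>\<star>) = (eval_free u x)\<^sup>\<star>"
  by (induction x rule: poly_mapping_add_induct)
    (simp_all add: eval_free_zero eval_free_single eval_free_add star_zero star_add star_single
      eval_word_star star_scaleC star_complex_def)

lemma eval_free_one: "eval_free u 1 = 1"
  by (simp add: eval_free_single eval_word_zero scaleC_one flip: single_one)

lemma star_hom_eval_free: "star_hom (eval_free u)"
  by (simp add: star_hom_def clinear_map_def eval_free_add eval_free_scaleC eval_free_mult
      eval_free_star eval_free_one)

lemma eval_free_gen: "eval_free u (gen i) = u i"
  by (simp add: gen_def eval_free_single eval_word_def scaleC_one)

lemma eval_free_diff: "eval_free u (x - y) = eval_free u x - eval_free u y"
  using eval_free_add[of u "x - y" y] by (simp add: algebra_simps)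

lemma star_hom_eq_eval_free:
  assumes "star_hom f"
  shows "f x = eval_free (\<lambda>i. f (gen i)) x"
proof -
  have zero: "f 0 = 0"
    using assms scaleC_zero_left[of 0] unfolding star_hom_def clinear_map_def
    by (metis scaleC_zero_left)
  have letter: "Poly_Mapping.single (Word [(i, s)]) 1 = (if s then (gen i)\<^sup>\<star> else gen i)" for i :: 'a and s
    by (simp add: gen_def star_single star_word_def star_complex_def)
  have word: "f (Poly_Mapping.single (Word l) 1) = eval_word (\<lambda>i. f (gen i)) (Word l)" for l
  proof (induction l)
    case Nil
    then show ?case
      using assms by (simp add: star_hom_def eval_word_zero flip: zero_word_def)
  next
    case (Cons g l)
    have "Poly_Mapping.single (Word (g # l)) (1::complex)
        = Poly_Mapping.single (Word [g]) 1 * Poly_Mapping.single (Word l) 1"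
      by (simp add: mult_single plus_word_def)
    then show ?case
      using assms Cons by (cases g) (simp add: star_hom_def eval_word_def letter)
  qed
  show ?thesis
  proof (induction x rule: poly_mapping_add_induct)
    case (single w c)
    have "Poly_Mapping.single w c = c *\<^sub>C Poly_Mapping.single w 1"
      by (simp add: scaleC_single scaleC_complex_def)
    then show ?case
      using assms word[of "letters w"]
      by (simp add: star_hom_def clinear_map_def eval_free_scaleC eval_free_single scaleC_one)
  qed (use assms in \<open>simp_all add: zero star_hom_def clinear_map_def eval_free_zero eval_free_add\<close>)
qed

lemma star_hom_comp: "star_hom f \<Longrightarrow> star_hom g \<Longrightarrow> star_hom (\<lambda>x. g (f x))"
  by (simp add: star_hom_def clinear_map_def)

lemma star_hom_eval_free_comp:
  assumes "star_hom f"
  shows "f (eval_free u x) = eval_free (\<lambda>i. f (u i)) x"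
  using star_hom_eq_eval_free[OF star_hom_comp[OF star_hom_eval_free assms], of u x]
  by (simp add: eval_free_gen)

section \<open>Universal C*-algebras given by generators and relations\<close>

text \<open>
  The universal unital C*-algebra on generators indexed by \<^typ>\<open>'g\<close> subject to relations
  \<open>r = 0\<close> for \<open>r\<close> in \<open>R\<close> is the Hausdorff completion of the free unital star-algebra with respect
  to the largest C*-seminorm that vanishes on \<open>R\<close>. The predicate below says that the C*-algebra
  \<^typ>\<open>'a\<close>, together with the family \<open>u\<close> of images of the generators, is this completion;
  \<open>universal_property\<close> below derives the mapping property.
\<close>

definition universal_cstar_algebra ::
    "'g free_star_algebra set \<Rightarrow> ('g \<Rightarrow> 'a::cstar_algebra) \<Rightarrow> bool" where
  "universal_cstar_algebra R u \<longleftrightarrow>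
     (\<forall>r\<in>R. eval_free u r = 0) \<and>
     closure (range (eval_free u)) = UNIV \<and>
     (\<forall>p. cstar_seminorm_on UNIV p \<and> (\<forall>r\<in>R. p r = 0) \<longrightarrow> (\<forall>x. p x \<le> norm (eval_free u x)))"

lemma norm_star: "norm (x\<^sup>\<star>) = norm (x :: 'a::cstar_algebra)"
proof -
  have le: "norm y \<le> norm (y\<^sup>\<star>)" for y :: 'a
  proof (cases "y = 0")
    case False
    have "norm y * norm y \<le> norm (y\<^sup>\<star>) * norm y"
      using norm_mult_ineq[of "y\<^sup>\<star>" y] by (simp add: cstar_identity power2_eq_square)
    then show ?thesis using False by simp
  qed simp
  show ?thesis using le[of x] le[of "x\<^sup>\<star>"] by (simp add: star_star)
qed

lemma cstar_seminorm_eval_free: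
  "cstar_seminorm_on UNIV (\<lambda>x. norm (eval_free (u :: 'g \<Rightarrow> 'a::cstar_algebra) x))"
  by (simp add: cstar_seminorm_on_def eval_free_add eval_free_scaleC eval_free_mult eval_free_star
      norm_triangle_ineq norm_scaleC norm_mult_ineq cstar_identity)

lemma continuous_star: "continuous_on S (star :: 'a::cstar_algebra \<Rightarrow> 'a)"
proof -
  have "bounded_linear (star :: 'a \<Rightarrow> 'a)"
    by (rule bounded_linear_intro[where K = 1])
      (simp_all add: star_add scaleR_scaleC star_scaleC norm_star)
  then show ?thesis by (rule linear_continuous_on)
qed

lemma continuous_scaleC: "continuous_on S (\<lambda>x :: 'a::cstar_algebra. c *\<^sub>C x)"
proof -
  have "bounded_linear (\<lambda>x :: 'a. c *\<^sub>C x)"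
    by (rule bounded_linear_intro[where K = "cmod c"])
      (simp_all add: scaleC_add_right scaleR_scaleC scaleC_scaleC norm_scaleC mult.commute)
  then show ?thesis by (rule linear_continuous_on)
qed

theorem universal_property:
  fixes u :: "'g \<Rightarrow> 'a::cstar_algebra" and v :: "'g \<Rightarrow> 'b::cstar_algebra"
  assumes u: "universal_cstar_algebra R u" and v: "\<And>r. r \<in> R \<Longrightarrow> eval_free v r = 0"
  shows "\<exists>!f. star_hom f \<and> continuous_on UNIV f \<and> (\<forall>i. f (u i) = v i)"
proof -
  let ?A = "range (eval_free u)"
  have dense: "closure ?A = UNIV" and le: "norm (eval_free v x) \<le> norm (eval_free u x)" for x
    using u v cstar_seminorm_eval_free[of v] unfolding universal_cstar_algebra_def by auto
  have wd: "eval_free v x = eval_free v y" if "eval_free u x = eval_free u y" for x y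
    using le[of "x - y"] that by (simp add: eval_free_diff)
  define f0 where "f0 z = eval_free v (SOME x. eval_free u x = z)" for z
  have f0: "f0 (eval_free u x) = eval_free v x" for x
    unfolding f0_def by (rule wd) (rule someI_ex, blast)
  have "uniformly_continuous_on ?A f0"
    unfolding uniformly_continuous_on_def
  proof (intro allI impI)
    fix e :: real assume "0 < e"
    then show "\<exists>d>0. \<forall>x\<in>?A. \<forall>x'\<in>?A. dist x' x < d \<longrightarrow> dist (f0 x') (f0 x) < e"
      using le by (intro exI[of _ e])
        (auto simp: f0 dist_norm simp flip: eval_free_diff intro: le_less_trans)
  qed
  then obtain f where f: "uniformly_continuous_on (closure ?A) f" "\<And>x. x \<in> ?A \<Longrightarrow> f0 x = f x"
    using uniformly_continuous_on_extension_on_closure by metis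
  have cont: "continuous_on UNIV f"
    using f(1) dense by (simp add: uniformly_continuous_imp_continuous)
  have fe: "f (eval_free u x) = eval_free v x" for x
    using f(2)[of "eval_free u x"] f0 by simp
  have agree: "g z = h z"
    if "continuous_on UNIV g" "continuous_on UNIV h" "\<And>x. g (eval_free u x) = h (eval_free u x)"
    for g h :: "'a \<Rightarrow> 'b" and z
  proof -
    have "closure ?A \<subseteq> {z. g z = h z}"
      using that by (intro closure_minimal closed_Collect_eq) auto
    then show ?thesis using dense by auto
  qed
  have cont_f: "continuous_on UNIV (\<lambda>z. f (g z))" if "continuous_on UNIV g" for g :: "'a \<Rightarrow> 'a"
    using continuous_on_compose2[OF cont that] by simp
  have cont_scale_f: "continuous_on UNIV (\<lambda>z. c *\<^sub>C f z)" for c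
    using continuous_on_compose2[OF continuous_scaleC[where S = UNIV and c = c] cont] by simp
  have cont_star_f: "continuous_on UNIV (\<lambda>z. (f z)\<^sup>\<star>)"
    using continuous_on_compose2[OF continuous_star[of UNIV] cont] by simp
  have one: "f 1 = 1"
    using fe[of 1] by (simp add: eval_free_one)
  have scale: "f (c *\<^sub>C z) = c *\<^sub>C f z" for c z
    by (rule agree[OF cont_f[OF continuous_scaleC] cont_scale_f])
      (metis eval_free_scaleC fe)
  have star: "f (z\<^sup>\<star>) = (f z)\<^sup>\<star>" for z
    by (rule agree[OF cont_f[OF continuous_star] cont_star_f]) (metis eval_free_star fe)
  have add1: "f (eval_free u x + z) = f (eval_free u x) + f z" for x z
    by (rule agree) (auto intro!: continuous_intros cont_f cont simp: fe simp flip: eval_free_add)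
  have add: "f (y + z) = f y + f z" for y z
    by (rule agree[where z = y]) (auto intro!: continuous_intros cont_f cont simp: add1)
  have mult1: "f (eval_free u x * z) = f (eval_free u x) * f z" for x z
    by (rule agree) (auto intro!: continuous_intros cont_f cont simp: fe simp flip: eval_free_mult)
  have mult: "f (y * z) = f y * f z" for y z
    by (rule agree[where z = y]) (auto intro!: continuous_intros cont_f cont simp: mult1)
  have gens: "f (u i) = v i" for i
    using fe[of "gen i"] by (simp add: eval_free_gen)
  show ?thesis
  proof (rule ex1I[of _ f])
    show "star_hom f \<and> continuous_on UNIV f \<and> (\<forall>i. f (u i) = v i)"
      by (simp add: star_hom_def clinear_map_def one scale star add mult gens cont)
    fix g assume g: "star_hom g \<and> continuous_on UNIV g \<and> (\<forall>i. g (u i) = v i)"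
    show "g = f"
    proof
      fix z
      show "g z = f z"
        by (rule agree) (use g cont in \<open>simp_all add: star_hom_eval_free_comp fe\<close>)
    qed
  qed
qed

section \<open>The minimal tensor product\<close>

definition algebraic_tensor :: "('a \<Rightarrow> 'b \<Rightarrow> 't::comm_monoid_add) \<Rightarrow> 't set" where
  "algebraic_tensor ten = {t. \<exists>(n::nat) x y. t = (\<Sum>i<n. ten (x i) (y i))}"

text \<open>
  \<open>minimal_tensor_product ten\<close> says that \<^typ>\<open>'t\<close> with the elementary tensors \<open>ten x y\<close> is the
  minimal (spatial) C*-tensor product of \<^typ>\<open>'a\<close> and \<^typ>\<open>'b\<close>, i.e. the completion of the
  algebraic tensor product in its least C*-norm. The clause on linearly independent families makes
  \<open>algebraic_tensor ten\<close> a copy of the algebraic tensor product, not a quotient of it.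
\<close>

definition minimal_tensor_product ::
    "('a::cstar_algebra \<Rightarrow> 'b::cstar_algebra \<Rightarrow> 't::cstar_algebra) \<Rightarrow> bool" where
  "minimal_tensor_product ten \<longleftrightarrow>
     (\<forall>x. clinear_map (ten x)) \<and>
     (\<forall>y. clinear_map (\<lambda>x. ten x y)) \<and>
     (\<forall>x x' y y'. ten x y * ten x' y' = ten (x * x') (y * y')) \<and>
     (\<forall>x y. (ten x y)\<^sup>\<star> = ten (x\<^sup>\<star>) (y\<^sup>\<star>)) \<and>
     ten 1 1 = 1 \<and>
     (\<forall>(n::nat) x y. (\<forall>c. (\<Sum>i<n. c i *\<^sub>C y i) = 0 \<longrightarrow> (\<forall>i<n. c i = 0)) \<and>
        (\<Sum>i<n. ten (x i) (y i)) = 0 \<longrightarrow> (\<forall>i<n. x i = 0)) \<and>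
     closure (algebraic_tensor ten) = UNIV \<and>
     (\<forall>p. cstar_norm_on (algebraic_tensor ten) p \<longrightarrow> (\<forall>t\<in>algebraic_tensor ten. norm t \<le> p t))"

text \<open>
  The slice maps \<open>\<phi> \<otimes> id\<close> and \<open>id \<otimes> \<phi>\<close>: being continuous, they are determined by their values
  on elementary tensors.
\<close>

definition left_slice ::
    "('a::cstar_algebra \<Rightarrow> 'b::cstar_algebra \<Rightarrow> 't::cstar_algebra) \<Rightarrow> ('a \<Rightarrow> complex) \<Rightarrow> ('t \<Rightarrow> 'b) \<Rightarrow> bool" where
  "left_slice ten \<phi> S \<longleftrightarrow> clinear_map S \<and> bounded_linear S \<and> (\<forall>x y. S (ten x y) = \<phi> x *\<^sub>C y)"

definition right_slice ::
    "('a::cstar_algebra \<Rightarrow> 'b::cstar_algebra \<Rightarrow> 't::cstar_algebra) \<Rightarrow> ('b \<Rightarrow> complex) \<Rightarrow> ('t \<Rightarrow> 'a) \<Rightarrow> bool" where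
  "right_slice ten \<phi> S \<longleftrightarrow> clinear_map S \<and> bounded_linear S \<and> (\<forall>x y. S (ten x y) = \<phi> y *\<^sub>C x)"

definition haar_state ::
    "('a::cstar_algebra \<Rightarrow> 'a \<Rightarrow> 't::cstar_algebra) \<Rightarrow> ('a \<Rightarrow> 't) \<Rightarrow> ('a \<Rightarrow> complex) \<Rightarrow> bool" where
  "haar_state ten \<Delta> h \<longleftrightarrow> state h \<and>
     (\<exists>S. left_slice ten h S \<and> (\<forall>x. S (\<Delta> x) = h x *\<^sub>C 1)) \<and>
     (\<exists>S. right_slice ten h S \<and> (\<forall>x. S (\<Delta> x) = h x *\<^sub>C 1))"

section \<open>The compact quantum group \<open>U\<^sub>q(2)\<close>\<close>

datatype uq2_generator = Gen_a | Gen_b | Gen_D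

definition uq2_relators :: "complex \<Rightarrow> uq2_generator free_star_algebra set" where
  "uq2_relators q =
     (let a = gen Gen_a; b = gen Gen_b; D = gen Gen_D in
      {b * a - q *\<^sub>C (a * b),
       a\<^sup>\<star> * b - q *\<^sub>C (b * a\<^sup>\<star>),
       b * b\<^sup>\<star> - b\<^sup>\<star> * b,
       a * a\<^sup>\<star> + b * b\<^sup>\<star> - 1,
       a * D - D * a,
       b * D - (q\<^sup>2 / of_real ((cmod q)\<^sup>2)) *\<^sub>C (D * b),
       D * D\<^sup>\<star> - 1,
       D\<^sup>\<star> * D - 1,
       a\<^sup>\<star> * a + of_real ((cmod q)\<^sup>2) *\<^sub>C (b\<^sup>\<star> * b) - 1})"

definition C_Uq2 :: "complex \<Rightarrow> 'a::cstar_algebra \<Rightarrow> 'a \<Rightarrow> 'a \<Rightarrow> bool" where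
  "C_Uq2 q a b D \<longleftrightarrow> universal_cstar_algebra (uq2_relators q) (case_uq2_generator a b D)"

definition uq2_comultiplication ::
    "complex \<Rightarrow> 'a::cstar_algebra \<Rightarrow> 'a \<Rightarrow> 'a \<Rightarrow> ('a \<Rightarrow> 'a \<Rightarrow> 't::cstar_algebra) \<Rightarrow> ('a \<Rightarrow> 't) \<Rightarrow> bool" where
  "uq2_comultiplication q a b D ten \<Delta> \<longleftrightarrow> star_hom \<Delta> \<and>
     \<Delta> a = ten a a - cnj q *\<^sub>C ten b (D * b\<^sup>\<star>) \<and>
     \<Delta> b = ten a b + ten b (D * a\<^sup>\<star>) \<and>
     \<Delta> D = ten D D"

lemma C_Uq2_relations:
  assumes "C_Uq2 q a b D"
  shows "b * a = q *\<^sub>C (a * b)" "a\<^sup>\<star> * b = q *\<^sub>C (b * a\<^sup>\<star>)" "b * b\<^sup>\<star> = b\<^sup>\<star> * b"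
    "a * a\<^sup>\<star> + b * b\<^sup>\<star> = 1" "a * D = D * a" "b * D = (q\<^sup>2 / of_real ((cmod q)\<^sup>2)) *\<^sub>C (D * b)"
    "D * D\<^sup>\<star> = 1" "D\<^sup>\<star> * D = 1" "a\<^sup>\<star> * a + of_real ((cmod q)\<^sup>2) *\<^sub>C (b\<^sup>\<star> * b) = 1"
proof -
  have "\<forall>r\<in>uq2_relators q. eval_free (case_uq2_generator a b D) r = 0"
    using assms by (simp add: C_Uq2_def universal_cstar_algebra_def)
  note * = this[unfolded uq2_relators_def Let_def, simplified ball_simps eval_free_diff eval_free_add
      eval_free_mult eval_free_star eval_free_scaleC eval_free_one eval_free_gen
      uq2_generator.case right_minus_eq]
  show "b * a = q *\<^sub>C (a * b)" "a\<^sup>\<star> * b = q *\<^sub>C (b * a\<^sup>\<star>)" "b * b\<^sup>\<star> = b\<^sup>\<star> * b"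
    "a * a\<^sup>\<star> + b * b\<^sup>\<star> = 1" "a * D = D * a" "b * D = (q\<^sup>2 / of_real ((cmod q)\<^sup>2)) *\<^sub>C (D * b)"
    "D * D\<^sup>\<star> = 1" "D\<^sup>\<star> * D = 1" "a\<^sup>\<star> * a + of_real ((cmod q)\<^sup>2) *\<^sub>C (b\<^sup>\<star> * b) = 1"
    using * by blast+
qed

end

theory Submission
  imports Defs "HOL-Computational_Algebra.Polynomial"
begin

text \<open>
  Put \<open>s = |q|\<^sup>2\<close> and \<open>c = b b\<^sup>\<star>\<close>, so that \<open>c a = s a c\<close> and \<open>a a\<^sup>\<star> = 1 - c\<close>. The torus acts on
  the algebra by rescaling the generators, and the Haar state is invariant because these automorphisms
  are compositions of slices of the comultiplication with characters. Hence the null space of the Haar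
  state, a closed left ideal, contains with any nonzero \<open>x\<close> a nonzero Fourier component \<open>y\<close> of \<open>x\<close>, and
  \<open>f = y\<^sup>\<star> y\<close> lies in the closure of the polynomials in \<open>c\<close>. The powers of \<open>c\<close> converge to
  a projection \<open>e\<close> with \<open>e a = 0\<close>; compressing the invariance identity by \<open>e\<close> shows
  that the Haar state is the Jackson integral on polynomials in \<open>c\<close>, so \<open>f\<close> vanishes at every point
  \<open>s\<^sup>m\<close> of the spectrum of \<open>c\<close>. As \<open>0\<close> is not isolated in this spectrum, \<open>f = 0\<close>.
\<close>

section \<open>Elementary C*-algebra and the projection \<open>e\<close>\<close>

text \<open>The algebra is known only through its universal property, so every spectral statement
  about \<open>c\<close> has to come from norm estimates. Their common source is that
  \<open>c ^ n - c ^ Suc n\<close> carries the factor \<open>s ^ n\<close>. Evaluation at the point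
  \<open>s ^ m\<close> is expressed inside the algebra: \<open>e * (a\<^sup>\<star>) ^ m\<close> is
  a left eigenvector of \<open>c\<close> for that eigenvalue. The relations alone admit
  \<open>b = 0\<close>, where \<open>e\<close> vanishes; a representation that bounds the norm of
  \<open>b\<close> from below excludes this. The Jackson integral is forced: the compressed
  invariance reads \<open>h (c ^ m) = h ((a\<^sup>\<star>) ^ m * a ^ m)\<close>, the argument on the
  right is a Pochhammer polynomial in \<open>c\<close>, and a linear functional with this property
  is determined by its value at 1. Vanishing at all \<open>s ^ m\<close> could still leave an
  \<open>f\<close> concentrated at \<open>c = 0\<close>, that is, one that only the quotient by
  \<open>b\<close> sees. The polynomials approximating \<open>f\<close> are small at all
  \<open>s ^ m\<close> uniformly in \<open>m\<close>, hence small at 0, and this removes that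
  case.\<close>

context complex_star_algebra_1
begin

lemma scaleC_minus_left: "(- k) *\<^sub>C x = - (k *\<^sub>C x)"
  using scaleC_add_left[of "- k" k x] by (simp add: scaleC_zero_left eq_neg_iff_add_eq_0)

lemma scaleC_minus_right: "k *\<^sub>C (- x) = - (k *\<^sub>C x)"
  using scaleC_add_right[of k "- x" x] by (simp add: scaleC_zero_right eq_neg_iff_add_eq_0)

lemma scaleC_diff_right: "k *\<^sub>C (x - y) = k *\<^sub>C x - k *\<^sub>C y"
  using scaleC_add_right[of k x "- y"] by (simp add: scaleC_minus_right)

lemma scaleC_diff_left: "(k - l) *\<^sub>C x = k *\<^sub>C x - l *\<^sub>C x"
  using scaleC_add_left[of k "- l" x] by (simp add: scaleC_minus_left)

lemma scaleC_sum_right: "k *\<^sub>C (\<Sum>i\<in>A. f i) = (\<Sum>i\<in>A. k *\<^sub>C f i)"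
  by (induction A rule: infinite_finite_induct) (simp_all add: scaleC_zero_right scaleC_add_right)

lemma scaleC_sum_left: "(\<Sum>i\<in>A. k i) *\<^sub>C x = (\<Sum>i\<in>A. k i *\<^sub>C x)"
  by (induction A rule: infinite_finite_induct) (simp_all add: scaleC_zero_left scaleC_add_left)

lemma star_power: "(x ^ n)\<^sup>\<star> = (x\<^sup>\<star>) ^ n"
  by (induction n) (simp_all add: star_one star_mult power_commutes)

lemma scaleC_power: "(k *\<^sub>C x) ^ n = k ^ n *\<^sub>C x ^ n"
  by (induction n) (simp_all add: scaleC_one mult_scaleC_left mult_scaleC_right scaleC_scaleC mult.commute)

lemmas scaleC_mult = mult_scaleC_left mult_scaleC_right scaleC_scaleC

end

section \<open>Norm identities from the C*-axioms\<close>

lemma bounded_linear_star: "bounded_linear (star :: 'a::cstar_algebra \<Rightarrow> 'a)"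
  by (rule bounded_linear_intro[where K = 1])
    (simp_all add: star_add scaleR_scaleC star_scaleC norm_star)

lemma bounded_bilinear_scaleC:
  "bounded_bilinear (scaleC :: complex \<Rightarrow> 'a::cstar_algebra \<Rightarrow> 'a)"
proof
  show "\<exists>K. \<forall>k (x::'a). norm (k *\<^sub>C x) \<le> norm k * norm x * K"
    by (rule exI[of _ 1]) (simp add: norm_scaleC)
qed (simp_all add: scaleC_add_left scaleC_add_right scaleR_scaleC scaleC_scaleC scaleC_complex_def
    mult.commute)

lemmas tendsto_star [tendsto_intros] = bounded_linear.tendsto[OF bounded_linear_star]
lemmas tendsto_scaleC [tendsto_intros] = bounded_bilinear.tendsto[OF bounded_bilinear_scaleC]

lemma norm_mult_star: "norm (x * x\<^sup>\<star>) = (norm (x :: 'a::cstar_algebra))\<^sup>2"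
  using cstar_identity[of "x\<^sup>\<star>"] by (simp add: star_star norm_star)

lemma star_mult_self_eq_0: "x\<^sup>\<star> * x = 0 \<longleftrightarrow> (x :: 'a::cstar_algebra) = 0"
  using cstar_identity[of x] by auto

text \<open>Stands in for the spectral radius formula: for selfadjoint elements the C*-identity
  squares the norm at every doubling of the exponent.\<close>

lemma norm_selfadjoint_power:
  fixes x :: "'a::cstar_algebra"
  assumes "x\<^sup>\<star> = x"
  shows "norm (x ^ 2 ^ n) = norm x ^ 2 ^ n"
proof (induction n)
  case (Suc n)
  have "x ^ 2 ^ Suc n = (x ^ 2 ^ n)\<^sup>\<star> * x ^ 2 ^ n"
    using assms by (simp add: star_power mult_2 power_add)
  then show ?case
    using Suc by (simp add: cstar_identity power2_eq_square mult_2 power_add)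
qed simp

text \<open>Horner scheme. The coefficients are complex numbers while the argument lies in the
  algebra, so \<open>poly\<close> does not apply.\<close>

definition peval :: "'a::complex_star_algebra_1 \<Rightarrow> complex poly \<Rightarrow> 'a" where
  "peval x p = fold_coeffs (\<lambda>k y. k *\<^sub>C 1 + x * y) p 0"

lemma peval_0 [simp]: "peval x 0 = 0"
  by (simp add: peval_def)

lemma peval_pCons: "peval x (pCons k p) = k *\<^sub>C 1 + x * peval x p"
  by (cases "p = 0 \<and> k = 0") (auto simp: peval_def scaleC_zero_left)

lemma peval_add: "peval x (p + r) = peval x p + peval x r"
  by (induction p r rule: poly_induct2) (simp_all add: peval_pCons scaleC_add_left algebra_simps)

lemma peval_smult: "peval x (smult k p) = k *\<^sub>C peval x p"
  by (induction p) (simp_all add: peval_pCons scaleC_zero_right scaleC_add_right scaleC_scaleC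
      mult_scaleC_right)

lemma peval_1 [simp]: "peval x 1 = 1"
  by (simp add: one_pCons peval_pCons scaleC_one)

lemma peval_mult: "peval x (p * r) = peval x p * peval x r"
  by (induction p)
    (simp_all add: peval_pCons peval_add peval_smult distrib_right mult_scaleC_left mult.assoc
      scaleC_zero_left)

lemma peval_power: "peval x (p ^ n) = peval x p ^ n"
  by (induction n) (simp_all add: peval_mult)

lemma peval_X: "peval x [:0, 1:] = x"
  by (simp add: peval_pCons scaleC_one scaleC_zero_left)

lemma star_peval:
  assumes "x\<^sup>\<star> = x"
  shows "(peval x p)\<^sup>\<star> = peval x (map_poly cnj p)"
proof -
  have comm: "peval x r * x = x * peval x r" for r
    by (induction r) (simp_all add: peval_pCons algebra_simps mult_scaleC_left mult_scaleC_right)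
  show ?thesis
  proof (induction p)
    case (pCons k p)
    then show ?case
      using comm by (simp add: peval_pCons map_poly_pCons star_add star_mult star_scaleC star_one assms)
  qed (simp add: star_zero)
qed

text \<open>Relations without universality: what is proved here holds for every such triple,
  \<open>b = 0\<close> included, which is why \<open>e \<noteq> 0\<close> appears as a hypothesis
  below.\<close>

locale uq2_relations =
  fixes q :: complex and a b D :: "'a::cstar_algebra"
  assumes q_pos: "0 < cmod q" and q_less_1: "cmod q < 1"
    and ba: "b * a = q *\<^sub>C (a * b)"
    and a'b: "a\<^sup>\<star> * b = q *\<^sub>C (b * a\<^sup>\<star>)"
    and b_normal: "b * b\<^sup>\<star> = b\<^sup>\<star> * b"
    and aa': "a * a\<^sup>\<star> + b * b\<^sup>\<star> = 1"
    and aD: "a * D = D * a"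
    and bD: "b * D = (q\<^sup>2 / of_real ((cmod q)\<^sup>2)) *\<^sub>C (D * b)"
    and DD': "D * D\<^sup>\<star> = 1"
    and D'D: "D\<^sup>\<star> * D = 1"
    and a'a: "a\<^sup>\<star> * a + of_real ((cmod q)\<^sup>2) *\<^sub>C (b\<^sup>\<star> * b) = 1"
begin

section \<open>Commutation relations for \<open>c\<close>, \<open>a\<close>, \<open>b\<close> and
  \<open>D\<close>\<close>

definition s :: real where "s = (cmod q)\<^sup>2"
definition \<omega> :: complex where "\<omega> = q\<^sup>2 / of_real s"
definition c :: 'a where "c = b * b\<^sup>\<star>"

lemma s_pos: "0 < s" and s_less_1: "s < 1"
  using q_pos q_less_1 by (auto simp: s_def power_less_one_iff abs_square_less_1)

lemma q_cnj: "q * cnj q = of_real s" "cnj q * q = of_real s"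
  by (simp_all add: s_def complex_norm_square mult.commute flip: of_real_power)

lemma norm_\<omega>: "cmod \<omega> = 1"
  using q_pos by (simp add: \<omega>_def s_def norm_divide norm_power)

lemma \<omega>_cnj: "\<omega> * cnj \<omega> = 1" "cnj \<omega> * \<omega> = 1"
  using norm_\<omega> by (simp_all add: complex_norm_square[symmetric] mult.commute)

lemma c_star: "c\<^sup>\<star> = c"
  by (simp add: c_def star_mult star_star)

lemma c_alt: "c = b\<^sup>\<star> * b"
  by (simp add: c_def b_normal)

lemma aa'_c: "a * a\<^sup>\<star> = 1 - c"
  using aa' by (simp add: c_def algebra_simps)

lemma a'a_c: "a\<^sup>\<star> * a = 1 - of_real s *\<^sub>C c"
  using a'a by (simp add: c_alt s_def algebra_simps)

lemma b'a: "b\<^sup>\<star> * a = cnj q *\<^sub>C (a * b\<^sup>\<star>)"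
  using arg_cong[OF a'b, of star] by (simp add: star_mult star_scaleC star_star)

lemma D'a: "D\<^sup>\<star> * a = a * D\<^sup>\<star>"
proof -
  have "D\<^sup>\<star> * a = D\<^sup>\<star> * (a * D) * D\<^sup>\<star>"
    by (simp add: mult.assoc DD')
  also have "\<dots> = (D\<^sup>\<star> * D) * a * D\<^sup>\<star>"
    by (simp only: aD mult.assoc)
  finally show ?thesis
    by (simp add: D'D)
qed

lemma a'D: "a\<^sup>\<star> * D = D * a\<^sup>\<star>"
  using arg_cong[OF D'a, of star] by (simp add: star_mult star_star)

lemma bD_\<omega>: "b * D = \<omega> *\<^sub>C (D * b)"
  using bD by (simp add: \<omega>_def s_def)

lemma bD': "b * D\<^sup>\<star> = cnj \<omega> *\<^sub>C (D\<^sup>\<star> * b)"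
proof -
  have "D\<^sup>\<star> * b = D\<^sup>\<star> * (b * D) * D\<^sup>\<star>"
    by (simp add: mult.assoc DD')
  also have "\<dots> = \<omega> *\<^sub>C ((D\<^sup>\<star> * D) * b * D\<^sup>\<star>)"
    by (simp only: bD_\<omega> mult.assoc mult_scaleC_left mult_scaleC_right)
  finally show ?thesis
    by (simp add: D'D scaleC_scaleC \<omega>_cnj scaleC_one)
qed

lemma b'D: "b\<^sup>\<star> * D = cnj \<omega> *\<^sub>C (D * b\<^sup>\<star>)"
  using arg_cong[OF bD', of star]
  by (simp add: star_mult star_star star_scaleC scaleC_scaleC \<omega>_cnj scaleC_one)

lemma c_b: "c * b = b * c" and c_b': "c * b\<^sup>\<star> = b\<^sup>\<star> * c"
  by (simp_all add: c_def mult.assoc b_normal) (simp add: b_normal flip: mult.assoc)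

lemma c_a: "c * a = of_real s *\<^sub>C (a * c)"
proof -
  have "c * a = cnj q *\<^sub>C ((b * a) * b\<^sup>\<star>)"
    by (simp add: c_def mult.assoc b'a mult_scaleC_right)
  then show ?thesis
    by (simp add: ba scaleC_mult mult.assoc q_cnj c_def)
qed

lemma c_D: "c * D = D * c"
proof -
  have "c * D = cnj \<omega> *\<^sub>C ((b * D) * b\<^sup>\<star>)"
    by (simp add: c_def mult.assoc b'D mult_scaleC_right)
  then show ?thesis
    by (simp add: bD_\<omega> scaleC_mult mult.assoc \<omega>_cnj c_def scaleC_one)
qed

lemma c_D': "c * D\<^sup>\<star> = D\<^sup>\<star> * c"
  using arg_cong[OF c_D, of star] by (simp add: star_mult c_star)

section \<open>Powers of \<open>c\<close>: commutation, norm bounds, convergence\<close>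

lemma cpow_a: "c ^ n * a = of_real s ^ n *\<^sub>C (a * c ^ n)"
proof (induction n)
  case (Suc n)
  have "c ^ Suc n * a = c * (c ^ n * a)"
    by (simp add: mult.assoc)
  also have "\<dots> = of_real s ^ n *\<^sub>C ((c * a) * c ^ n)"
    by (simp only: Suc mult_scaleC_right mult.assoc)
  finally show ?case
    by (simp add: c_a scaleC_mult mult.assoc mult.commute)
qed (simp add: scaleC_one)

lemma c_apow: "c * a ^ n = of_real s ^ n *\<^sub>C (a ^ n * c)"
proof (induction n)
  case (Suc n)
  have "c * a ^ Suc n = (c * a) * a ^ n"
    by (simp add: mult.assoc)
  also have "\<dots> = of_real s *\<^sub>C (a * (c * a ^ n))"
    by (simp add: c_a mult_scaleC_left mult.assoc)
  finally show ?case
    by (simp add: Suc scaleC_mult mult.assoc mult.commute)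
qed (simp add: scaleC_one)

lemma a'pow_c: "(a\<^sup>\<star>) ^ n * c = of_real s ^ n *\<^sub>C (c * (a\<^sup>\<star>) ^ n)"
  using arg_cong[OF c_apow[of n], of star] by (simp add: star_mult star_scaleC c_star star_power)

text \<open>By the C*-identity \<open>1 - c\<close> and \<open>1 - of_real s *\<^sub>C c\<close>
  both have norm \<open>(norm a)\<^sup>2\<close>, and the second is the convex combination of 1 and
  the first with weights \<open>1 - s\<close> and \<open>s\<close>. No order on the algebra is
  involved.\<close>

lemma norm_a_le_1: "norm a \<le> 1"
proof -
  have M: "norm (1 - c) = (norm a)\<^sup>2" "norm (1 - of_real s *\<^sub>C c) = (norm a)\<^sup>2"
    by (simp_all flip: aa'_c a'a_c add: norm_mult_star cstar_identity)
  have "1 - of_real s *\<^sub>C c = of_real (1 - s) *\<^sub>C 1 + of_real s *\<^sub>C (1 - c)"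
    by (simp add: scaleC_diff_right scaleC_diff_left scaleC_one)
  then have "(norm a)\<^sup>2 \<le> norm (of_real (1 - s) *\<^sub>C (1::'a)) + norm (of_real s *\<^sub>C (1 - c))"
    using M(2) norm_triangle_ineq by metis
  also have "\<dots> = (1 - s) + s * (norm a)\<^sup>2"
    using s_pos s_less_1 by (simp only: norm_scaleC M norm_of_real norm_one) simp
  finally have "(1 - s) * (norm a)\<^sup>2 \<le> (1 - s) * 1"
    by (simp add: algebra_simps)
  then have "(norm a)\<^sup>2 \<le> 1"
    using s_less_1 by simp
  then show ?thesis
    by (simp add: power_le_one_iff abs_square_le_1)
qed

lemma norm_a'_le_1: "norm (a\<^sup>\<star>) \<le> 1"
  by (simp add: norm_star norm_a_le_1)

text \<open>Since \<open>1 - c = a * a\<^sup>\<star>\<close>, moving this \<open>a\<close> to the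
  left past \<open>c ^ n\<close> produces the factor \<open>s ^ n\<close>. All telescoping arguments
  below rest on it.\<close>

lemma cpow_diff: "c ^ n - c ^ Suc n = of_real s ^ n *\<^sub>C (a * c ^ n * a\<^sup>\<star>)"
proof -
  have "c ^ n - c ^ Suc n = c ^ n * (a * a\<^sup>\<star>)"
    by (simp add: aa'_c algebra_simps power_commutes)
  also have "\<dots> = (c ^ n * a) * a\<^sup>\<star>"
    by (simp add: mult.assoc)
  finally show ?thesis
    by (simp add: cpow_a mult_scaleC_left)
qed

lemma norm_a_mult_le: "norm (a * x) \<le> norm x" "norm (x * a\<^sup>\<star>) \<le> norm x" "norm (a\<^sup>\<star> * x) \<le> norm x"
proof -
  have "norm a * norm x \<le> 1 * norm x" "norm x * norm (a\<^sup>\<star>) \<le> norm x * 1" "norm (a\<^sup>\<star>) * norm x \<le> 1 * norm x"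
    by (intro mult_right_mono mult_left_mono norm_a_le_1 norm_a'_le_1 norm_ge_zero)+
  then show "norm (a * x) \<le> norm x" "norm (x * a\<^sup>\<star>) \<le> norm x" "norm (a\<^sup>\<star> * x) \<le> norm x"
    using norm_mult_ineq[of a x] norm_mult_ineq[of x "a\<^sup>\<star>"] norm_mult_ineq[of "a\<^sup>\<star>" x] by simp_all
qed

lemma norm_cpow_diff: "norm (c ^ n - c ^ Suc n) \<le> s ^ n * norm (c ^ n)"
proof -
  have "norm (a * c ^ n * a\<^sup>\<star>) \<le> norm (c ^ n)"
    by (rule order_trans[OF norm_a_mult_le(2) norm_a_mult_le(1)])
  then show ?thesis
    using s_pos by (simp only: cpow_diff norm_scaleC) (simp add: norm_power mult_left_mono)
qed

text \<open>A crude first bound: \<open>norm_cpow_diff\<close> still contains the norm of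
  \<open>c ^ n\<close>, so it only gives a recursion with factor \<open>1 + s ^ n\<close>; the
  product of these factors stays bounded.\<close>

lemma norm_cpow_bound: "norm (c ^ n) \<le> exp (1 / (1 - s))"
proof -
  have "norm (c ^ n) \<le> exp (\<Sum>k<n. s ^ k)"
  proof (induction n)
    case (Suc n)
    have "norm (c ^ Suc n) \<le> norm (c ^ n) + norm (c ^ n - c ^ Suc n)"
      using norm_triangle_ineq4[of "c ^ n" "c ^ n - c ^ Suc n"] by simp
    also have "\<dots> \<le> (1 + s ^ n) * norm (c ^ n)"
      using norm_cpow_diff[of n] by (simp add: algebra_simps)
    also have "\<dots> \<le> exp (s ^ n) * exp (\<Sum>k<n. s ^ k)"
      using s_pos Suc by (intro mult_mono exp_ge_add_one_self) auto
    finally show ?case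
      by (simp add: exp_add mult.commute)
  qed simp
  also have "(\<Sum>k<n. s ^ k) \<le> 1 / (1 - s)"
    using s_pos s_less_1 sum_le_suminf[of "\<lambda>k. s ^ k" "{..<n}"]
    by (simp add: suminf_geometric summable_geometric)
  finally show ?thesis by simp
qed

text \<open>A power-bounded selfadjoint element is a contraction, for otherwise its powers with
  exponent \<open>2 ^ n\<close> would be unbounded.\<close>

lemma norm_c_le_1: "norm c \<le> 1"
proof (rule ccontr)
  assume "\<not> norm c \<le> 1"
  then obtain n where n: "exp (1 / (1 - s)) < norm c ^ n"
    using real_arch_pow[of "norm c" "exp (1 / (1 - s))"] by auto
  have "norm c ^ n \<le> norm c ^ 2 ^ n"
    using \<open>\<not> norm c \<le> 1\<close> by (intro power_increasing) (auto simp: less_imp_le)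
  also have "\<dots> \<le> exp (1 / (1 - s))"
    using norm_cpow_bound[of "2 ^ n"] by (simp add: norm_selfadjoint_power c_star)
  finally show False
    using n by simp
qed

lemma norm_c_mult_le: "norm (c * x) \<le> norm x"
  using norm_mult_ineq[of c x] mult_right_mono[OF norm_c_le_1, of "norm x"] by simp

lemma norm_cpow_add_mult_le: "norm (c ^ (m + n) * x) \<le> norm (c ^ m * x)"
proof (induction n)
  case (Suc n)
  then show ?case
    using norm_c_mult_le[of "c ^ (m + n) * x"] by (simp add: mult.assoc)
qed simp

lemma norm_cpow_le_1: "norm (c ^ n) \<le> 1"
  using norm_cpow_add_mult_le[of 0 n 1] by simp

lemma cpow_converges: "convergent (\<lambda>n. c ^ n)"
proof -
  have "summable (\<lambda>n. c ^ Suc n - c ^ n)"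
  proof (rule summable_comparison_test'[where N = 0])
    show "summable (\<lambda>n. s ^ n)"
      using s_pos s_less_1 by (simp add: summable_geometric)
    show "norm (c ^ Suc n - c ^ n) \<le> s ^ n" for n
    proof -
      have "norm (c ^ Suc n - c ^ n) \<le> s ^ n * norm (c ^ n)"
        using norm_cpow_diff[of n] by (simp only: norm_minus_commute[of "c ^ Suc n"])
      also have "\<dots> \<le> s ^ n"
        using norm_cpow_le_1[of n] s_pos by (intro mult_right_le_one_le) auto
      finally show ?thesis .
    qed
  qed
  then have "convergent (\<lambda>n. \<Sum>k<n. c ^ Suc k - c ^ k)"
    by (simp add: summable_iff_convergent)
  then have "convergent (\<lambda>n. c ^ n - c ^ 0)"
    by (simp only: sum_lessThan_telescope)
  from convergent_add[OF this convergent_const[of 1]] show ?thesis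
    by simp
qed

section \<open>The spectral projection \<open>e\<close> of \<open>c\<close> at the eigenvalue
  1\<close>

definition e :: 'a where "e = lim (\<lambda>n. c ^ n)"

lemma cpow_tendsto_e: "(\<lambda>n. c ^ n) \<longlonglongrightarrow> e"
  using cpow_converges by (simp add: e_def convergent_LIMSEQ_iff)

lemma e_star: "e\<^sup>\<star> = e"
  using tendsto_star[OF cpow_tendsto_e] cpow_tendsto_e
  by (simp add: star_power c_star LIMSEQ_unique)

lemma e_c: "e * c = e" and c_e: "c * e = e"
proof -
  have lim: "(\<lambda>n. c ^ Suc n) \<longlonglongrightarrow> e"
    using cpow_tendsto_e by (rule LIMSEQ_Suc)
  show "e * c = e"
    using tendsto_mult_right[OF cpow_tendsto_e, of c] lim
    by (simp add: power_commutes LIMSEQ_unique)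
  show "c * e = e"
    using tendsto_mult_left[OF cpow_tendsto_e, of c] lim by (simp add: LIMSEQ_unique)
qed

lemma e_a: "e * a = 0"
proof -
  have "(\<lambda>n. of_real s ^ n *\<^sub>C (a * c ^ n)) \<longlonglongrightarrow> 0 *\<^sub>C (a * e)"
    using s_pos s_less_1
    by (intro tendsto_intros cpow_tendsto_e LIMSEQ_power_zero) simp
  moreover have "(\<lambda>n. c ^ n * a) \<longlonglongrightarrow> e * a"
    by (intro tendsto_intros cpow_tendsto_e)
  ultimately show ?thesis
    by (simp add: cpow_a scaleC_zero_left LIMSEQ_unique)
qed

lemma a'_e: "a\<^sup>\<star> * e = 0"
  using arg_cong[OF e_a, of star] by (simp add: star_mult e_star star_zero)

text \<open>The norms of the powers of \<open>c\<close> decrease, while those with exponent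
  \<open>2 ^ n\<close> are powers of \<open>norm c\<close>, hence at least 1. So all of them are at
  least 1, and the bound passes to the limit.\<close>

lemma e_nonzero:
  assumes "1 \<le> norm b"
  shows "e \<noteq> 0"
proof
  assume "e = 0"
  have "1 \<le> norm (c ^ n)" for n
  proof -
    have "1 \<le> norm c ^ 2 ^ n"
      using assms by (simp add: c_def norm_mult_star one_le_power)
    also have "\<dots> = norm (c ^ (n + (2 ^ n - n)) * 1)"
      using norm_selfadjoint_power[OF c_star, of n] less_exp[of n] by simp
    also have "\<dots> \<le> norm (c ^ n)"
      using norm_cpow_add_mult_le[of n "2 ^ n - n" 1] by simp
    finally show ?thesis .
  qed
  then have "1 \<le> norm e"
    using tendsto_norm[OF cpow_tendsto_e] by (intro LIMSEQ_le_const) auto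
  then show False
    using \<open>e = 0\<close> by simp
qed

text \<open>\<open>a\<^sup>\<star>\<close> takes \<open>a ^ Suc m * e\<close> back to
  \<open>a ^ m * e\<close> with the nonzero weight \<open>1 - s ^ Suc m\<close>.\<close>

lemma a_pow_e_nonzero:
  assumes "e \<noteq> 0"
  shows "a ^ m * e \<noteq> 0"
proof (induction m)
  case (Suc m)
  have "a\<^sup>\<star> * (a ^ Suc m * e) = (a\<^sup>\<star> * a) * (a ^ m * e)"
    by (simp add: mult.assoc)
  also have "\<dots> = a ^ m * e - of_real s *\<^sub>C ((c * a ^ m) * e)"
    by (simp add: a'a_c left_diff_distrib mult_scaleC_left mult.assoc)
  also have "\<dots> = of_real (1 - s ^ Suc m) *\<^sub>C (a ^ m * e)"
    by (simp add: c_apow scaleC_mult mult.assoc c_e scaleC_diff_left scaleC_one)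
  finally have "norm (a\<^sup>\<star> * (a ^ Suc m * e)) = \<bar>1 - s ^ Suc m\<bar> * norm (a ^ m * e)"
    by (simp only: norm_scaleC norm_of_real)
  moreover have "s ^ Suc m < 1"
    using s_pos s_less_1 by (intro power_Suc_less_one)
  ultimately show ?case
    using Suc by auto
qed (use assms in simp)

lemma e_a'pow_nonzero:
  assumes "e \<noteq> 0"
  shows "e * (a\<^sup>\<star>) ^ m \<noteq> 0"
proof -
  have "e * (a\<^sup>\<star>) ^ m = (a ^ m * e)\<^sup>\<star>"
    by (simp add: star_mult star_power e_star)
  then show ?thesis
    using a_pow_e_nonzero[OF assms, of m] star_star star_zero by metis
qed

text \<open>Left multiplication by \<open>e * (a\<^sup>\<star>) ^ m\<close> turns a polynomial in
  \<open>c\<close> into its value at \<open>s ^ m\<close>; this replaces functional calculus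
  throughout.\<close>

lemma e_a'pow_peval: "e * (a\<^sup>\<star>) ^ m * peval c p = poly p (of_real (s ^ m)) *\<^sub>C (e * (a\<^sup>\<star>) ^ m)"
proof (induction p)
  case (pCons k p)
  have "e * (a\<^sup>\<star>) ^ m * c = of_real s ^ m *\<^sub>C ((e * c) * (a\<^sup>\<star>) ^ m)"
    by (simp add: mult.assoc a'pow_c mult_scaleC_right)
  then have "e * (a\<^sup>\<star>) ^ m * (c * peval c p) = of_real s ^ m *\<^sub>C (e * (a\<^sup>\<star>) ^ m * peval c p)"
    by (simp add: e_c mult_scaleC_left flip: mult.assoc)
  then show ?case
    using pCons by (simp add: peval_pCons distrib_left mult_scaleC_right scaleC_scaleC scaleC_add_left)
qed (simp add: scaleC_zero_left)

text \<open>As \<open>c ^ k * z\<close> tends to \<open>e * z = 0\<close>, the element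
  \<open>c ^ n * z\<close> is a telescoping sum of the differences in \<open>cpow_diff\<close>. Each
  of them contains \<open>a\<^sup>\<star> * z\<close>, and their coefficients add up to
  \<open>s ^ n / (1 - s)\<close>.\<close>

lemma annihilated_step:
  assumes "e * z = 0"
  shows "norm (c ^ n * z) \<le> s ^ n / (1 - s) * norm (c ^ n * (a\<^sup>\<star> * z))"
proof -
  let ?B = "norm (c ^ n * (a\<^sup>\<star> * z))"
  have bound: "norm (c ^ n * z) \<le> s ^ n / (1 - s) * ?B + norm (c ^ (n + k) * z)" for k
  proof -
    have "norm (c ^ n * z) \<le> (\<Sum>j<k. s ^ n * s ^ j * ?B) + norm (c ^ (n + k) * z)"
    proof (induction k)
      case (Suc k)
      have "norm (c ^ (n + k) * z - c ^ (n + Suc k) * z)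
          = s ^ (n + k) * norm (a * (c ^ (n + k) * (a\<^sup>\<star> * z)))"
        using s_pos
        by (simp only: left_diff_distrib[symmetric] add_Suc_right cpow_diff mult_scaleC_left
            norm_scaleC mult.assoc) (simp add: norm_mult norm_power)
      also have "\<dots> \<le> s ^ (n + k) * ?B"
        using s_pos norm_a_mult_le(1) norm_cpow_add_mult_le[of n k "a\<^sup>\<star> * z"]
        by (intro mult_left_mono) (auto intro: order_trans)
      finally have "norm (c ^ (n + k) * z) \<le> s ^ n * s ^ k * ?B + norm (c ^ (n + Suc k) * z)"
        using norm_triangle_ineq[of "c ^ (n + k) * z - c ^ (n + Suc k) * z" "c ^ (n + Suc k) * z"]
        by (simp add: power_add)
      then show ?case
        using Suc by simp
    qed simp
    also have "(\<Sum>j<k. s ^ n * s ^ j * ?B) = s ^ n * ?B * (\<Sum>j<k. s ^ j)"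
      by (simp add: sum_distrib_left sum_distrib_right mult_ac)
    also have "(\<Sum>j<k. s ^ j) \<le> 1 / (1 - s)"
      using s_pos s_less_1 sum_le_suminf[of "\<lambda>k. s ^ k" "{..<k}"]
      by (simp add: suminf_geometric summable_geometric)
    finally show ?thesis
      using s_pos by (simp add: mult_left_mono)
  qed
  have "(\<lambda>k. c ^ (k + n) * z) \<longlonglongrightarrow> e * z"
    by (intro tendsto_intros LIMSEQ_ignore_initial_segment cpow_tendsto_e)
  then have "(\<lambda>k. s ^ n / (1 - s) * ?B + norm (c ^ (n + k) * z)) \<longlonglongrightarrow> s ^ n / (1 - s) * ?B + norm (0 :: 'a)"
    using assms by (intro tendsto_intros) (simp add: add.commute)
  then show ?thesis
    using bound by (intro LIMSEQ_le_const[where X = "\<lambda>k. s ^ n / (1 - s) * ?B + norm (c ^ (n + k) * z)"])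
      auto
qed

text \<open>For selfadjoint \<open>c\<close>, the C*-identity reduces
  \<open>c ^ Suc n * z = 0\<close> to a product with the right factor
  \<open>c ^ Suc (Suc n) * z\<close>, so the exponent can be lowered one by one.\<close>

lemma cpow_mult_eq_0:
  assumes "c ^ Suc n * z = 0"
  shows "c * z = 0"
  using assms
proof (induction n)
  case (Suc n)
  have "(c ^ Suc n * z)\<^sup>\<star> * (c ^ Suc n * z) = z\<^sup>\<star> * (c ^ (Suc n + Suc n) * z)"
    by (simp only: star_mult star_power c_star mult.assoc power_add)
  also have "\<dots> = z\<^sup>\<star> * (c ^ n * (c ^ Suc (Suc n) * z))"
  proof -
    have "Suc n + Suc n = n + Suc (Suc n)"
      by simp
    then show ?thesis
      by (simp only: power_add mult.assoc)
  qed
  finally have "(c ^ Suc n * z)\<^sup>\<star> * (c ^ Suc n * z) = z\<^sup>\<star> * (c ^ n * (c ^ Suc (Suc n) * z))" .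
  then show ?case
    using Suc star_mult_self_eq_0[of "c ^ Suc n * z"] by simp
qed simp

text \<open>The vectors \<open>a\<^sup>m e\<close> span a dense part of the range of \<open>c\<close>.\<close>

lemma c_mult_eq_0:
  assumes "\<And>m. e * (a\<^sup>\<star>) ^ m * z = 0"
  shows "c * z = 0"
proof -
  have "(\<lambda>n. s ^ n) \<longlonglongrightarrow> 0"
    using s_pos s_less_1 by (simp add: LIMSEQ_power_zero)
  \<comment> \<open>For such an exponent the factor in \<open>annihilated_step\<close> is at most
    1/2. Iterating it over \<open>(a\<^sup>\<star>) ^ i * z\<close> gives decay like
    \<open>(1 / 2) ^ i\<close>, because the contraction \<open>a\<^sup>\<star>\<close> keeps the
    right-hand norms bounded.\<close>
  then have "eventually (\<lambda>n. s ^ n < (1 - s) / 2) sequentially"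
    using s_less_1 by (intro order_tendstoD) auto
  then obtain n where n: "s ^ Suc n < (1 - s) / 2"
    by (metis eventually_sequentially le_SucI order_refl)
  then have rho: "s ^ Suc n / (1 - s) \<le> 1 / 2"
    using s_less_1 by (simp add: field_simps)
  have step: "norm (c ^ Suc n * ((a\<^sup>\<star>) ^ i * z)) \<le> 1 / 2 * norm (c ^ Suc n * ((a\<^sup>\<star>) ^ Suc i * z))" for i
  proof -
    have "norm (c ^ Suc n * ((a\<^sup>\<star>) ^ i * z))
        \<le> s ^ Suc n / (1 - s) * norm (c ^ Suc n * (a\<^sup>\<star> * ((a\<^sup>\<star>) ^ i * z)))"
      by (rule annihilated_step) (use assms[of i] in \<open>simp add: mult.assoc\<close>)
    also have "\<dots> \<le> 1 / 2 * norm (c ^ Suc n * (a\<^sup>\<star> * ((a\<^sup>\<star>) ^ i * z)))"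
      by (intro mult_right_mono rho norm_ge_zero)
    finally show ?thesis
      by (simp only: power_Suc mult.assoc)
  qed
  have "norm (c ^ Suc n * z) \<le> (1 / 2) ^ i * norm (c ^ Suc n * ((a\<^sup>\<star>) ^ i * z))" for i
  proof (induction i)
    case (Suc i)
    have "norm (c ^ Suc n * z) \<le> (1 / 2) ^ i * (1 / 2 * norm (c ^ Suc n * ((a\<^sup>\<star>) ^ Suc i * z)))"
      by (rule order_trans[OF Suc mult_left_mono[OF step]]) simp
    then show ?case
      by (simp only: power_Suc2 mult.assoc)
  qed simp
  moreover have "norm ((a\<^sup>\<star>) ^ i * z) \<le> norm z" for i
    by (induction i) (use norm_a_mult_le(3) in \<open>auto simp: mult.assoc intro: order_trans\<close>)
  then have "norm (c ^ Suc n * ((a\<^sup>\<star>) ^ i * z)) \<le> norm z" for i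
    using norm_cpow_add_mult_le[of 0 "Suc n" "(a\<^sup>\<star>) ^ i * z"] order_trans by fastforce
  ultimately have "norm (c ^ Suc n * z) \<le> (1 / 2) ^ i * norm z" for i
    by (meson mult_left_mono order_trans zero_le_divide_1_iff zero_le_numeral zero_le_power)
  moreover have "(\<lambda>i. (1 / 2 :: real) ^ i * norm z) \<longlonglongrightarrow> 0 * norm z"
    by (intro tendsto_intros LIMSEQ_power_zero) simp
  ultimately have "norm (c ^ Suc n * z) \<le> 0"
    by (intro LIMSEQ_le_const[where X = "\<lambda>i. (1 / 2) ^ i * norm z"]) auto
  then show ?thesis
    by (intro cpow_mult_eq_0[of n]) simp
qed

end

section \<open>A representation in which \<open>b\<close> is nonzero\<close>

definition finsupp :: "('i \<Rightarrow> complex) \<Rightarrow> bool" where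
  "finsupp f \<longleftrightarrow> finite {i. f i \<noteq> 0}"

text \<open>Conjugate-linear in the first argument. Summing over the support of \<open>f\<close>
  makes linearity in \<open>g\<close> unconditional; linearity in \<open>f\<close> is then obtained
  through \<open>ip_cnj\<close>.\<close>

definition ip :: "('i \<Rightarrow> complex) \<Rightarrow> ('i \<Rightarrow> complex) \<Rightarrow> complex" where
  "ip f g = (\<Sum>i | f i \<noteq> 0. cnj (f i) * g i)"

definition nrm :: "('i \<Rightarrow> complex) \<Rightarrow> real" where
  "nrm f = L2_set (\<lambda>i. cmod (f i)) {i. f i \<noteq> 0}"

lemma finsupp_zero: "finsupp (\<lambda>i. 0)"
  by (simp add: finsupp_def)

lemma finsupp_add: "finsupp f \<Longrightarrow> finsupp g \<Longrightarrow> finsupp (\<lambda>i. f i + g i)"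
  unfolding finsupp_def by (rule finite_subset[where B = "{i. f i \<noteq> 0} \<union> {i. g i \<noteq> 0}"]) auto

lemma finsupp_mult: "finsupp f \<Longrightarrow> finsupp (\<lambda>i. k i * f i)"
  unfolding finsupp_def by (rule finite_subset[where B = "{i. f i \<noteq> 0}"]) auto

lemma ip_superset: "finite A \<Longrightarrow> {i. f i \<noteq> 0} \<subseteq> A \<Longrightarrow> ip f g = (\<Sum>i\<in>A. cnj (f i) * g i)"
  unfolding ip_def by (rule sum.mono_neutral_left) auto

lemma nrm_superset: "finite A \<Longrightarrow> {i. f i \<noteq> 0} \<subseteq> A \<Longrightarrow> nrm f = L2_set (\<lambda>i. cmod (f i)) A"
  unfolding nrm_def L2_set_def by (rule arg_cong[where f = sqrt], rule sum.mono_neutral_left) auto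

lemma nrm_nonneg [simp]: "0 \<le> nrm f"
  by (simp add: nrm_def)

lemma ip_self: "ip f f = of_real ((nrm f)\<^sup>2)"
  by (simp add: ip_def nrm_def L2_set_def sum_nonneg complex_norm_square mult.commute flip: of_real_power)

lemma ip_add_right: "ip f (\<lambda>i. g i + h i) = ip f g + ip f h"
  by (simp add: ip_def algebra_simps sum.distrib)

lemma ip_scale_right: "ip f (\<lambda>i. k * g i) = k * ip f g"
  by (simp add: ip_def sum_distrib_left mult_ac)

lemma ip_cnj: "finsupp f \<Longrightarrow> finsupp g \<Longrightarrow> ip g f = cnj (ip f g)"
  by (simp add: ip_superset[of "{i. f i \<noteq> 0} \<union> {i. g i \<noteq> 0}"] finsupp_def mult.commute)

lemma ip_add_left:
  assumes "finsupp f" "finsupp g" "finsupp h"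
  shows "ip (\<lambda>i. f i + g i) h = ip f h + ip g h"
  using assms ip_cnj[of h "\<lambda>i. f i + g i"] ip_cnj[of h f] ip_cnj[of h g]
  by (simp add: finsupp_add ip_add_right)

lemma ip_scale_left:
  assumes "finsupp f" "finsupp h"
  shows "ip (\<lambda>i. k * f i) h = cnj k * ip f h"
  using assms ip_cnj[of h "\<lambda>i. k * f i"] ip_cnj[of h f]
  by (simp add: finsupp_mult ip_scale_right)

lemma norm_ip_le:
  assumes "finsupp f" "finsupp g"
  shows "cmod (ip f g) \<le> nrm f * nrm g"
proof -
  let ?A = "{i. f i \<noteq> 0} \<union> {i. g i \<noteq> 0}"
  have A: "finite ?A"
    using assms by (simp add: finsupp_def)
  have "cmod (ip f g) \<le> (\<Sum>i\<in>?A. \<bar>cmod (f i)\<bar> * \<bar>cmod (g i)\<bar>)"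
    unfolding ip_superset[OF A Un_upper1] by (rule order_trans[OF norm_sum]) (simp add: norm_mult)
  also have "\<dots> \<le> L2_set (\<lambda>i. cmod (f i)) ?A * L2_set (\<lambda>i. cmod (g i)) ?A"
    by (rule L2_set_mult_ineq)
  finally show ?thesis
    by (simp only: nrm_superset[OF A Un_upper1] nrm_superset[OF A Un_upper2])
qed

lemma nrm_add_le:
  assumes "finsupp f" "finsupp g"
  shows "nrm (\<lambda>i. f i + g i) \<le> nrm f + nrm g"
proof -
  let ?A = "{i. f i \<noteq> 0} \<union> {i. g i \<noteq> 0}"
  have A: "finite ?A"
    using assms by (simp add: finsupp_def)
  have "nrm (\<lambda>i. f i + g i) = L2_set (\<lambda>i. cmod (f i + g i)) ?A"
    by (rule nrm_superset[OF A]) auto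
  also have "\<dots> \<le> L2_set (\<lambda>i. cmod (f i) + cmod (g i)) ?A"
    by (intro L2_set_mono norm_triangle_ineq norm_ge_zero)
  also have "\<dots> \<le> L2_set (\<lambda>i. cmod (f i)) ?A + L2_set (\<lambda>i. cmod (g i)) ?A"
    by (rule L2_set_triangle_ineq)
  finally show ?thesis
    by (simp only: nrm_superset[OF A Un_upper1] nrm_superset[OF A Un_upper2])
qed

lemma nrm_scale: "nrm (\<lambda>i. k * f i) = cmod k * nrm f"
proof (cases "k = 0")
  case False
  then show ?thesis
    by (simp add: nrm_def norm_mult L2_set_right_distrib)
qed (simp add: nrm_def)

lemma nrm_zero [simp]: "nrm (\<lambda>i. 0) = 0"
  by (simp add: nrm_def)

text \<open>The letters \<open>(x, False)\<close> and \<open>(x, True)\<close> act as mutually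
  adjoint contractions. No Hilbert space completion is formed: adjoints are part of the data, and
  the operator norm over finitely supported functions is already a C*-seminorm.\<close>

locale star_rep =
  fixes act :: "'g \<times> bool \<Rightarrow> ('i \<Rightarrow> complex) \<Rightarrow> 'i \<Rightarrow> complex"
  assumes finsupp_act: "finsupp f \<Longrightarrow> finsupp (act l f)"
    and act_add: "act l (\<lambda>i. f i + g i) = (\<lambda>i. act l f i + act l g i)"
    and act_scale: "act l (\<lambda>i. k * f i) = (\<lambda>i. k * act l f i)"
    and ip_act: "finsupp f \<Longrightarrow> finsupp g \<Longrightarrow> ip (act (x, t) f) g = ip f (act (x, \<not> t) g)"
    and nrm_act_le: "finsupp f \<Longrightarrow> nrm (act l f) \<le> nrm f"
begin

section \<open>The operator seminorm on the free star-algebra\<close>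

definition act_word :: "'g word \<Rightarrow> ('i \<Rightarrow> complex) \<Rightarrow> 'i \<Rightarrow> complex" where
  "act_word w f = foldr act (letters w) f"

definition rep :: "'g free_star_algebra \<Rightarrow> ('i \<Rightarrow> complex) \<Rightarrow> 'i \<Rightarrow> complex" where
  "rep x f = (\<lambda>i. \<Sum>w\<in>Poly_Mapping.keys x. Poly_Mapping.lookup x w * act_word w f i)"

lemma act_word_plus: "act_word (v + w) f = act_word v (act_word w f)"
  by (simp add: act_word_def plus_word_def)

lemma act_word_add: "act_word w (\<lambda>i. f i + g i) = (\<lambda>i. act_word w f i + act_word w g i)"
proof -
  have "foldr act l (\<lambda>i. f i + g i) = (\<lambda>i. foldr act l f i + foldr act l g i)" for l
    by (induction l) (simp_all add: act_add)
  then show ?thesis by (simp add: act_word_def)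
qed

lemma act_word_scale: "act_word w (\<lambda>i. k * f i) = (\<lambda>i. k * act_word w f i)"
proof -
  have "foldr act l (\<lambda>i. k * f i) = (\<lambda>i. k * foldr act l f i)" for l
    by (induction l) (simp_all add: act_scale)
  then show ?thesis by (simp add: act_word_def)
qed

lemma finsupp_act_word: "finsupp f \<Longrightarrow> finsupp (act_word w f)"
proof -
  assume "finsupp f"
  then have "finsupp (foldr act l f)" for l
    by (induction l) (simp_all add: finsupp_act)
  then show ?thesis by (simp add: act_word_def)
qed

lemma ip_act_word:
  assumes "finsupp f" "finsupp g"
  shows "ip (act_word w f) g = ip f (act_word (w\<^sup>\<star>) g)"
proof -
  have "ip (foldr act l f) g = ip f (foldr act (rev (map (\<lambda>(x, t). (x, \<not> t)) l)) g)" for l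
    using assms(2)
  proof (induction l arbitrary: g)
    case (Cons xt l)
    obtain x t where "xt = (x, t)" by force
    moreover have "finsupp (foldr act l f)"
      using finsupp_act_word[OF assms(1), of "Word l"] by (simp add: act_word_def)
    ultimately show ?case
      using Cons by (simp add: ip_act finsupp_act)
  qed simp
  then show ?thesis by (simp add: act_word_def star_word_def)
qed

lemma nrm_act_word_le:
  assumes "finsupp f"
  shows "nrm (act_word w f) \<le> nrm f"
proof -
  have "nrm (foldr act l f) \<le> nrm f" for l
  proof (induction l)
    case (Cons x l)
    have "finsupp (foldr act l f)"
      using finsupp_act_word[OF assms(1), of "Word l"] by (simp add: act_word_def)
    then show ?case
      using nrm_act_le[of "foldr act l f" x] Cons by simp
  qed simp
  then show ?thesis by (simp add: act_word_def)
qed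

lemma rep_superset:
  assumes "finite W" "Poly_Mapping.keys x \<subseteq> W"
  shows "rep x f i = (\<Sum>w\<in>W. Poly_Mapping.lookup x w * act_word w f i)"
  unfolding rep_def
  by (rule sum.mono_neutral_left) (use assms in \<open>auto simp: in_keys_iff\<close>)

lemma rep_zero: "rep 0 f = (\<lambda>i. 0)"
  by (simp add: rep_def)

lemma rep_single: "rep (Poly_Mapping.single w k) f = (\<lambda>i. k * act_word w f i)"
  by (subst fun_eq_iff, subst rep_superset[of "{w}"]) auto

lemma rep_add: "rep (x + y) f = (\<lambda>i. rep x f i + rep y f i)"
proof
  fix i
  let ?W = "Poly_Mapping.keys x \<union> Poly_Mapping.keys y"
  have "rep z f i = (\<Sum>w\<in>?W. Poly_Mapping.lookup z w * act_word w f i)"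
    if "z = x \<or> z = y \<or> z = x + y" for z
    by (rule rep_superset) (use that Poly_Mapping.keys_add[of x y] in auto)
  then show "rep (x + y) f i = rep x f i + rep y f i"
    by (simp add: lookup_add algebra_simps sum.distrib)
qed

lemma rep_scaleC: "rep (k *\<^sub>C x) f = (\<lambda>i. k * rep x f i)"
  by (induction x rule: poly_mapping_add_induct)
    (simp_all add: rep_zero rep_single rep_add scaleC_zero_right scaleC_single scaleC_add_right
      scaleC_complex_def algebra_simps)

lemma rep_diff: "rep (x - y) f = (\<lambda>i. rep x f i - rep y f i)"
  using rep_add[of "x - y" y f] by (simp add: fun_eq_iff)

lemma rep_add_vec: "rep x (\<lambda>i. f i + g i) = (\<lambda>i. rep x f i + rep x g i)"
  by (simp add: rep_def act_word_add algebra_simps sum.distrib)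

lemma rep_scale_vec: "rep x (\<lambda>i. k * f i) = (\<lambda>i. k * rep x f i)"
  by (simp add: rep_def act_word_scale sum_distrib_left mult_ac)

lemma rep_zero_vec: "rep x (\<lambda>i. 0) = (\<lambda>i. 0)"
  using rep_scale_vec[of x 0 "\<lambda>i. 0"] by simp

lemma rep_mult: "rep (x * y) f = rep x (rep y f)"
proof (induction x rule: poly_mapping_add_induct)
  case (single v k)
  show ?case
    by (induction y rule: poly_mapping_add_induct)
      (simp_all add: rep_zero rep_zero_vec rep_single rep_add rep_add_vec act_word_plus mult_single
        act_word_scale act_word_add distrib_left mult.assoc)
qed (simp_all add: rep_zero rep_add distrib_right)

lemma rep_one: "rep 1 f = f"
  by (simp add: rep_single act_word_def zero_word_def flip: single_one)

lemma rep_gen: "rep (gen x) f = act (x, False) f"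
  by (simp add: gen_def rep_single act_word_def)

lemma rep_star_gen: "rep ((gen x)\<^sup>\<star>) f = act (x, True) f"
  by (simp add: gen_def star_single star_word_def star_complex_def rep_single act_word_def)

lemma finsupp_rep: "finsupp f \<Longrightarrow> finsupp (rep x f)"
  by (induction x rule: poly_mapping_add_induct)
    (simp_all add: rep_zero rep_single rep_add finsupp_zero finsupp_add finsupp_mult finsupp_act_word)

lemma ip_rep:
  assumes "finsupp f" "finsupp g"
  shows "ip (rep x f) g = ip f (rep (x\<^sup>\<star>) g)"
proof (induction x rule: poly_mapping_add_induct)
  case zero
  show ?case by (simp add: rep_zero star_zero ip_def)
next
  case (single w k)
  show ?case
    using assms by (simp add: rep_single star_single star_complex_def ip_scale_left ip_scale_right
        finsupp_act_word ip_act_word)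
next
  case (add x y)
  then show ?case
    using assms by (simp add: rep_add star_add ip_add_left ip_add_right finsupp_rep)
qed

lemma rep_bounded: "\<exists>C\<ge>0. \<forall>f. finsupp f \<longrightarrow> nrm (rep x f) \<le> C * nrm f"
proof (induction x rule: poly_mapping_add_induct)
  case zero
  show ?case by (rule exI[of _ 0]) (simp add: rep_zero)
next
  case (single w k)
  show ?case
    by (rule exI[of _ "cmod k"]) (simp add: rep_single nrm_scale nrm_act_word_le mult_left_mono)
next
  case (add x y)
  then obtain B C where "B \<ge> 0" "C \<ge> 0"
    and "\<And>f. finsupp f \<Longrightarrow> nrm (rep x f) \<le> B * nrm f" "\<And>f. finsupp f \<Longrightarrow> nrm (rep y f) \<le> C * nrm f"
    by blast
  then show ?case
    by (intro exI[of _ "B + C"])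
      (auto simp: rep_add distrib_right intro!: order_trans[OF nrm_add_le] add_mono finsupp_rep)
qed

definition opnorm :: "'g free_star_algebra \<Rightarrow> real" where
  "opnorm x = Inf {C. 0 \<le> C \<and> (\<forall>f. finsupp f \<longrightarrow> nrm (rep x f) \<le> C * nrm f)}"

lemma opnorm_nonneg: "0 \<le> opnorm x"
  unfolding opnorm_def by (rule cInf_greatest) (use rep_bounded[of x] in auto)

lemma opnorm_le:
  assumes "0 \<le> C" "\<And>f. finsupp f \<Longrightarrow> nrm (rep x f) \<le> C * nrm f"
  shows "opnorm x \<le> C"
  unfolding opnorm_def by (rule cInf_lower) (use assms in \<open>auto simp: bdd_below_def\<close>)

lemma nrm_rep_le:
  assumes "finsupp f"
  shows "nrm (rep x f) \<le> opnorm x * nrm f"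
proof (cases "nrm f = 0")
  case True
  then show ?thesis
    using rep_bounded[of x] assms by fastforce
next
  case False
  then have pos: "0 < nrm f"
    using nrm_nonneg[of f] by linarith
  then have "nrm (rep x f) / nrm f \<le> opnorm x"
    unfolding opnorm_def
    by (intro cInf_greatest) (use rep_bounded[of x] assms in \<open>auto simp: divide_le_eq\<close>)
  then show ?thesis
    using pos by (simp add: divide_le_eq)
qed

lemma opnorm_add: "opnorm (x + y) \<le> opnorm x + opnorm y"
proof (rule opnorm_le)
  fix f :: "'i \<Rightarrow> complex" assume f: "finsupp f"
  have "nrm (rep (x + y) f) \<le> nrm (rep x f) + nrm (rep y f)"
    using f by (simp add: rep_add nrm_add_le finsupp_rep)
  then show "nrm (rep (x + y) f) \<le> (opnorm x + opnorm y) * nrm f"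
    using nrm_rep_le[OF f, of x] nrm_rep_le[OF f, of y] by (simp add: distrib_right)
qed (simp add: opnorm_nonneg)

lemma opnorm_mult: "opnorm (x * y) \<le> opnorm x * opnorm y"
proof (rule opnorm_le)
  fix f :: "'i \<Rightarrow> complex" assume f: "finsupp f"
  have "nrm (rep (x * y) f) \<le> opnorm x * nrm (rep y f)"
    using f by (simp add: rep_mult nrm_rep_le finsupp_rep)
  also have "\<dots> \<le> opnorm x * (opnorm y * nrm f)"
    by (intro mult_left_mono nrm_rep_le f opnorm_nonneg)
  finally show "nrm (rep (x * y) f) \<le> opnorm x * opnorm y * nrm f"
    by (simp add: mult.assoc)
qed (simp add: opnorm_nonneg)

lemma opnorm_scaleC: "opnorm (k *\<^sub>C x) = cmod k * opnorm x"
proof -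
  have le: "opnorm (l *\<^sub>C y) \<le> cmod l * opnorm y" for l y
    by (rule opnorm_le) (simp_all add: opnorm_nonneg rep_scaleC nrm_scale nrm_rep_le mult.assoc mult_left_mono)
  show ?thesis
  proof (cases "k = 0")
    case True
    then show ?thesis
      using le[of k x] opnorm_nonneg[of "k *\<^sub>C x"] by simp
  next
    case False
    then have "opnorm x \<le> inverse (cmod k) * opnorm (k *\<^sub>C x)"
      using le[of "inverse k" "k *\<^sub>C x"] by (simp add: scaleC_scaleC scaleC_one norm_inverse)
    then have "cmod k * opnorm x \<le> opnorm (k *\<^sub>C x)"
      using False by (simp add: field_simps)
    then show ?thesis
      using le[of k x] by linarith
  qed
qed

text \<open>Cauchy-Schwarz after moving \<open>x\<close> to the other side of \<open>ip\<close>.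
  Both \<open>opnorm_star_le\<close> and the C*-identity for \<open>opnorm\<close> come from
  it.\<close>

lemma nrm_rep_square:
  assumes "finsupp f"
  shows "(nrm (rep x f))\<^sup>2 \<le> nrm f * nrm (rep (x\<^sup>\<star> * x) f)"
proof -
  have "complex_of_real ((nrm (rep x f))\<^sup>2) = ip f (rep (x\<^sup>\<star> * x) f)"
    using assms by (simp only: ip_self[symmetric] rep_mult ip_rep finsupp_rep)
  then have "(nrm (rep x f))\<^sup>2 = cmod (ip f (rep (x\<^sup>\<star> * x) f))"
    by (metis abs_of_nonneg norm_of_real zero_le_power2)
  then show ?thesis
    using norm_ip_le[OF assms finsupp_rep[OF assms], of "x\<^sup>\<star> * x"] by simp
qed

lemma opnorm_star_le: "opnorm (x\<^sup>\<star>) \<le> opnorm x"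
proof (rule opnorm_le)
  fix f :: "'i \<Rightarrow> complex" assume f: "finsupp f"
  let ?g = "rep (x\<^sup>\<star>) f"
  have "(nrm ?g)\<^sup>2 \<le> nrm f * nrm (rep x ?g)"
    using nrm_rep_square[OF f, of "x\<^sup>\<star>"] by (simp add: star_star rep_mult)
  also have "\<dots> \<le> nrm f * (opnorm x * nrm ?g)"
    by (intro mult_left_mono nrm_rep_le finsupp_rep f nrm_nonneg)
  finally have "nrm ?g * nrm ?g \<le> (opnorm x * nrm f) * nrm ?g"
    by (simp add: power2_eq_square mult_ac)
  then show "nrm ?g \<le> opnorm x * nrm f"
    using opnorm_nonneg[of x] by (cases "nrm ?g = 0") (auto simp: less_le)
qed (rule opnorm_nonneg)

lemma opnorm_cstar: "opnorm (x\<^sup>\<star> * x) = (opnorm x)\<^sup>2"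
proof (rule antisym)
  show "opnorm (x\<^sup>\<star> * x) \<le> (opnorm x)\<^sup>2"
    using order_trans[OF opnorm_mult mult_right_mono[OF opnorm_star_le opnorm_nonneg]]
    by (simp add: power2_eq_square)
  have "opnorm x \<le> sqrt (opnorm (x\<^sup>\<star> * x))"
  proof (rule opnorm_le)
    fix f :: "'i \<Rightarrow> complex" assume f: "finsupp f"
    have "(nrm (rep x f))\<^sup>2 \<le> nrm f * (opnorm (x\<^sup>\<star> * x) * nrm f)"
      by (rule order_trans[OF nrm_rep_square[OF f]]) (intro mult_left_mono nrm_rep_le f nrm_nonneg)
    also have "\<dots> = (sqrt (opnorm (x\<^sup>\<star> * x)) * nrm f)\<^sup>2"
      by (simp add: power_mult_distrib opnorm_nonneg power2_eq_square)
    finally show "nrm (rep x f) \<le> sqrt (opnorm (x\<^sup>\<star> * x)) * nrm f"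
      by (rule power2_le_imp_le) (simp add: opnorm_nonneg)
  qed (simp add: opnorm_nonneg)
  then show "(opnorm x)\<^sup>2 \<le> opnorm (x\<^sup>\<star> * x)"
    by (metis opnorm_nonneg real_sqrt_le_iff real_sqrt_pow2 power_mono)
qed

lemma cstar_seminorm_opnorm: "cstar_seminorm_on UNIV opnorm"
  by (simp add: cstar_seminorm_on_def opnorm_nonneg opnorm_add opnorm_mult opnorm_scaleC opnorm_cstar)

lemma opnorm_eq_0: "(\<And>f. finsupp f \<Longrightarrow> rep x f = (\<lambda>i. 0)) \<Longrightarrow> opnorm x = 0"
  using opnorm_le[of 0 x] opnorm_nonneg[of x] by simp

end

text \<open>
  The representation is the direct integral over the circle of the irreducible representations in
  which \<open>b b\<^sup>\<star>\<close> is nonzero; the integer coordinate is there because \<open>D\<close> and \<open>b\<close> commute only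
  up to a phase.
\<close>

fun uq2_act :: "complex \<Rightarrow> uq2_generator \<times> bool \<Rightarrow> (nat \<times> int \<Rightarrow> complex) \<Rightarrow> nat \<times> int \<Rightarrow> complex" where
  "uq2_act q (Gen_a, False) f (0, k) = 0"
| "uq2_act q (Gen_a, False) f (Suc n, k) = of_real (sqrt (1 - ((cmod q)\<^sup>2) ^ Suc n)) * f (n, k)"
| "uq2_act q (Gen_a, True) f (n, k) = of_real (sqrt (1 - ((cmod q)\<^sup>2) ^ Suc n)) * f (Suc n, k)"
| "uq2_act q (Gen_b, False) f (n, k) = q ^ n * (q\<^sup>2 / of_real ((cmod q)\<^sup>2)) powi k * f (n, k)"
| "uq2_act q (Gen_b, True) f (n, k) = cnj (q ^ n * (q\<^sup>2 / of_real ((cmod q)\<^sup>2)) powi k) * f (n, k)"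
| "uq2_act q (Gen_D, False) f (n, k) = f (n, k - 1)"
| "uq2_act q (Gen_D, True) f (n, k) = f (n, k + 1)"

text \<open>The shape shared by all generators: \<open>T\<close> is a weighted shift along an
  injection and \<open>S\<close> its adjoint. Nonzero weights make the support of \<open>T f\<close>
  the exact image of that of \<open>f\<close>, so the sum can be reindexed.\<close>

lemma ip_shift:
  assumes "inj \<sigma>" and "finsupp f" "finsupp g" and "\<And>i. w i \<noteq> (0::complex)"
    and T: "\<And>i. T f (\<sigma> i) = w i * f i" "\<And>j. j \<notin> range \<sigma> \<Longrightarrow> T f j = 0"
    and S: "\<And>i. S g i = cnj (w i) * g (\<sigma> i)"
  shows "ip (T f) g = ip f (S g)"
proof -
  have "{j. T f j \<noteq> 0} = \<sigma> ` {i. f i \<noteq> 0}"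
    using T assms(4) by (auto simp: image_iff) (metis mult_zero_right rangeE)
  then have "ip (T f) g = (\<Sum>i | f i \<noteq> 0. cnj (T f (\<sigma> i)) * g (\<sigma> i))"
    using assms(1) by (simp add: ip_def sum.reindex inj_on_def)
  then show ?thesis
    by (simp add: T S ip_def mult_ac)
qed

lemma finsupp_shift:
  assumes "finsupp f" "\<And>j. T f j \<noteq> 0 \<Longrightarrow> j \<in> \<sigma> ` {i. f i \<noteq> (0::complex)}"
  shows "finsupp (T f)"
proof -
  have "{j. T f j \<noteq> 0} \<subseteq> \<sigma> ` {i. f i \<noteq> 0}"
    using assms(2) by blast
  then show ?thesis
    using assms(1) finite_subset finite_imageI unfolding finsupp_def by metis
qed

section \<open>The relations of \<open>U_q(2)\<close> for \<open>uq2_act\<close>\<close>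

context
  fixes q :: complex
  assumes q: "0 < cmod q" "cmod q < 1"
begin

lemma q_abs_power_less: "((cmod q)\<^sup>2) ^ Suc n < 1"
  using q by (intro power_Suc_less_one) (auto simp: power_less_one_iff abs_square_less_1)

lemma q_sq_power_less: "0 < 1 - (cmod q)\<^sup>2 * ((cmod q)\<^sup>2) ^ n"
  using q_abs_power_less[of n] by simp

lemma finsupp_uq2_act:
  assumes f: "finsupp f"
  shows "finsupp (uq2_act q l f)"
proof -
  obtain x t where l: "l = (x, t)" by force
  show ?thesis
  proof (cases x; cases t)
    show ?thesis if "x = Gen_a" "\<not> t"
    proof (rule finsupp_shift[OF f, where \<sigma> = "\<lambda>(n, k). (Suc n, k)"])
      fix j assume j: "uq2_act q l f j \<noteq> 0"
      obtain n k where "j = (n, k)" by force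
      then show "j \<in> (\<lambda>(n, k). (Suc n, k)) ` {i. f i \<noteq> 0}"
        using j that l by (cases n) (auto simp: image_iff)
    qed
    show ?thesis if "x = Gen_a" "t"
      \<comment> \<open>The truncation of \<open>n - 1\<close> at 0 is harmless: the image only has
        to contain the support.\<close>
      by (rule finsupp_shift[OF f, where \<sigma> = "\<lambda>(n, k). (n - 1, k)"])
        (use that l in \<open>force simp: image_iff\<close>)
    show ?thesis if "x = Gen_b" "\<not> t"
      by (rule finsupp_shift[OF f, where \<sigma> = id]) (use that l in auto)
    show ?thesis if "x = Gen_b" "t"
      by (rule finsupp_shift[OF f, where \<sigma> = id]) (use that l in auto)
    show ?thesis if "x = Gen_D" "\<not> t"
      by (rule finsupp_shift[OF f, where \<sigma> = "\<lambda>(n, k). (n, k + 1)"])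
        (use that l in \<open>force simp: image_iff\<close>)
    show ?thesis if "x = Gen_D" "t"
      by (rule finsupp_shift[OF f, where \<sigma> = "\<lambda>(n, k). (n, k - 1)"])
        (use that l in \<open>force simp: image_iff\<close>)
  qed
qed

lemma uq2_act_add: "uq2_act q l (\<lambda>i. f i + g i) = (\<lambda>i. uq2_act q l f i + uq2_act q l g i)"
proof
  fix i :: "nat \<times> int"
  obtain x t n k where "l = (x, t)" "i = (n, k)" by force
  then show "uq2_act q l (\<lambda>i. f i + g i) i = uq2_act q l f i + uq2_act q l g i"
    by (cases x; cases t; cases n) (simp_all add: algebra_simps)
qed

lemma uq2_act_scale: "uq2_act q l (\<lambda>i. m * f i) = (\<lambda>i. m * uq2_act q l f i)"
proof
  fix i :: "nat \<times> int"
  obtain x t n k where "l = (x, t)" "i = (n, k)" by force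
  then show "uq2_act q l (\<lambda>i. m * f i) i = m * uq2_act q l f i"
    by (cases x; cases t; cases n) (simp_all add: algebra_simps)
qed

lemma ip_uq2_act:
  assumes f: "finsupp f" and g: "finsupp g"
  shows "ip (uq2_act q (x, t) f) g = ip f (uq2_act q (x, \<not> t) g)"
proof -
  have plain: "ip (uq2_act q (x, False) f) g = ip f (uq2_act q (x, True) g)"
    if f: "finsupp f" and g: "finsupp g" for f g
  proof (cases x)
    case Gen_a
    show ?thesis
      unfolding Gen_a
    proof (rule ip_shift[OF _ f g, where \<sigma> = "\<lambda>(n, k). (Suc n, k)"
          and w = "\<lambda>(n, k). of_real (sqrt (1 - ((cmod q)\<^sup>2) ^ Suc n))"])
      show "uq2_act q (Gen_a, False) f j = 0" if "j \<notin> range (\<lambda>(n, k). (Suc n, k))" for j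
      proof -
        obtain n k where "j = (n, k)" by force
        then show ?thesis using that by (cases n) (auto simp: image_iff)
      qed
    qed (use q_sq_power_less in \<open>auto simp: inj_on_def less_imp_neq[symmetric]\<close>)
  next
    case Gen_b
    show ?thesis
      unfolding Gen_b
      by (rule ip_shift[OF _ f g, where \<sigma> = id
          and w = "\<lambda>(n, k). q ^ n * (q\<^sup>2 / of_real ((cmod q)\<^sup>2)) powi k"]) (use q in auto)
  next
    case Gen_D
    show ?thesis
      unfolding Gen_D
    proof (rule ip_shift[OF _ f g, where \<sigma> = "\<lambda>(n, k). (n, k + 1)" and w = "\<lambda>_. 1"])
      show "uq2_act q (Gen_D, False) f j = 0" if "j \<notin> range (\<lambda>(n, k). (n, k + 1))" for j
        using that by (auto simp: image_iff) (metis diff_add_cancel surj_pair)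
    qed (auto simp: inj_on_def)
  qed
  show ?thesis
  proof (cases t)
    case True
    have "ip (uq2_act q (x, True) f) g = cnj (ip g (uq2_act q (x, True) f))"
      by (intro ip_cnj g finsupp_uq2_act f)
    also have "\<dots> = cnj (ip (uq2_act q (x, False) g) f)"
      by (simp add: plain f g)
    also have "\<dots> = ip f (uq2_act q (x, False) g)"
      by (intro ip_cnj[symmetric] finsupp_uq2_act f g)
    finally show ?thesis using True by simp
  qed (use plain f g in simp)
qed

lemma of_real_sqrt_mult_self: "0 \<le> x \<Longrightarrow> complex_of_real (sqrt x) * (complex_of_real (sqrt x) * z) = of_real x * z"
  by (simp flip: of_real_mult mult.assoc)

lemma powi_phase_norm: "cmod ((q\<^sup>2 / of_real ((cmod q)\<^sup>2)) powi k) = 1"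
  using q by (simp add: norm_power_int norm_divide norm_power)

lemma powi_phase: "(q\<^sup>2 / of_real ((cmod q)\<^sup>2)) powi k * cnj ((q\<^sup>2 / of_real ((cmod q)\<^sup>2)) powi k) = 1"
proof -
  have "z * cnj z = 1" if "cmod z = 1" for z
    using complex_norm_square[of z] that by simp
  then show ?thesis
    using powi_phase_norm by blast
qed

lemma b_weight: "q ^ n * (q\<^sup>2 / of_real ((cmod q)\<^sup>2)) powi k * cnj (q ^ n * (q\<^sup>2 / of_real ((cmod q)\<^sup>2)) powi k)
   = of_real (((cmod q)\<^sup>2) ^ n)"
proof -
  have "q ^ n * (q\<^sup>2 / of_real ((cmod q)\<^sup>2)) powi k * cnj (q ^ n * (q\<^sup>2 / of_real ((cmod q)\<^sup>2)) powi k)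
    = (q * cnj q) ^ n * ((q\<^sup>2 / of_real ((cmod q)\<^sup>2)) powi k * cnj ((q\<^sup>2 / of_real ((cmod q)\<^sup>2)) powi k))"
    by (simp only: complex_cnj_mult complex_cnj_power power_mult_distrib mult_ac)
  then show ?thesis
    by (simp only: powi_phase complex_norm_square[of q, symmetric] mult_1_right) simp
qed

lemma b_weight_star: "cnj (q ^ n * (q\<^sup>2 / of_real ((cmod q)\<^sup>2)) powi k) *
    (q ^ n * (q\<^sup>2 / of_real ((cmod q)\<^sup>2)) powi k * z) = of_real (((cmod q)\<^sup>2) ^ n) * z"
  "(q ^ n * (q\<^sup>2 / of_real ((cmod q)\<^sup>2)) powi k) *
    (cnj (q ^ n * (q\<^sup>2 / of_real ((cmod q)\<^sup>2)) powi k) * z) = of_real (((cmod q)\<^sup>2) ^ n) * z"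
  using b_weight[of n k] by (metis mult.assoc mult.commute)+

lemma uq2_act_rel_aa':
  "uq2_act q (Gen_a, False) (uq2_act q (Gen_a, True) f) i + uq2_act q (Gen_b, False) (uq2_act q (Gen_b, True) f) i = f i"
proof -
  obtain n k where i: "i = (n, k)" by force
  show ?thesis
    unfolding i uq2_act.simps(4,5) b_weight_star
  proof (cases n)
    case (Suc m)
    then show "uq2_act q (Gen_a, False) (uq2_act q (Gen_a, True) f) (n, k) + of_real (((cmod q)\<^sup>2) ^ n) * f (n, k) = f (n, k)"
      using q_abs_power_less[of m]
      by (simp only: uq2_act.simps of_real_sqrt_mult_self less_imp_le diff_ge_0_iff_ge) (simp add: algebra_simps)
  qed simp
qed

lemma uq2_act_rel_a'a:
  "uq2_act q (Gen_a, True) (uq2_act q (Gen_a, False) f) i +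
    of_real ((cmod q)\<^sup>2) * uq2_act q (Gen_b, True) (uq2_act q (Gen_b, False) f) i = f i"
proof -
  obtain n k where i: "i = (n, k)" by force
  show ?thesis
    unfolding i uq2_act.simps b_weight_star
    using q_abs_power_less[of n]
    by (simp only: of_real_sqrt_mult_self less_imp_le diff_ge_0_iff_ge) (simp add: algebra_simps)
qed

lemma uq2_act_rel_bb':
  "uq2_act q (Gen_b, True) (uq2_act q (Gen_b, False) f) = uq2_act q (Gen_b, False) (uq2_act q (Gen_b, True) f)"
  by (auto simp: fun_eq_iff)

lemma uq2_act_rel_DD': "uq2_act q (Gen_D, t) (uq2_act q (Gen_D, \<not> t) f) = f"
  by (cases t) (auto simp: fun_eq_iff)

text \<open>Read off from the relations by pairing with \<open>f\<close>. The relation for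
  \<open>a\<^sup>\<star> * a\<close> controls \<open>b\<close> only up to the factor
  \<open>(cmod q)\<^sup>2\<close>, so \<open>b\<close> is compared with
  \<open>b\<^sup>\<star>\<close> by normality instead.\<close>

lemma nrm_uq2_act_le:
  assumes f: "finsupp f"
  shows "nrm (uq2_act q l f) \<le> nrm f"
proof -
  have sq: "complex_of_real ((nrm (uq2_act q (x, t) f))\<^sup>2) = ip f (uq2_act q (x, \<not> t) (uq2_act q (x, t) f))" for x t
    by (simp only: ip_self[symmetric] ip_uq2_act[OF f finsupp_uq2_act[OF f]])
  have "complex_of_real ((nrm (uq2_act q (Gen_a, True) f))\<^sup>2 + (nrm (uq2_act q (Gen_b, True) f))\<^sup>2)
      = of_real ((nrm f)\<^sup>2)"
    by (simp only: of_real_add sq ip_add_right[symmetric] not_True_eq_False uq2_act_rel_aa' ip_self)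
  then have 1: "(nrm (uq2_act q (Gen_a, True) f))\<^sup>2 + (nrm (uq2_act q (Gen_b, True) f))\<^sup>2 = (nrm f)\<^sup>2"
    by (simp only: of_real_eq_iff)
  have "complex_of_real ((nrm (uq2_act q (Gen_a, False) f))\<^sup>2 + (cmod q)\<^sup>2 * (nrm (uq2_act q (Gen_b, False) f))\<^sup>2)
      = of_real ((nrm f)\<^sup>2)"
    by (simp only: of_real_add of_real_mult sq ip_scale_right[symmetric] ip_add_right[symmetric]
        not_False_eq_True uq2_act_rel_a'a ip_self)
  then have 2: "(nrm (uq2_act q (Gen_a, False) f))\<^sup>2 + (cmod q)\<^sup>2 * (nrm (uq2_act q (Gen_b, False) f))\<^sup>2 = (nrm f)\<^sup>2"
    by (simp only: of_real_eq_iff)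
  have "complex_of_real ((nrm (uq2_act q (Gen_b, False) f))\<^sup>2) = of_real ((nrm (uq2_act q (Gen_b, True) f))\<^sup>2)"
    by (simp only: sq uq2_act_rel_bb' simp_thms)
  then have 3: "(nrm (uq2_act q (Gen_b, False) f))\<^sup>2 = (nrm (uq2_act q (Gen_b, True) f))\<^sup>2"
    by (simp only: of_real_eq_iff)
  have "complex_of_real ((nrm (uq2_act q (Gen_D, t) f))\<^sup>2) = of_real ((nrm f)\<^sup>2)" for t
    unfolding sq using uq2_act_rel_DD'[of "\<not> t" f] by (simp only: simp_thms ip_self)
  then have 4: "(nrm (uq2_act q (Gen_D, t) f))\<^sup>2 = (nrm f)\<^sup>2" for t
    by (simp only: of_real_eq_iff)
  obtain x t where l: "l = (x, t)" by force
  have nn: "0 \<le> (cmod q)\<^sup>2 * (nrm (uq2_act q (Gen_b, False) f))\<^sup>2" "0 \<le> (nrm (uq2_act q (Gen_b, True) f))\<^sup>2"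
      "0 \<le> (nrm (uq2_act q (Gen_a, True) f))\<^sup>2"
    by simp_all
  have "(nrm (uq2_act q (Gen_a, False) f))\<^sup>2 \<le> (nrm f)\<^sup>2" "(nrm (uq2_act q (Gen_a, True) f))\<^sup>2 \<le> (nrm f)\<^sup>2"
    "(nrm (uq2_act q (Gen_b, False) f))\<^sup>2 \<le> (nrm f)\<^sup>2" "(nrm (uq2_act q (Gen_b, True) f))\<^sup>2 \<le> (nrm f)\<^sup>2"
    "(nrm (uq2_act q (Gen_D, False) f))\<^sup>2 \<le> (nrm f)\<^sup>2" "(nrm (uq2_act q (Gen_D, True) f))\<^sup>2 \<le> (nrm f)\<^sup>2"
    using 1 2 3 4[of True] 4[of False] nn by linarith+
  then have "(nrm (uq2_act q (x, t) f))\<^sup>2 \<le> (nrm f)\<^sup>2"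
    by (cases x; cases t) (simp_all only:)
  then show ?thesis
    unfolding l by (rule power2_le_imp_le) simp
qed

lemma star_rep_uq2: "star_rep (uq2_act q)"
  by standard (simp_all add: finsupp_uq2_act uq2_act_add uq2_act_scale ip_uq2_act nrm_uq2_act_le)

interpretation star_rep "uq2_act q"
  by (rule star_rep_uq2)

lemma rep_uq2_relators:
  assumes "r \<in> uq2_relators q"
  shows "rep r f = (\<lambda>i. 0)"
proof
  fix i :: "nat \<times> int"
  obtain n k where i: "i = (n, k)" by force
  \<comment> \<open>Lowering \<open>k\<close> by one divides the weight of \<open>b\<close> by the
    phase between \<open>b\<close> and \<open>D\<close>; this is what the integer coordinate is
    for.\<close>
  have phase: "(q\<^sup>2 / of_real ((cmod q)\<^sup>2)) powi k = q\<^sup>2 / of_real ((cmod q)\<^sup>2) * (q\<^sup>2 / of_real ((cmod q)\<^sup>2)) powi (k - 1)"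
    using q by (subst power_int_minus_mult[symmetric]) (auto simp: mult.commute)
  note rep_simps = rep_diff rep_add rep_mult rep_gen rep_star_gen rep_scaleC rep_one
  show "rep r f i = 0"
    using assms unfolding uq2_relators_def Let_def
  proof (elim insertE; (simp only: rep_simps empty_iff)?)
    show "uq2_act q (Gen_b, False) (uq2_act q (Gen_a, False) f) i -
        q * uq2_act q (Gen_a, False) (uq2_act q (Gen_b, False) f) i = 0"
      unfolding i by (cases n) simp_all
    show "uq2_act q (Gen_a, True) (uq2_act q (Gen_b, False) f) i -
        q * uq2_act q (Gen_b, False) (uq2_act q (Gen_a, True) f) i = 0"
      unfolding i by simp
    show "uq2_act q (Gen_b, False) (uq2_act q (Gen_b, True) f) i -
        uq2_act q (Gen_b, True) (uq2_act q (Gen_b, False) f) i = 0"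
      by (simp add: uq2_act_rel_bb')
    show "uq2_act q (Gen_a, False) (uq2_act q (Gen_a, True) f) i +
        uq2_act q (Gen_b, False) (uq2_act q (Gen_b, True) f) i - f i = 0"
      by (simp only: uq2_act_rel_aa') simp
    show "uq2_act q (Gen_a, False) (uq2_act q (Gen_D, False) f) i -
        uq2_act q (Gen_D, False) (uq2_act q (Gen_a, False) f) i = 0"
      unfolding i by (cases n) simp_all
    show "uq2_act q (Gen_b, False) (uq2_act q (Gen_D, False) f) i -
        q\<^sup>2 / of_real ((cmod q)\<^sup>2) * uq2_act q (Gen_D, False) (uq2_act q (Gen_b, False) f) i = 0"
      unfolding i by (simp only: uq2_act.simps) (subst phase, simp)
    show "uq2_act q (Gen_D, False) (uq2_act q (Gen_D, True) f) i - f i = 0"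
      using uq2_act_rel_DD'[of False f] by simp
    show "uq2_act q (Gen_D, True) (uq2_act q (Gen_D, False) f) i - f i = 0"
      using uq2_act_rel_DD'[of True f] by simp
    show "uq2_act q (Gen_a, True) (uq2_act q (Gen_a, False) f) i +
        of_real ((cmod q)\<^sup>2) * uq2_act q (Gen_b, True) (uq2_act q (Gen_b, False) f) i - f i = 0"
      by (simp only: uq2_act_rel_a'a) simp
  qed
qed

text \<open>The universal norm dominates every C*-seminorm that kills the relators,
  \<open>opnorm\<close> among them, and \<open>b\<close> fixes the basis vector at
  \<open>(0, 0)\<close>.\<close>

lemma C_Uq2_norm_b_ge_1:
  assumes "C_Uq2 q a b D"
  shows "1 \<le> norm b"
proof -
  define f :: "nat \<times> int \<Rightarrow> complex" where "f = (\<lambda>i. if i = (0, 0) then 1 else 0)"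
  have supp: "{i. f i \<noteq> 0} = {(0, 0)}"
    by (auto simp: f_def)
  have "rep (gen Gen_b) f = f"
    by (auto simp: rep_gen f_def fun_eq_iff)
  moreover have "nrm f = 1"
    unfolding nrm_def supp by (simp add: f_def)
  moreover have "finsupp f"
    by (simp add: finsupp_def supp)
  ultimately have "1 \<le> opnorm (gen Gen_b)"
    using nrm_rep_le[of f "gen Gen_b"] by simp
  also have "\<dots> \<le> norm (eval_free (case_uq2_generator a b D) (gen Gen_b))"
    using assms cstar_seminorm_opnorm opnorm_eq_0[OF rep_uq2_relators]
    unfolding C_Uq2_def universal_cstar_algebra_def by blast
  finally show ?thesis
    by (simp add: eval_free_gen)
qed

end

section \<open>The Jackson integral\<close>

text \<open>The \<open>f m\<close> form a triangular basis: subtracting a multiple of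
  \<open>f (degree p)\<close> removes the leading term of \<open>p\<close>.\<close>

lemma linear_functional_eq_0:
  fixes \<Lambda> :: "complex poly \<Rightarrow> complex"
  assumes add: "\<And>p r. \<Lambda> (p + r) = \<Lambda> p + \<Lambda> r" and smult: "\<And>k p. \<Lambda> (smult k p) = k * \<Lambda> p"
    and basis: "\<And>m. \<Lambda> (f m) = 0" "\<And>m. degree (f m) \<le> m" "\<And>m. coeff (f m) m \<noteq> 0"
  shows "\<Lambda> p = 0"
proof (induction "degree p" arbitrary: p rule: less_induct)
  case less
  have zero: "\<Lambda> 0 = 0"
    using smult[of 0 0] by simp
  define r where "r = p - smult (coeff p (degree p) / coeff (f (degree p)) (degree p)) (f (degree p))"
  have "degree r \<le> degree p"
    unfolding r_def by (intro degree_diff_le order_refl order_trans[OF degree_smult_le] basis)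
  moreover have coeff: "coeff r (degree p) = 0"
    using basis(3)[of "degree p"] by (simp add: r_def)
  ultimately have "r = 0 \<or> degree r < degree p"
    by (metis leading_coeff_0_iff le_neq_implies_less)
  then have "\<Lambda> r = 0"
    using less zero by auto
  moreover have "p = r + smult (coeff p (degree p) / coeff (f (degree p)) (degree p)) (f (degree p))"
    by (simp add: r_def)
  ultimately show ?case
    using basis(1) by (metis add smult add_0 mult_zero_right)
qed

lemma poly_cnj_of_real: "poly (map_poly cnj p) (of_real x) = cnj (poly p (of_real x))"
  by (induction p) (simp_all add: map_poly_pCons)

text \<open>The \<open>q\<close>-Pochhammer polynomial \<open>(t x; t)\<^sub>m\<close>.\<close>

definition qpoch :: "complex \<Rightarrow> nat \<Rightarrow> complex poly" where
  "qpoch t m = (\<Prod>k<m. [:1, - (t ^ Suc k):])"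

text \<open>The Jackson integral over the unit interval in base \<open>t\<close>: a Riemann sum on
  the points \<open>t ^ j\<close> with cell lengths \<open>t ^ j - t ^ Suc j\<close>.\<close>

definition jackson :: "complex \<Rightarrow> complex poly \<Rightarrow> complex" where
  "jackson t p = (1 - t) * suminf (\<lambda>j. t ^ j * poly p (t ^ j))"

lemma poly_bounded_unit_disc: "\<exists>B. \<forall>z. cmod z \<le> 1 \<longrightarrow> cmod (poly p z) \<le> B"
proof -
  have "compact (poly p ` cball 0 1)"
    by (intro compact_continuous_image continuous_intros) simp
  then have "bounded (poly p ` cball 0 1)"
    by (rule compact_imp_bounded)
  then obtain B where "\<forall>x\<in>poly p ` cball 0 1. cmod x \<le> B"
    unfolding bounded_iff by blast
  then show ?thesis
    by (intro exI[of _ B]) simp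
qed

lemma summable_jackson:
  assumes "cmod t < 1"
  shows "summable (\<lambda>j. t ^ j * poly p (t ^ j))"
proof -
  obtain B where B: "\<And>z. cmod z \<le> 1 \<Longrightarrow> cmod (poly p z) \<le> B"
    using poly_bounded_unit_disc by blast
  show ?thesis
  proof (rule summable_comparison_test'[where N = 0])
    show "summable (\<lambda>j. cmod t ^ j * B)"
      using assms by (intro summable_mult2 summable_geometric) simp
    show "norm (t ^ j * poly p (t ^ j)) \<le> cmod t ^ j * B" for j
      using assms B[of "t ^ j"] by (simp add: norm_mult norm_power power_le_one mult_left_mono)
  qed
qed

lemma jackson_add: "cmod t < 1 \<Longrightarrow> jackson t (p + r) = jackson t p + jackson t r"
  by (simp add: jackson_def distrib_left suminf_add[symmetric] summable_jackson)

lemma jackson_smult: "cmod t < 1 \<Longrightarrow> jackson t (smult k p) = k * jackson t p"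
  by (simp add: jackson_def mult.left_commute[of _ k] suminf_mult summable_jackson)

lemma jackson_monom:
  assumes "cmod t < 1"
  shows "jackson t (monom 1 m) = (1 - t) / (1 - t ^ Suc m)"
proof -
  have "cmod (t ^ Suc m) < 1"
    using assms by (simp add: norm_power power_less_one_iff del: power_Suc)
  then have "suminf (\<lambda>j. (t ^ Suc m) ^ j) = 1 / (1 - t ^ Suc m)"
    by (rule suminf_geometric)
  moreover have "t ^ j * poly (monom 1 m) (t ^ j) = (t ^ Suc m) ^ j" for j
    by (simp add: poly_monom power_mult_distrib mult.commute flip: power_mult)
  ultimately show ?thesis
    by (simp add: jackson_def)
qed

lemma poly_qpoch: "poly (qpoch t m) x = (\<Prod>k<m. 1 - t ^ Suc k * x)"
  by (simp add: qpoch_def poly_prod mult.commute)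

text \<open>The value is that of \<open>monom 1 m\<close>, so the Jackson integral satisfies the
  functional equation which \<open>h_cpow\<close> gives for the Haar state.\<close>

lemma jackson_qpoch:
  assumes "cmod t < 1"
  shows "jackson t (qpoch t m) = (1 - t) / (1 - t ^ Suc m)"
proof -
  have t1: "t ^ Suc m \<noteq> 1"
  proof
    assume "t ^ Suc m = 1"
    then have "cmod t ^ Suc m = 1"
      by (metis norm_one norm_power)
    moreover have "cmod t ^ Suc m < 1"
      using assms by (simp add: power_less_one_iff del: power_Suc)
    ultimately show False by simp
  qed
  \<comment> \<open>\<open>G j\<close> is the Pochhammer symbol of \<open>t ^ j\<close> of length
    \<open>Suc m\<close>. Consecutive values differ by the summand times
    \<open>1 - t ^ Suc m\<close>; \<open>G 0\<close> vanishes because of its factor with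
    \<open>k = 0\<close>, and the limit is 1.\<close>
  define G where "G j = (\<Prod>k<Suc m. 1 - t ^ (j + k))" for j
  have "(\<lambda>j. t ^ (j + k)) \<longlonglongrightarrow> 0" for k
    using assms by (intro LIMSEQ_ignore_initial_segment LIMSEQ_power_zero)
  then have "G \<longlonglongrightarrow> (\<Prod>k<Suc m. 1 - 0)"
    unfolding G_def by (intro tendsto_intros)
  then have "(\<lambda>j. G (Suc j) - G j) sums ((\<Prod>k<Suc m. 1 - 0) - G 0)"
    by (rule telescope_sums)
  moreover have "G 0 = 0"
    unfolding G_def by (subst prod.lessThan_Suc_shift) simp
  moreover have "G (Suc j) - G j = (1 - t ^ Suc m) * (t ^ j * poly (qpoch t m) (t ^ j))" for j
  proof -
    let ?P = "\<Prod>k<m. 1 - t ^ (Suc j + k)"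
    have "G (Suc j) = ?P * (1 - t ^ (Suc j + m))"
      by (simp add: G_def)
    moreover have "G j = (1 - t ^ j) * ?P"
      unfolding G_def by (subst prod.lessThan_Suc_shift) simp
    moreover have "poly (qpoch t m) (t ^ j) = ?P"
      unfolding poly_qpoch by (intro prod.cong) (simp_all add: power_add mult_ac)
    ultimately show ?thesis
      by (simp add: algebra_simps power_add)
  qed
  ultimately have "(\<lambda>j. (1 - t ^ Suc m) * (t ^ j * poly (qpoch t m) (t ^ j))) sums 1"
    by simp
  from sums_mult[OF this, of "1 / (1 - t ^ Suc m)"]
  have "(\<lambda>j. t ^ j * poly (qpoch t m) (t ^ j)) sums (1 / (1 - t ^ Suc m))"
    using t1 by simp
  then show ?thesis
    by (simp add: jackson_def sums_unique[symmetric])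
qed

lemma degree_qpoch_le: "degree (qpoch t m) \<le> m"
proof (induction m)
  case (Suc m)
  have "degree (qpoch t (Suc m)) \<le> degree (qpoch t m) + degree [:1, - (t ^ Suc m):]"
    by (simp only: qpoch_def prod.lessThan_Suc) (rule degree_mult_le)
  also have "\<dots> \<le> m + 1"
    by (intro add_mono Suc) simp
  finally show ?case by simp
qed (simp add: qpoch_def)

lemma coeff_mult_degree_le:
  assumes "degree p \<le> m" "degree r \<le> n"
  shows "coeff (p * r :: 'a::comm_semiring_0 poly) (m + n) = coeff p m * coeff r n"
proof -
  have "coeff (p * r) (m + n) = (\<Sum>i\<le>m + n. coeff p i * coeff r (m + n - i))"
    by (simp add: coeff_mult)
  also have "\<dots> = (\<Sum>i\<in>{m}. coeff p i * coeff r (m + n - i))"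
  proof (rule sum.mono_neutral_right)
    show "\<forall>i\<in>{..m + n} - {m}. coeff p i * coeff r (m + n - i) = 0"
    proof
      fix i assume "i \<in> {..m + n} - {m}"
      then have "degree p < i \<or> degree r < m + n - i"
        using assms by auto
      then show "coeff p i * coeff r (m + n - i) = 0"
        by (auto simp: coeff_eq_0)
    qed
  qed auto
  finally show ?thesis by simp
qed

text \<open>The modulus is enough to tell this coefficient from the leading coefficient 1 of
  \<open>monom 1 m\<close>.\<close>

lemma coeff_qpoch: "cmod (coeff (qpoch t m) m) = (\<Prod>k<m. cmod t ^ Suc k)"
proof (induction m)
  case (Suc m)
  have "coeff (qpoch t m * [:1, - (t ^ Suc m):]) (m + 1) = coeff (qpoch t m) m * coeff [:1, - (t ^ Suc m):] 1"
    by (rule coeff_mult_degree_le) (simp_all add: degree_qpoch_le)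
  then show ?case
    using Suc by (simp add: qpoch_def norm_mult norm_power)
qed (simp add: qpoch_def)

text \<open>For positive \<open>m\<close> the leading coefficient of \<open>qpoch t m\<close> has
  modulus below 1, so \<open>monom 1 m - qpoch t m\<close> has degree exactly \<open>m\<close>.
  \<open>H\<close> and the Jackson integral both vanish on these differences, and only the value at
  1 remains free.\<close>

lemma functional_eq_jackson:
  fixes H :: "complex poly \<Rightarrow> complex"
  assumes t: "cmod t < 1"
    and add: "\<And>p r. H (p + r) = H p + H r" and smult: "\<And>k p. H (smult k p) = k * H p"
    and qpoch: "\<And>m. H (monom 1 m) = H (qpoch t m)"
  shows "H p = H 1 * jackson t p"
proof -
  \<comment> \<open>For \<open>m = 0\<close> the difference would be 0; the constant 1 takes its
    place and carries the normalisation.\<close>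
  define f where "f m = (if m = 0 then 1 else monom 1 m - qpoch t m)" for m
  have j1: "jackson t 1 = 1"
  proof -
    have "t \<noteq> 1"
      using t by auto
    then show ?thesis
      using jackson_monom[OF t, of 0] by (simp add: monom_0 one_pCons)
  qed
  have diff: "H (p - r) = H p - H r" "jackson t (p - r) = jackson t p - jackson t r" for p r
    using add[of "p - r" r] jackson_add[OF t, of "p - r" r] by simp_all
  have "H p - H 1 * jackson t p = 0"
  proof (rule linear_functional_eq_0[where f = f])
    show "H (f m) - H 1 * jackson t (f m) = 0" for m
      using t by (simp add: f_def j1 diff qpoch jackson_monom jackson_qpoch)
    show "degree (f m) \<le> m" for m
      by (auto simp: f_def intro!: degree_diff_le degree_monom_le degree_qpoch_le)
    show "coeff (f m) m \<noteq> 0" for m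
    proof (cases m)
      case (Suc n)
      have "(\<Prod>k<m. cmod t ^ Suc k) = (\<Prod>k<n. cmod t ^ Suc (Suc k)) * cmod t"
        unfolding Suc by (subst prod.lessThan_Suc_shift) (simp add: mult.commute)
      also have "\<dots> \<le> 1 * cmod t"
        using t by (intro mult_right_mono prod_le_1) (simp_all add: power_le_one mult_le_one)
      finally have "cmod (coeff (qpoch t m) m) < 1"
        using t by (simp add: coeff_qpoch)
      then show ?thesis
        using Suc by (auto simp: f_def)
    qed (simp add: f_def)
  qed (use t in \<open>simp_all add: add smult jackson_add jackson_smult algebra_simps\<close>)
  then show ?thesis by simp
qed

section \<open>Pochhammer identities in the algebra\<close>

context uq2_relations
begin

text \<open>The innermost pair is \<open>1 - of_real s *\<^sub>C c\<close>; moving its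
  \<open>c\<close> to the right through \<open>a ^ m\<close> turns \<open>s\<close> into
  \<open>s ^ Suc m\<close> and yields the next Pochhammer factor.\<close>

lemma a'pow_apow: "(a\<^sup>\<star>) ^ m * a ^ m = peval c (qpoch (of_real s) m)"
proof (induction m)
  case (Suc m)
  have "(a\<^sup>\<star>) ^ Suc m * a ^ Suc m = (a\<^sup>\<star>) ^ m * (a\<^sup>\<star> * a) * a ^ m"
    by (simp only: power_Suc2[of "a\<^sup>\<star>"] power_Suc[of a] mult.assoc)
  also have "\<dots> = (a\<^sup>\<star>) ^ m * a ^ m - of_real s *\<^sub>C ((a\<^sup>\<star>) ^ m * (c * a ^ m))"
    by (simp add: a'a_c mult.assoc left_diff_distrib right_diff_distrib scaleC_mult)
  also have "\<dots> = (a\<^sup>\<star>) ^ m * a ^ m * (1 - of_real s ^ Suc m *\<^sub>C c)"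
    by (simp add: c_apow mult.assoc right_diff_distrib scaleC_mult)
  also have "1 - of_real s ^ Suc m *\<^sub>C c = peval c [:1, - (of_real s ^ Suc m):]"
    by (simp add: peval_pCons scaleC_minus_left scaleC_one mult_scaleC_right)
  finally show ?case
    by (simp only: Suc peval_mult[symmetric] qpoch_def prod.lessThan_Suc)
qed (simp add: qpoch_def)

lemma bpow_b'pow: "b ^ m * (b\<^sup>\<star>) ^ m = c ^ m"
proof (induction m)
  case (Suc m)
  have "b ^ Suc m * (b\<^sup>\<star>) ^ Suc m = b * (b ^ m * (b\<^sup>\<star>) ^ m) * b\<^sup>\<star>"
    by (simp only: power_Suc[of b] power_Suc2[of "b\<^sup>\<star>"] mult.assoc)
  also have "\<dots> = c ^ m * b * b\<^sup>\<star>"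
    using power_commuting_commutes[OF c_b, of m] by (simp add: Suc)
  finally show ?case
    by (simp add: c_def mult.assoc power_commutes)
qed simp

lemma peval_c_commute:
  assumes "c * x = x * c"
  shows "peval c p * x = x * peval c p"
proof (induction p)
  case (pCons k p)
  have "c * peval c p * x = c * x * peval c p"
    by (simp add: pCons mult.assoc)
  also have "\<dots> = x * (c * peval c p)"
    by (simp add: assms mult.assoc)
  finally show ?case
    by (simp add: peval_pCons algebra_simps scaleC_mult)
qed simp

end

section \<open>The Haar state on polynomials in \<open>c\<close>\<close>

lemma eval_free_induct:
  fixes P :: "'a::complex_star_algebra_1 \<Rightarrow> bool"
  assumes "P 1" "\<And>g. P (u g)" and mult: "\<And>x y. P x \<Longrightarrow> P y \<Longrightarrow> P (x * y)"
    and add: "\<And>x y. P x \<Longrightarrow> P y \<Longrightarrow> P (x + y)"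
    and star: "\<And>x. P x \<Longrightarrow> P (x\<^sup>\<star>)" and scale: "\<And>k x. P x \<Longrightarrow> P (k *\<^sub>C x)"
  shows "P (eval_free u x)"
proof (induction x rule: poly_mapping_add_induct)
  case zero
  show ?case
    using scale[OF assms(1), of 0] by (simp add: eval_free_zero scaleC_zero_left)
next
  case (single w k)
  have "P (prod_list (map (\<lambda>(g, t). if t then (u g)\<^sup>\<star> else u g) l))" for l
    by (induction l) (auto intro!: mult star assms(1,2))
  then show ?case
    by (simp add: eval_free_single eval_word_def scale)
qed (simp add: eval_free_add add)

text \<open>With \<open>h (x\<^sup>\<star> * x) = 0\<close>, positivity at
  \<open>y\<^sup>\<star> + k *\<^sub>C x\<close> says that an expression real-affine in
  \<open>k\<close> is never negative, so its linear part is 0. Real and imaginary \<open>k\<close>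
  together separate \<open>u\<close> from \<open>v\<close>, without assuming that \<open>h\<close>
  respects the star.\<close>

lemma state_cauchy_schwarz_zero:
  assumes h: "state h" and x: "h (x\<^sup>\<star> * x) = 0"
  shows "h (y * x) = 0"
proof -
  have add: "h (v + w) = h v + h w" and scale: "h (k *\<^sub>C v) = k * h v" for v w k
    using h by (simp_all add: state_def clinear_map_def scaleC_complex_def)
  have pos: "h (v\<^sup>\<star> * v) \<in> \<real>\<^sub>\<ge>\<^sub>0" for v
    using h by (simp add: state_def)
  define B where "B = h (y * y\<^sup>\<star>)"
  define u where "u = h (y * x)"
  define v where "v = h (x\<^sup>\<star> * y\<^sup>\<star>)"
  have exp: "B + k * u + cnj k * v \<in> \<real>\<^sub>\<ge>\<^sub>0" for k
  proof -
    have "h ((y\<^sup>\<star> + k *\<^sub>C x)\<^sup>\<star> * (y\<^sup>\<star> + k *\<^sub>C x)) = B + k * u + cnj k * v"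
      by (simp add: B_def u_def v_def star_add star_star star_scaleC distrib_left distrib_right add scale
          scaleC_mult x)
    then show ?thesis
      using pos by metis
  qed
  have lin: "z = 0" if z: "\<And>t. B + of_real t * z \<in> \<real>\<^sub>\<ge>\<^sub>0" for z
  proof -
    have im: "Im B + t * Im z = 0" and re: "0 \<le> Re B + t * Re z" for t
      using z[of t] by (simp_all add: complex_nonneg_Reals_iff)
    have "Im z = 0"
      using im[of 0] im[of 1] by simp
    moreover have "Re z = 0"
    proof (rule ccontr)
      assume "Re z \<noteq> 0"
      then have "0 \<le> Re B + (- Re B - 1)"
        using re[of "(- Re B - 1) / Re z"] by simp
      then show False by simp
    qed
    ultimately show ?thesis
      by (simp add: complex_eq_iff)
  qed
  have "u + v = 0"
    using exp[of "of_real _"] by (intro lin) (simp add: algebra_simps)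
  moreover have "\<i> * (u - v) = 0"
    using exp[of "of_real _ * \<i>"] by (intro lin) (simp add: algebra_simps)
  ultimately show ?thesis
    by (simp add: u_def)
qed

text \<open>\<open>state\<close> normalises by \<open>onorm h = 1\<close>. If \<open>h 1\<close>
  were 0, the degenerate Cauchy-Schwarz inequality at \<open>x = 1\<close> would make
  \<open>h\<close> zero.\<close>

lemma state_one:
  assumes "state h"
  shows "\<exists>r>0. h 1 = of_real r"
proof -
  have lin: "bounded_linear h" "onorm h = 1"
    using assms by (simp_all add: state_def)
  have "h (1\<^sup>\<star> * 1) \<in> \<real>\<^sub>\<ge>\<^sub>0"
    using assms by (simp only: state_def)
  then obtain r where r: "r \<ge> 0" "h 1 = of_real r"
    by (auto simp: star_one elim!: nonneg_Reals_cases)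
  have "h 1 \<noteq> 0"
  proof
    assume "h 1 = 0"
    then have "h x = 0" for x
      using state_cauchy_schwarz_zero[OF assms, of 1 x] by (simp add: star_one)
    then have "onorm h = 0"
      using lin(1) by (simp add: onorm_eq_0)
    then show False
      using lin(2) by simp
  qed
  then show ?thesis
    using r by (auto simp: less_le)
qed

section \<open>Slices of the minimal tensor product\<close>

locale minimal_tensor =
  fixes ten :: "'a::cstar_algebra \<Rightarrow> 'a \<Rightarrow> 't::cstar_algebra"
  assumes minimal: "minimal_tensor_product ten"
begin

lemma ten_scale_left: "ten (k *\<^sub>C x) y = k *\<^sub>C ten x y"
  and ten_scale_right: "ten x (k *\<^sub>C y) = k *\<^sub>C ten x y"
  and ten_mult: "ten x y * ten x' y' = ten (x * x') (y * y')"
  and ten_star: "(ten x y)\<^sup>\<star> = ten (x\<^sup>\<star>) (y\<^sup>\<star>)"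
  and ten_one: "ten 1 1 = 1"
  and ten_dense: "closure (algebraic_tensor ten) = UNIV"
  using minimal by (simp_all add: minimal_tensor_product_def clinear_map_def)

lemma ten_power: "ten x y ^ n = ten (x ^ n) (y ^ n)"
  by (induction n) (simp_all add: ten_one ten_mult)

lemma bounded_linear_eq_on_tensors:
  fixes F G :: "'t \<Rightarrow> 'b::real_normed_vector"
  assumes F: "bounded_linear F" and G: "bounded_linear G" and eq: "\<And>x y. F (ten x y) = G (ten x y)"
  shows "F t = G t"
proof -
  have "closure (algebraic_tensor ten) \<subseteq> {t. F t = G t}"
  proof (rule closure_minimal)
    show "algebraic_tensor ten \<subseteq> {t. F t = G t}"
      using F G eq
      by (auto simp: algebraic_tensor_def linear_sum[OF bounded_linear.linear])
    show "closed {t. F t = G t}"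
      using F G by (intro closed_Collect_eq linear_continuous_on)
  qed
  then show ?thesis
    using ten_dense by blast
qed

text \<open>Together with the next lemma: slicing the second leg is a bimodule map over the first,
  so factors of the first leg can be taken out and compressed by \<open>e\<close>.\<close>

lemma right_slice_mult_left:
  assumes "right_slice ten \<phi> S"
  shows "S (ten x 1 * t) = x * S t"
proof (rule bounded_linear_eq_on_tensors)
  show "bounded_linear (\<lambda>t. S (ten x 1 * t))" "bounded_linear (\<lambda>t. x * S t)"
    using assms
    by (auto simp: right_slice_def intro: bounded_linear_compose bounded_linear_mult_right)
  show "S (ten x 1 * ten y z) = x * S (ten y z)" for y z
    using assms by (simp add: right_slice_def ten_mult scaleC_mult)
qed

lemma right_slice_mult_right:
  assumes "right_slice ten \<phi> S"
  shows "S (t * ten x 1) = S t * x"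
proof (rule bounded_linear_eq_on_tensors)
  show "bounded_linear (\<lambda>t. S (t * ten x 1))" "bounded_linear (\<lambda>t. S t * x)"
    using assms
    by (auto simp: right_slice_def intro: bounded_linear_compose bounded_linear_mult_left)
  show "S (ten y z * ten x 1) = S (ten y z) * x" for y z
    using assms by (simp add: right_slice_def ten_mult scaleC_mult)
qed

text \<open>For a character \<open>\<psi>\<close>, the triple consists of \<open>t\<close>, \<open>(\<psi> \<otimes> id) t\<close> and \<open>(id \<otimes> \<psi>) t\<close>.\<close>

inductive char_slices :: "('a \<Rightarrow> complex) \<Rightarrow> 't \<Rightarrow> 'a \<Rightarrow> 'a \<Rightarrow> bool" for \<psi> where
  tensor: "char_slices \<psi> (ten x y) (\<psi> x *\<^sub>C y) (\<psi> y *\<^sub>C x)"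
| add: "char_slices \<psi> t y z \<Longrightarrow> char_slices \<psi> t' y' z' \<Longrightarrow> char_slices \<psi> (t + t') (y + y') (z + z')"

context
  fixes \<psi> :: "'a \<Rightarrow> complex"
  assumes \<psi>: "star_hom \<psi>"
begin

lemma char_add: "\<psi> (x + y) = \<psi> x + \<psi> y"
  and char_scale: "\<psi> (k *\<^sub>C x) = k * \<psi> x"
  and char_mult: "\<psi> (x * y) = \<psi> x * \<psi> y"
  and char_star: "\<psi> (x\<^sup>\<star>) = cnj (\<psi> x)"
  and char_one: "\<psi> 1 = 1"
  using \<psi> by (simp_all add: star_hom_def clinear_map_def scaleC_complex_def star_complex_def)

lemma char_slices_tensor:
  assumes "t = ten x y" "z = \<psi> x *\<^sub>C y" "z' = \<psi> y *\<^sub>C x"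
  shows "char_slices \<psi> t z z'"
  using assms tensor by simp

lemma char_slices_one: "char_slices \<psi> 1 1 1"
  by (rule char_slices_tensor[of _ 1 1]) (simp_all add: ten_one char_one scaleC_one)

lemma char_slices_scale: "char_slices \<psi> t y z \<Longrightarrow> char_slices \<psi> (k *\<^sub>C t) (k *\<^sub>C y) (k *\<^sub>C z)"
proof (induction rule: char_slices.induct)
  case (tensor x y)
  show ?case
    by (rule char_slices_tensor[of _ "k *\<^sub>C x" y])
      (simp_all add: ten_scale_left char_scale scaleC_scaleC mult.commute)
qed (simp add: scaleC_add_right add)

lemma char_slices_star: "char_slices \<psi> t y z \<Longrightarrow> char_slices \<psi> (t\<^sup>\<star>) (y\<^sup>\<star>) (z\<^sup>\<star>)"
proof (induction rule: char_slices.induct)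
  case (tensor x y)
  show ?case
    by (rule char_slices_tensor[of _ "x\<^sup>\<star>" "y\<^sup>\<star>"]) (simp_all add: ten_star star_scaleC char_star)
qed (simp add: star_add add)

text \<open>Slicing with a character is multiplicative. Stated for the relation on finite sums of
  tensors, this does not require a slice map for \<open>\<psi>\<close> to be constructed.\<close>

lemma char_slices_mult:
  assumes "char_slices \<psi> t y z" "char_slices \<psi> t' y' z'"
  shows "char_slices \<psi> (t * t') (y * y') (z * z')"
  using assms
proof (induction arbitrary: t' y' z' rule: char_slices.induct)
  case outer: (tensor x y)
  show ?case
    using outer
  proof (induction rule: char_slices.induct)
    case (tensor x' y')
    show ?case
      by (rule char_slices_tensor[of _ "x * x'" "y * y'"])
        (simp_all add: ten_mult char_mult scaleC_mult mult.commute)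
  qed (simp add: distrib_left add)
qed (simp add: distrib_right add)

text \<open>Slices in different legs commute: both sides are \<open>\<psi>\<close> on the first leg
  and \<open>\<phi>\<close> on the second. Hence slicing with \<open>\<phi>\<close> on the right
  meets the left slice \<open>y\<close>.\<close>

lemma char_slices_right:
  assumes "right_slice ten \<phi> S" "char_slices \<psi> t y z" "clinear_map \<phi>"
  shows "\<psi> (S t) = \<phi> y"
  using assms(2)
  by (induction rule: char_slices.induct)
    (use assms(1,3) in \<open>simp_all add: right_slice_def clinear_map_def char_scale char_add
      scaleC_complex_def mult.commute\<close>)

lemma char_slices_left:
  assumes "left_slice ten \<phi> S" "char_slices \<psi> t y z" "clinear_map \<phi>"
  shows "\<psi> (S t) = \<phi> z"
  using assms(2)
  by (induction rule: char_slices.induct)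
    (use assms(1,3) in \<open>simp_all add: left_slice_def clinear_map_def char_scale char_add
      scaleC_complex_def mult.commute\<close>)

end

end

section \<open>Invariance of the Haar state on powers of \<open>c\<close>\<close>

locale uq2_haar = uq2_relations q a b D + minimal_tensor ten
  for q and a b D :: "'a::cstar_algebra" and ten :: "'a \<Rightarrow> 'a \<Rightarrow> 't::cstar_algebra" +
  fixes \<Delta> :: "'a \<Rightarrow> 't" and h :: "'a \<Rightarrow> complex"
  assumes C_Uq2: "C_Uq2 q a b D"
    and comultiplication: "uq2_comultiplication q a b D ten \<Delta>"
    and haar: "haar_state ten \<Delta> h"
begin

lemma state_h: "state h"
  using haar by (simp add: haar_state_def)

lemma clinear_h: "clinear_map h" and bounded_linear_h: "bounded_linear h"
  using state_h by (simp_all add: state_def)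

lemma h_add: "h (x + y) = h x + h y" and h_scale: "h (k *\<^sub>C x) = k * h x"
  using clinear_h by (simp_all add: clinear_map_def scaleC_complex_def)

lemma e_nz: "e \<noteq> 0"
  using C_Uq2_norm_b_ge_1[OF q_pos q_less_1 C_Uq2] by (rule e_nonzero)

lemma \<Delta>_add: "\<Delta> (x + y) = \<Delta> x + \<Delta> y"
  and \<Delta>_scale: "\<Delta> (k *\<^sub>C x) = k *\<^sub>C \<Delta> x"
  and \<Delta>_mult: "\<Delta> (x * y) = \<Delta> x * \<Delta> y"
  and \<Delta>_star: "\<Delta> (x\<^sup>\<star>) = (\<Delta> x)\<^sup>\<star>"
  and \<Delta>_one: "\<Delta> 1 = 1"
  and \<Delta>_a: "\<Delta> a = ten a a - cnj q *\<^sub>C ten b (D * b\<^sup>\<star>)"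
  and \<Delta>_b: "\<Delta> b = ten a b + ten b (D * a\<^sup>\<star>)"
  and \<Delta>_D: "\<Delta> D = ten D D"
  using comultiplication by (simp_all add: uq2_comultiplication_def star_hom_def clinear_map_def)

lemma \<Delta>_power: "\<Delta> (x ^ n) = \<Delta> x ^ n"
  by (induction n) (simp_all add: \<Delta>_one \<Delta>_mult)

text \<open>The two summands of \<open>\<Delta> b\<close> commute up to a scalar, so in every mixed
  monomial one factor \<open>ten a b\<close> can be moved to the far left. Only the pure power of
  the other summand escapes.\<close>

lemma \<Delta>_b_power: "\<exists>X. \<Delta> (b ^ m) = ten a b * X + ten b (D * a\<^sup>\<star>) ^ m"
proof -
  let ?u = "ten a b" and ?v = "ten b (D * a\<^sup>\<star>)"
  have Da'b: "D * a\<^sup>\<star> * b = q *\<^sub>C (D * b * a\<^sup>\<star>)"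
    by (simp add: mult.assoc a'b mult_scaleC_right)
  have bDa': "b * (D * a\<^sup>\<star>) = \<omega> *\<^sub>C (D * b * a\<^sup>\<star>)"
    by (simp add: bD_\<omega> mult_scaleC_left flip: mult.assoc)
  have "?v * ?u = (q * q) *\<^sub>C ten (a * b) (D * b * a\<^sup>\<star>)"
    by (simp add: ten_mult ba Da'b ten_scale_left ten_scale_right scaleC_scaleC)
  also have "ten (a * b) (D * b * a\<^sup>\<star>) = cnj \<omega> *\<^sub>C (?u * ?v)"
    by (simp add: ten_mult bDa' ten_scale_right scaleC_scaleC \<omega>_cnj scaleC_one)
  finally have vu: "?v * ?u = (q * q * cnj \<omega>) *\<^sub>C (?u * ?v)"
    by (simp add: scaleC_scaleC)
  have "\<exists>X. (?u + ?v) ^ m = ?u * X + ?v ^ m"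
  proof (induction m)
    case 0
    show ?case by (rule exI[of _ 0]) simp
  next
    case (Suc m)
    then obtain X where X: "(?u + ?v) ^ m = ?u * X + ?v ^ m" by blast
    have "(?u + ?v) ^ Suc m = ?u * (?u * X + ?v ^ m) + (?v * ?u) * X + ?v ^ Suc m"
      by (simp add: X distrib_left distrib_right mult.assoc)
    also have "\<dots> = ?u * (?u * X + ?v ^ m + (q * q * cnj \<omega>) *\<^sub>C (?v * X)) + ?v ^ Suc m"
      by (simp add: vu distrib_left scaleC_mult mult.assoc)
    finally show ?case by blast
  qed
  then show ?thesis
    by (simp add: \<Delta>_power \<Delta>_b)
qed

text \<open>
  Compressing the invariance identity for \<open>c\<^sup>m\<close> by \<open>e\<close> in the first leg kills every term of the
  comultiplication containing \<open>a\<close> or \<open>a\<^sup>\<star>\<close> in the outermost position of that leg.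
\<close>

lemma h_cpow: "h (c ^ m) = h ((a\<^sup>\<star>) ^ m * a ^ m)"
proof -
  obtain S where S: "right_slice ten h S" and inv: "\<And>x. S (\<Delta> x) = h x *\<^sub>C 1"
    using haar by (auto simp: haar_state_def)
  have S_add: "S (t + t') = S t + S t'" and S_ten: "S (ten x y) = h y *\<^sub>C x" for t t' x y
    using S by (simp_all add: right_slice_def clinear_map_def)
  let ?u = "ten a b" and ?v = "ten b (D * a\<^sup>\<star>)"
  obtain X where X: "\<Delta> (b ^ m) = ?u * X + ?v ^ m"
    using \<Delta>_b_power by blast
  have u: "?u = ten a 1 * ten 1 b" and u': "?u\<^sup>\<star> = ten 1 (b\<^sup>\<star>) * ten (a\<^sup>\<star>) 1"
    by (simp_all add: ten_mult ten_star)
  \<comment> \<open>The \<open>a\<close> of the first leg leaves the slice on the left and is killed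
    by \<open>e * a = 0\<close>; \<open>right\<close> is the mirror image with
    \<open>a\<^sup>\<star> * e = 0\<close>.\<close>
  have left: "e * S (?u * t) = 0" for t
    by (simp add: u mult.assoc right_slice_mult_left[OF S]) (simp add: e_a flip: mult.assoc)
  have right: "S (t * ?u\<^sup>\<star>) * e = 0" for t
  proof -
    have "t * ?u\<^sup>\<star> = (t * ten 1 (b\<^sup>\<star>)) * ten (a\<^sup>\<star>) 1"
      by (simp only: u' mult.assoc)
    then show ?thesis
      by (simp only: right_slice_mult_right[OF S]) (simp add: mult.assoc a'_e)
  qed
  have "\<Delta> (c ^ m) = \<Delta> (b ^ m) * (\<Delta> (b ^ m))\<^sup>\<star>"
    by (simp only: bpow_b'pow[symmetric] \<Delta>_mult star_power[symmetric] \<Delta>_star)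
  also have "\<dots> = ?u * (X * (?u * X + ?v ^ m)\<^sup>\<star>) + (?v ^ m * X\<^sup>\<star>) * ?u\<^sup>\<star> + ?v ^ m * (?v ^ m)\<^sup>\<star>"
    by (simp add: X star_add star_mult distrib_left distrib_right mult.assoc)
  finally obtain Y Z where "\<Delta> (c ^ m) = ?u * Y + Z * ?u\<^sup>\<star> + ?v ^ m * (?v ^ m)\<^sup>\<star>"
    by blast
  then have "e * S (\<Delta> (c ^ m)) * e
      = e * S (?u * Y) * e + e * (S (Z * ?u\<^sup>\<star>) * e) + e * S (?v ^ m * (?v ^ m)\<^sup>\<star>) * e"
    by (simp only: S_add distrib_left distrib_right mult.assoc[of e _ e])
  then have "e * S (\<Delta> (c ^ m)) * e = e * S (?v ^ m * (?v ^ m)\<^sup>\<star>) * e"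
    by (simp only: left right mult_zero_left mult_zero_right add_0)
  moreover have "?v ^ m * (?v ^ m)\<^sup>\<star> = ten (c ^ m) ((a\<^sup>\<star>) ^ m * a ^ m)"
  proof -
    have Da': "(D * a\<^sup>\<star>) ^ m = D ^ m * (a\<^sup>\<star>) ^ m"
    proof (induction m)
      case (Suc m)
      have "(D * a\<^sup>\<star>) ^ Suc m = D * (a\<^sup>\<star> * D ^ m) * (a\<^sup>\<star>) ^ m"
        by (simp add: Suc mult.assoc)
      also have "a\<^sup>\<star> * D ^ m = D ^ m * a\<^sup>\<star>"
        using power_commuting_commutes[of D "a\<^sup>\<star>" m] a'D by simp
      finally show ?case by (simp add: mult.assoc)
    qed simp
    \<comment> \<open>\<open>D\<close> commutes with \<open>c\<close>, so it cancels from the second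
      leg as soon as \<open>(a\<^sup>\<star>) ^ m * a ^ m\<close> is written as a polynomial in
      \<open>c\<close>.\<close>
    have conj: "D ^ m * peval c p * (D\<^sup>\<star>) ^ m = peval c p" for p
    proof (induction m)
      case (Suc m)
      have "D ^ Suc m * peval c p * (D\<^sup>\<star>) ^ Suc m = D * (D ^ m * peval c p * (D\<^sup>\<star>) ^ m) * D\<^sup>\<star>"
        by (simp only: power_Suc[of D] power_Suc2[of "D\<^sup>\<star>"] mult.assoc)
      also have "\<dots> = peval c p * D * D\<^sup>\<star>"
        by (simp only: Suc peval_c_commute[OF c_D])
      finally show ?case by (simp add: mult.assoc DD')
    qed simp
    have "(D * a\<^sup>\<star>) ^ m * ((D * a\<^sup>\<star>) ^ m)\<^sup>\<star> = D ^ m * ((a\<^sup>\<star>) ^ m * a ^ m) * (D\<^sup>\<star>) ^ m"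
      by (simp add: Da' star_mult star_power star_star mult.assoc)
    also have "\<dots> = (a\<^sup>\<star>) ^ m * a ^ m"
      by (simp only: a'pow_apow conj)
    finally show ?thesis
      by (simp add: ten_power ten_star ten_mult star_power bpow_b'pow)
  qed
  moreover have "e * e = e"
  proof -
    have "e * c ^ n = e" for n
      by (induction n) (simp_all add: e_c flip: mult.assoc)
    then show ?thesis
      using tendsto_mult_left[OF cpow_tendsto_e, of e] by (simp add: LIMSEQ_const_iff)
  qed
  moreover have "e * c ^ m = e"
    by (induction m) (simp_all add: e_c flip: mult.assoc)
  \<comment> \<open>On the left invariance turns the slice into the scalar \<open>h (c ^ m)\<close>;
    on the right the surviving first leg \<open>c ^ m\<close> is absorbed by
    \<open>e\<close>.\<close>
  ultimately have "h (c ^ m) *\<^sub>C e = h ((a\<^sup>\<star>) ^ m * a ^ m) *\<^sub>C e"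
    by (simp add: inv S_ten scaleC_mult)
  then have "(h (c ^ m) - h ((a\<^sup>\<star>) ^ m * a ^ m)) *\<^sub>C e = 0"
    by (simp add: scaleC_diff_left)
  then have "cmod (h (c ^ m) - h ((a\<^sup>\<star>) ^ m * a ^ m)) * norm e = 0"
    by (simp only: norm_scaleC[symmetric] norm_zero)
  then show ?thesis
    using e_nz by simp
qed

text \<open>By \<open>a'pow_apow\<close>, \<open>h_cpow\<close> is the hypothesis of
  \<open>functional_eq_jackson\<close> with \<open>t = of_real s\<close>.\<close>

lemma h_peval: "h (peval c p) = h 1 * jackson (of_real s) p"
proof -
  have "peval c (monom 1 m) = c ^ m" for m
    by (simp add: monom_altdef peval_power peval_X)
  then have "h (peval c p) = h (peval c 1) * jackson (of_real s) p"
    using s_pos s_less_1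
    by (intro functional_eq_jackson[where H = "\<lambda>p. h (peval c p)"])
      (simp_all add: peval_add peval_smult h_add h_scale h_cpow a'pow_apow)
  then show ?thesis by simp
qed

text \<open>All terms of the Jackson series for \<open>cnj p * p\<close> are nonnegative; keep the
  one at \<open>s ^ m\<close>, whose weight is \<open>h 1\<close> times
  \<open>(1 - s) * s ^ m\<close>.\<close>

lemma h_peval_ge:
  "\<exists>w>0. \<forall>p. w * (cmod (poly p (of_real (s ^ m))))\<^sup>2 \<le> Re (h ((peval c p)\<^sup>\<star> * peval c p))"
proof -
  obtain r where r: "r > 0" "h 1 = of_real r"
    using state_one[OF state_h] by blast
  have "r * (1 - s) * s ^ m * (cmod (poly p (of_real (s ^ m))))\<^sup>2 \<le> Re (h ((peval c p)\<^sup>\<star> * peval c p))" for p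
  proof -
    let ?P = "map_poly cnj p * p"
    let ?f = "\<lambda>j. s ^ j * (cmod (poly p (of_real (s ^ j))))\<^sup>2"
    have f: "of_real s ^ j * poly ?P (of_real s ^ j) = complex_of_real (?f j)" for j
      using poly_cnj_of_real[of p "s ^ j"] complex_norm_square[of "poly p (of_real (s ^ j))"]
      by (simp add: mult.commute)
    have "summable (\<lambda>j. of_real s ^ j * poly ?P (of_real s ^ j))"
      using s_pos s_less_1 by (intro summable_jackson) simp
    then have sum: "summable ?f" and "suminf (\<lambda>j. complex_of_real (?f j)) = of_real (suminf ?f)"
      by (simp_all only: f summable_of_real_iff suminf_of_real[symmetric])
    then have "jackson (of_real s) ?P = of_real ((1 - s) * suminf ?f)"
      by (simp only: jackson_def f) simp
    then have h: "h ((peval c p)\<^sup>\<star> * peval c p) = of_real (r * ((1 - s) * suminf ?f))"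
      by (simp only: star_peval[OF c_star] peval_mult[symmetric] h_peval r of_real_mult)
    have "?f m \<le> suminf ?f"
      using sum_le_suminf[OF sum, of "{m}"] s_pos by simp
    then have "r * ((1 - s) * ?f m) \<le> r * ((1 - s) * suminf ?f)"
      using r s_less_1 by (intro mult_left_mono) auto
    then show ?thesis
      by (simp only: h Re_complex_of_real mult.assoc)
  qed
  moreover have "0 < r * (1 - s) * s ^ m"
    using r s_pos s_less_1 by simp
  ultimately show ?thesis by blast
qed

end

section \<open>Fourier components of circle actions\<close>

text \<open>Averages over the \<open>M\<close>-th roots of unity replace integration over the
  circle: on a homogeneous element they are exact once \<open>M\<close> is large, and no regularity
  in \<open>z\<close> enters.\<close>

definition uroot :: "nat \<Rightarrow> nat \<Rightarrow> complex" where
  "uroot M j = cis (2 * pi * real j / real M)"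

lemma norm_uroot [simp]: "cmod (uroot M j) = 1"
  by (simp add: uroot_def)

lemma sum_uroot_powi:
  assumes "\<bar>k\<bar> < int M"
  shows "(\<Sum>j<M. uroot M j powi k) = (if k = 0 then of_nat M else 0)"
proof (cases "k = 0")
  case False
  have M: "M > 0"
    using assms by simp
  define w where "w = cis (2 * pi * of_int k / real M)"
  have pow: "uroot M j powi k = w ^ j" for j
    by (simp add: uroot_def w_def cis_power_int Complex.DeMoivre mult_ac)
  have "w ^ M = cis (2 * pi * of_int k)"
    using M by (simp add: w_def Complex.DeMoivre)
  then have "w ^ M = 1"
    by simp
  moreover have "w \<noteq> 1"
  proof
    assume "w = 1"
    then have "cos (2 * pi * of_int k / real M) = 1"
      by (simp add: w_def cis.ctr complex_eq_iff)
    then obtain n :: int where "2 * pi * of_int k / real M = of_int n * 2 * pi"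
      by (auto simp: cos_one_2pi_int)
    then have "of_int k = real_of_int (n * int M)"
      using M by (simp add: field_simps)
    then have "k = n * int M"
      by (simp only: of_int_eq_iff)
    then show False
      using assms False M by (auto simp: abs_mult)
  qed
  ultimately show ?thesis
    using False by (simp add: pow geometric_sum)
qed simp

lemma cnj_power_int_unit:
  assumes "cmod z = 1"
  shows "cnj z = inverse z" "cnj z powi n = z powi (- n)" "cnj (z powi n) = z powi (- n)"
proof -
  have "z * cnj z = 1"
    using complex_norm_square[of z] assms by simp
  then show *: "cnj z = inverse z"
    by (metis inverse_unique)
  show "cnj z powi n = z powi (- n)"
    by (simp add: * power_int_minus power_int_inverse)
  have "(z powi n) * cnj (z powi n) = 1"
    using complex_norm_square[of "z powi n"] assms by (simp add: norm_power_int)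
  then show "cnj (z powi n) = z powi (- n)"
    by (metis inverse_unique power_int_minus)
qed

section \<open>Sequences of contractions tested on a dense set\<close>

lemma contraction_eq_0_of_dense:
  fixes T :: "nat \<Rightarrow> 'a::real_normed_vector \<Rightarrow> 'a"
  assumes lin: "\<And>n. linear (T n)" and contr: "\<And>n x. norm (T n x) \<le> norm x"
    and dense: "closure S = UNIV" and lim: "\<And>y. y \<in> S \<Longrightarrow> (\<lambda>n. T n y) \<longlonglongrightarrow> y"
    and zero: "\<And>n. T n x = 0"
  shows "x = 0"
proof (rule ccontr)
  assume "x \<noteq> 0"
  then have pos: "norm x / 3 > 0" by simp
  then obtain y where y: "y \<in> S" "dist y x < norm x / 3"
    using dense closure_approachable[of x S] by blast
  have "eventually (\<lambda>n. dist (T n y) y < norm x / 3) sequentially"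
    using lim[OF y(1)] pos by (rule tendstoD)
  then obtain n where n: "dist (T n y) y < norm x / 3"
    by (auto simp: eventually_sequentially)
  have "norm (T n y) \<le> norm (y - x)"
    using contr[of n "y - x"] by (simp add: linear_diff[OF lin] zero)
  then have "norm x \<le> norm (y - x) + (norm (T n y - y) + norm (y - x))"
    by norm
  then show False
    using y(2) n pos by (simp add: dist_norm)
qed

lemma contraction_convergent_of_dense:
  fixes T :: "nat \<Rightarrow> 'a::real_normed_vector \<Rightarrow> 'b::banach"
  assumes lin: "\<And>n. linear (T n)" and contr: "\<And>n x. norm (T n x) \<le> norm x"
    and dense: "closure S = UNIV" and conv: "\<And>y. y \<in> S \<Longrightarrow> convergent (\<lambda>n. T n y)"
  shows "convergent (\<lambda>n. T n x)"
proof -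
  have "Cauchy (\<lambda>n. T n x)"
  proof (rule CauchyI)
    fix r :: real assume "0 < r"
    then have pos: "r / 3 > 0" by simp
    then obtain y where y: "y \<in> S" "dist y x < r / 3"
      using dense closure_approachable[of x S] by blast
    have "Cauchy (\<lambda>n. T n y)"
      using conv[OF y(1)] by (rule convergent_Cauchy)
    then obtain N where N: "\<And>m n. m \<ge> N \<Longrightarrow> n \<ge> N \<Longrightarrow> norm (T m y - T n y) < r / 3"
      using pos CauchyD by blast
    have diff: "norm (T n x - T n y) < r / 3" for n
      using contr[of n "x - y"] y(2) by (simp add: linear_diff[OF lin] dist_norm norm_minus_commute)
    have "norm (T m x - T n x) < r" if "m \<ge> N" "n \<ge> N" for m n
      using diff[of m] diff[of n] N[OF that] by norm
    then show "\<exists>N. \<forall>m\<ge>N. \<forall>n\<ge>N. norm (T m x - T n x) < r" by blast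
  qed
  then show ?thesis
    by (simp add: Cauchy_convergent_iff)
qed

text \<open>Density of the span of homogeneous elements takes the place of strong continuity; normal
  forms supply it directly.\<close>

locale circle_action =
  fixes \<gamma> :: "complex \<Rightarrow> 'a::cstar_algebra \<Rightarrow> 'a"
  assumes \<gamma>_add: "cmod z = 1 \<Longrightarrow> \<gamma> z (x + y) = \<gamma> z x + \<gamma> z y"
    and \<gamma>_scale: "cmod z = 1 \<Longrightarrow> \<gamma> z (k *\<^sub>C x) = k *\<^sub>C \<gamma> z x"
    and \<gamma>_norm: "cmod z = 1 \<Longrightarrow> norm (\<gamma> z x) \<le> norm x"
    and \<gamma>_dense: "closure (span (\<Union>n. {y. \<forall>z. cmod z = 1 \<longrightarrow> \<gamma> z y = z powi n *\<^sub>C y})) = UNIV"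
begin

definition homog :: "int \<Rightarrow> 'a set" where
  "homog n = {y. \<forall>z. cmod z = 1 \<longrightarrow> \<gamma> z y = z powi n *\<^sub>C y}"

text \<open>The weights are arbitrary so that Fourier coefficients and averages against the Fejer
  kernel are both instances with one norm bound.\<close>

definition wavg :: "nat \<Rightarrow> (nat \<Rightarrow> complex) \<Rightarrow> 'a \<Rightarrow> 'a" where
  "wavg M k x = (1 / of_nat M) *\<^sub>C (\<Sum>j<M. k j *\<^sub>C \<gamma> (uroot M j) x)"

abbreviation avg :: "nat \<Rightarrow> int \<Rightarrow> 'a \<Rightarrow> 'a" where
  "avg M n \<equiv> wavg M (\<lambda>j. uroot M j powi (- n))"

lemma linear_wavg: "linear (wavg M k)"
  by (rule linearI)
    (simp_all add: wavg_def \<gamma>_add \<gamma>_scale scaleR_scaleC scaleC_add_right sum.distrib scaleC_sum_right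
      scaleC_scaleC mult_ac)

lemma wavg_scaleC: "wavg M k (l *\<^sub>C x) = l *\<^sub>C wavg M k x"
  by (simp add: wavg_def \<gamma>_scale scaleC_sum_right scaleC_scaleC mult_ac)

lemma norm_wavg_le: "norm (wavg M k x) \<le> (\<Sum>j<M. cmod (k j)) / real M * norm x"
proof -
  have "norm (\<Sum>j<M. k j *\<^sub>C \<gamma> (uroot M j) x) \<le> (\<Sum>j<M. cmod (k j) * norm x)"
    by (rule order_trans[OF norm_sum sum_mono]) (simp add: norm_scaleC \<gamma>_norm mult_left_mono)
  then have "1 / real M * norm (\<Sum>j<M. k j *\<^sub>C \<gamma> (uroot M j) x) \<le> 1 / real M * (\<Sum>j<M. cmod (k j) * norm x)"
    by (rule mult_left_mono) simp
  then show ?thesis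
    by (simp add: wavg_def norm_scaleC norm_divide sum_distrib_right)
qed

lemma norm_avg_le: "norm (avg M n x) \<le> norm x"
  using norm_wavg_le[of M "\<lambda>j. uroot M j powi (- n)" x]
  by (cases "M = 0") (simp_all add: norm_power_int)

lemma avg_homog:
  assumes y: "y \<in> homog m" and M: "\<bar>m - n\<bar> < int M"
  shows "avg M n y = (if m = n then y else 0)"
proof -
  have [simp]: "uroot M j \<noteq> 0" for j
    using norm_uroot[of M j] by (metis norm_zero zero_neq_one)
  have "avg M n y = (1 / of_nat M) *\<^sub>C (\<Sum>j<M. uroot M j powi (m - n)) *\<^sub>C y"
    using y by (simp add: wavg_def homog_def scaleC_sum_left scaleC_scaleC flip: power_int_add)
  then show ?thesis
    using M by (cases "M = 0") (simp_all add: sum_uroot_powi scaleC_scaleC scaleC_one scaleC_zero_left)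
qed

lemma eventually_avg_homog:
  assumes "y \<in> homog m"
  shows "eventually (\<lambda>M. avg M n y = (if m = n then y else 0)) sequentially"
  using eventually_gt_at_top[of "nat \<bar>m - n\<bar>"]
  by eventually_elim (rule avg_homog[OF assms], linarith)

lemma homog_dense: "closure (span (\<Union>n. homog n)) = UNIV"
  using \<gamma>_dense by (simp add: homog_def)

lemma avg_convergent: "convergent (\<lambda>M. avg M n x)"
proof (rule contraction_convergent_of_dense[OF linear_wavg norm_avg_le homog_dense])
  fix y assume "y \<in> span (\<Union>n. homog n)"
  then show "convergent (\<lambda>M. avg M n y)"
  proof (induction rule: span_induct)
    case base
    have "convergent (\<lambda>n. r *\<^sub>R f n)" if f: "convergent f" for r and f :: "nat \<Rightarrow> 'a"
    proof -
      obtain L where "f \<longlonglongrightarrow> L"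
        using f by (auto simp: convergent_def)
      then have "(\<lambda>n. r *\<^sub>R f n) \<longlonglongrightarrow> r *\<^sub>R L"
        by (intro tendsto_scaleR tendsto_const)
      then show ?thesis
        by (auto simp: convergent_def)
    qed
    then show ?case
      by (intro subspaceI)
        (auto simp: linear_0[OF linear_wavg] linear_add[OF linear_wavg] linear_scale[OF linear_wavg]
          intro!: convergent_add convergent_const)
  next
    case (step y)
    then obtain m where "y \<in> homog m" by blast
    then show ?case
      using tendsto_eventually[OF eventually_avg_homog] by (auto simp: convergent_def)
  qed
qed

definition component :: "int \<Rightarrow> 'a \<Rightarrow> 'a" where
  "component n x = lim (\<lambda>M. avg M n x)"

lemma tendsto_component: "(\<lambda>M. avg M n x) \<longlonglongrightarrow> component n x"
  using avg_convergent by (simp add: component_def convergent_LIMSEQ_iff)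

lemma component_homog: "y \<in> homog m \<Longrightarrow> component n y = (if m = n then y else 0)"
  using tendsto_component tendsto_eventually[OF eventually_avg_homog] by (rule LIMSEQ_unique)

lemma component_add: "component n (x + y) = component n x + component n y"
  using tendsto_component[of n "x + y"] tendsto_add[OF tendsto_component[of n x] tendsto_component[of n y]]
  by (simp add: linear_add[OF linear_wavg] LIMSEQ_unique)

lemma component_scaleC: "component n (k *\<^sub>C x) = k *\<^sub>C component n x"
proof -
  have "(\<lambda>M. k *\<^sub>C avg M n x) \<longlonglongrightarrow> k *\<^sub>C component n x"
    by (intro tendsto_intros tendsto_component)
  then show ?thesis
    using tendsto_component[of n "k *\<^sub>C x"] by (simp add: wavg_scaleC LIMSEQ_unique)
qed

lemma norm_component_le: "norm (component n x) \<le> norm x"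
  using tendsto_norm[OF tendsto_component[of n x]] norm_avg_le by (intro LIMSEQ_le_const2) auto

lemma bounded_linear_component: "bounded_linear (component n)"
  by (rule bounded_linear_intro[where K = 1])
    (simp_all add: component_add scaleR_scaleC component_scaleC norm_component_le)

lemma component_closed_invariant:
  assumes V: "closed V" "subspace V" "\<And>k x. x \<in> V \<Longrightarrow> k *\<^sub>C x \<in> V"
    "\<And>z x. cmod z = 1 \<Longrightarrow> x \<in> V \<Longrightarrow> \<gamma> z x \<in> V" and x: "x \<in> V"
  shows "component n x \<in> V"
proof (rule closed_sequentially[OF V(1) _ tendsto_component])
  show "avg M n x \<in> V" for M
    unfolding wavg_def by (intro V(3) subspace_sum[OF V(2)] V(4) x norm_uroot)
qed

text \<open>The Fejer mean: the component of degree \<open>n\<close> occurs \<open>K - |n|\<close>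
  times for \<open>|n| < K\<close>. Unlike partial Fourier sums these means are contractions, and
  the double sum exhibits the kernel as a square.\<close>

definition fejer :: "nat \<Rightarrow> 'a \<Rightarrow> 'a" where
  "fejer K x = (1 / of_nat K) *\<^sub>C (\<Sum>i<K. \<Sum>l<K. component (int i - int l) x)"

lemma linear_fejer: "linear (fejer K)"
  by (rule linearI)
    (simp_all add: fejer_def component_add scaleR_scaleC component_scaleC sum.distrib scaleC_add_right
      scaleC_scaleC mult.commute flip: scaleC_sum_right)

lemma norm_fejer_le: "norm (fejer K x) \<le> norm x"
proof (cases "K = 0")
  case False
  \<comment> \<open>The Fejer kernel sampled at the roots of unity. It is nonnegative, and its mean
    is 1 once \<open>M \<ge> K\<close>, since then no nonzero difference \<open>i - l\<close> is
    divisible by \<open>M\<close>; hence its \<open>wavg\<close> is a contraction.\<close>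
  define \<kappa> where "\<kappa> M j = (1 / of_nat K) * (\<Sum>i<K. \<Sum>l<K. uroot M j powi (- (int i - int l)))" for M j
  have \<kappa>_nonneg: "\<kappa> M j = of_real ((cmod (\<Sum>l<K. uroot M j ^ l))\<^sup>2 / real K)" for M j
  proof -
    have [simp]: "uroot M j \<noteq> 0"
      using norm_uroot[of M j] by (metis norm_zero zero_neq_one)
    have "(\<Sum>i<K. \<Sum>l<K. uroot M j powi (- (int i - int l)))
        = (\<Sum>i<K. \<Sum>l<K. uroot M j ^ l * cnj (uroot M j ^ i))"
    proof (intro sum.cong refl)
      fix i l
      have "uroot M j powi (- (int i - int l)) = uroot M j powi int l * uroot M j powi (- int i)"
        by (simp add: power_int_diff power_int_minus divide_inverse)
      then show "uroot M j powi (- (int i - int l)) = uroot M j ^ l * cnj (uroot M j ^ i)"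
        using cnj_power_int_unit(3)[OF norm_uroot, of M j "int i"] by simp
    qed
    also have "\<dots> = (\<Sum>l<K. uroot M j ^ l) * cnj (\<Sum>l<K. uroot M j ^ l)"
      by (subst sum.swap) (simp add: sum_product)
    also have "\<dots> = of_real ((cmod (\<Sum>l<K. uroot M j ^ l))\<^sup>2)"
      by (simp only: complex_norm_square)
    finally show ?thesis
      by (simp add: \<kappa>_def)
  qed
  have sum_\<kappa>: "(\<Sum>j<M. cmod (\<kappa> M j)) / real M = 1" if M: "K \<le> M" for M
  proof -
    have "complex_of_real (\<Sum>j<M. cmod (\<kappa> M j)) = (\<Sum>j<M. \<kappa> M j)"
      by (simp add: \<kappa>_nonneg norm_divide norm_power del: of_real_divide of_real_power)
    also have "\<dots> = (1 / of_nat K) * (\<Sum>i<K. \<Sum>l<K. \<Sum>j<M. uroot M j powi (- (int i - int l)))"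
      unfolding \<kappa>_def sum_distrib_left[symmetric]
      by (subst sum.swap, subst sum.swap) simp
    also have "(\<Sum>i<K. \<Sum>l<K. \<Sum>j<M. uroot M j powi (- (int i - int l)))
        = (\<Sum>i<K. \<Sum>l<K. if i = l then of_nat M else 0)"
      using M by (intro sum.cong refl, subst sum_uroot_powi) auto
    also have "\<dots> = of_nat K * of_nat M"
      by simp
    finally have "complex_of_real (\<Sum>j<M. cmod (\<kappa> M j)) = of_real (real M)"
      using False by simp
    then show ?thesis
      using False M by (simp only: of_real_eq_iff) simp
  qed
  have "norm ((1 / of_nat K) *\<^sub>C (\<Sum>i<K. \<Sum>l<K. avg M (int i - int l) x)) \<le> norm x" if M: "K \<le> M" for M
  proof -
    have "(1 / of_nat K) *\<^sub>C (\<Sum>i<K. \<Sum>l<K. avg M (int i - int l) x)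
        = (1 / of_nat M) *\<^sub>C (1 / of_nat K) *\<^sub>C (\<Sum>i<K. \<Sum>l<K. \<Sum>j<M. uroot M j powi (- (int i - int l)) *\<^sub>C \<gamma> (uroot M j) x)"
      by (simp add: wavg_def scaleC_scaleC mult.commute flip: scaleC_sum_right)
    also have "(\<Sum>i<K. \<Sum>l<K. \<Sum>j<M. uroot M j powi (- (int i - int l)) *\<^sub>C \<gamma> (uroot M j) x)
        = (\<Sum>i<K. \<Sum>j<M. \<Sum>l<K. uroot M j powi (- (int i - int l)) *\<^sub>C \<gamma> (uroot M j) x)"
      by (intro sum.cong refl sum.swap)
    also have "\<dots> = (\<Sum>j<M. \<Sum>i<K. \<Sum>l<K. uroot M j powi (- (int i - int l)) *\<^sub>C \<gamma> (uroot M j) x)"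
      by (rule sum.swap)
    also have "(1 / of_nat M) *\<^sub>C (1 / of_nat K) *\<^sub>C \<dots> = wavg M (\<kappa> M) x"
      by (simp only: wavg_def \<kappa>_def scaleC_sum_left[symmetric] scaleC_sum_right scaleC_scaleC)
    finally show ?thesis
      using norm_wavg_le[of M "\<kappa> M" x] sum_\<kappa>[OF M] by simp
  qed
  moreover have "(\<lambda>M. norm ((1 / of_nat K) *\<^sub>C (\<Sum>i<K. \<Sum>l<K. avg M (int i - int l) x))) \<longlonglongrightarrow> norm (fejer K x)"
    unfolding fejer_def by (intro tendsto_intros tendsto_component)
  ultimately show ?thesis
    by (intro LIMSEQ_le_const2) auto
qed (simp add: fejer_def scaleC_zero_right)

text \<open>On degree \<open>m\<close> the Fejer mean is multiplication by \<open>N K / K\<close>,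
  where \<open>N K\<close> counts the pairs \<open>i\<close>, \<open>l\<close> with
  \<open>i - l = m\<close> and differs from \<open>K\<close> by at most \<open>|m|\<close>.\<close>

lemma fejer_homog:
  assumes y: "y \<in> homog m"
  shows "(\<lambda>K. fejer K y) \<longlonglongrightarrow> y"
proof -
  define N where "N K = card {i \<in> {..<K}. 0 \<le> int i - m \<and> int i - m < int K}" for K
  have fej: "fejer K y = complex_of_real (real (N K) / real K) *\<^sub>C y" for K
  proof -
    have "(\<Sum>l<K. component (int i - int l) y) = (if 0 \<le> int i - m \<and> int i - m < int K then y else 0)" for i
    proof -
      have "(\<Sum>l<K. component (int i - int l) y) = (\<Sum>l<K. if int l = int i - m then y else 0)"
        using y by (intro sum.cong) (auto simp: component_homog)
      also have "\<dots> = (\<Sum>l\<in>{l \<in> {..<K}. int l = int i - m}. y)"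
        by (rule sum.inter_filter[symmetric]) simp
      also have "{l \<in> {..<K}. int l = int i - m}
          = (if 0 \<le> int i - m \<and> int i - m < int K then {nat (int i - m)} else {})"
        by auto
      finally show ?thesis by (simp split: if_splits)
    qed
    then have "fejer K y = (1 / of_nat K) *\<^sub>C (\<Sum>i\<in>{i \<in> {..<K}. 0 \<le> int i - m \<and> int i - m < int K}. y)"
      by (simp only: fejer_def sum.inter_filter[OF finite_lessThan])
    also have "(\<Sum>i\<in>{i \<in> {..<K}. 0 \<le> int i - m \<and> int i - m < int K}. y) = of_nat (N K) *\<^sub>C y"
      by (simp add: N_def scaleC_one flip: scaleC_sum_left[of "\<lambda>_. 1", simplified scaleC_one sum_constant mult_1_right])
    finally show ?thesis
      by (simp add: scaleC_scaleC)
  qed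
  have "N K \<le> K" for K
    using card_mono[of "{..<K}" "{i \<in> {..<K}. 0 \<le> int i - m \<and> int i - m < int K}"] by (auto simp: N_def)
  then have upper: "real (N K) / real K \<le> 1" for K
    by (simp add: divide_le_eq)
  have "K \<le> N K + nat \<bar>m\<bar>" for K
  proof -
    \<comment> \<open>The indices left out lie below \<open>m\<close>, or, for negative
      \<open>m\<close>, among the last \<open>- m\<close> ones.\<close>
    have "{..<K} \<subseteq> {i \<in> {..<K}. 0 \<le> int i - m \<and> int i - m < int K} \<union>
        (if 0 \<le> m then {..<nat m} else {K - nat (- m)..<K})"
      by auto
    then have "card {..<K} \<le> card ({i \<in> {..<K}. 0 \<le> int i - m \<and> int i - m < int K} \<union>
        (if 0 \<le> m then {..<nat m} else {K - nat (- m)..<K}))"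
      by (intro card_mono) auto
    also have "\<dots> \<le> N K + card (if 0 \<le> m then {..<nat m} else {K - nat (- m)..<K})"
      unfolding N_def by (rule card_Un_le)
    also have "card (if 0 \<le> m then {..<nat m} else {K - nat (- m)..<K}) \<le> nat \<bar>m\<bar>"
      by auto
    finally show ?thesis by simp
  qed
  then have "real K \<le> real (N K) + \<bar>of_int m\<bar>" for K
    by (metis of_int_abs of_nat_add of_nat_mono of_nat_nat abs_ge_zero of_int_of_nat_eq)
  then have lower: "1 - \<bar>of_int m\<bar> / real K \<le> real (N K) / real K" if "K > 0" for K
    using that divide_right_mono[OF \<open>real K \<le> real (N K) + \<bar>of_int m\<bar>\<close>, of "real K"]
    by (simp add: add_divide_distrib)
  have "(\<lambda>K. 1 - \<bar>of_int m\<bar> * (1 / real K)) \<longlonglongrightarrow> 1 - \<bar>of_int m\<bar> * 0"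
    by (intro tendsto_intros lim_1_over_n)
  then have "(\<lambda>K. 1 - \<bar>of_int m\<bar> / real K) \<longlonglongrightarrow> 1"
    by simp
  then have "(\<lambda>K. real (N K) / real K) \<longlonglongrightarrow> 1"
  proof (rule tendsto_sandwich[rotated 2, OF _ tendsto_const])
    show "eventually (\<lambda>K. 1 - \<bar>of_int m\<bar> / real K \<le> real (N K) / real K) sequentially"
      using eventually_gt_at_top[of 0] by eventually_elim (rule lower)
    show "eventually (\<lambda>K. real (N K) / real K \<le> 1) sequentially"
      by (simp add: upper)
  qed
  then have "(\<lambda>K. complex_of_real (real (N K) / real K) *\<^sub>C y) \<longlonglongrightarrow> complex_of_real 1 *\<^sub>C y"
    by (intro tendsto_intros)
  then show ?thesis
    by (simp add: fej scaleC_one)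
qed

text \<open>Fourier components determine an element: the Fejer means are built from them and
  approximate the identity on a dense subspace.\<close>

lemma eq_0_if_components_0:
  assumes "\<And>n. component n x = 0"
  shows "x = 0"
proof (rule contraction_eq_0_of_dense[OF linear_fejer norm_fejer_le homog_dense])
  show "fejer K x = 0" for K
    by (simp add: fejer_def assms scaleC_zero_right)
  fix y assume "y \<in> span (\<Union>n. homog n)"
  then show "(\<lambda>K. fejer K y) \<longlonglongrightarrow> y"
  proof (induction rule: span_induct)
    case base
    show ?case
      by (rule subspaceI)
        (auto simp: linear_0[OF linear_fejer] linear_add[OF linear_fejer] linear_scale[OF linear_fejer]
          intro!: tendsto_intros)
  qed (auto intro: fejer_homog)
qed

end

section \<open>Normal forms\<close>

lemma eval_free_uq2_relators:
  fixes a b D :: "'a::complex_star_algebra_1"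
  assumes "b * a = q *\<^sub>C (a * b)" "a\<^sup>\<star> * b = q *\<^sub>C (b * a\<^sup>\<star>)" "b * b\<^sup>\<star> = b\<^sup>\<star> * b"
    "a * a\<^sup>\<star> + b * b\<^sup>\<star> = 1" "a * D = D * a" "b * D = (q\<^sup>2 / of_real ((cmod q)\<^sup>2)) *\<^sub>C (D * b)"
    "D * D\<^sup>\<star> = 1" "D\<^sup>\<star> * D = 1" "a\<^sup>\<star> * a + of_real ((cmod q)\<^sup>2) *\<^sub>C (b\<^sup>\<star> * b) = 1"
    and "r \<in> uq2_relators q"
  shows "eval_free (case_uq2_generator a b D) r = 0"
proof -
  have "\<forall>r\<in>uq2_relators q. eval_free (case_uq2_generator a b D) r = 0"
    unfolding uq2_relators_def Let_def ball_simps eval_free_diff eval_free_add eval_free_mult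
      eval_free_star eval_free_scaleC eval_free_one eval_free_gen uq2_generator.case right_minus_eq
    by (intro conjI TrueI assms)
  then show ?thesis
    using assms(10) by blast
qed

text \<open>Negative exponents are powers of the star, as \<open>a\<close> and \<open>b\<close> need
  not be invertible. This way \<open>ipow x n\<close> has weight \<open>n\<close> under
  \<open>x \<mapsto> z *\<^sub>C x\<close> with \<open>z\<close> unimodular.\<close>

definition ipow :: "'a::complex_star_algebra_1 \<Rightarrow> int \<Rightarrow> 'a" where
  "ipow x n = (if 0 \<le> n then x ^ nat n else (x\<^sup>\<star>) ^ nat (- n))"

lemma ipow_of_nat [simp]: "ipow x (int n) = x ^ n"
  by (simp add: ipow_def)

lemma ipow_minus_of_nat [simp]: "ipow x (- int n) = (x\<^sup>\<star>) ^ n"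
  by (simp add: ipow_def)

lemma ipow_scaleC:
  assumes "cmod z = 1"
  shows "ipow (z *\<^sub>C x) n = z powi n *\<^sub>C ipow x n"
  by (cases n rule: int_cases2)
    (simp_all add: scaleC_power star_scaleC power_int_minus cnj_power_int_unit(1)[OF assms] power_inverse)

lemma star_hom_ipow:
  assumes "star_hom f"
  shows "f (ipow x n) = ipow (f x) n"
proof -
  have "f (y ^ k) = f y ^ k" for y k
    using assms by (induction k) (simp_all add: star_hom_def)
  then show ?thesis
    using assms by (simp add: ipow_def star_hom_def)
qed

lemma star_hom_peval:
  assumes "star_hom f"
  shows "f (peval x p) = peval (f x) p"
proof (induction p)
  case 0
  have "f 0 = 0"
    using assms unfolding star_hom_def clinear_map_def by (metis scaleC_zero_left)
  then show ?case by simp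
qed (use assms in \<open>simp add: peval_pCons star_hom_def clinear_map_def\<close>)

text \<open>The scalar is left unnamed because normal forms absorb it into their polynomial;
  requiring it to be nonzero makes the relation symmetric.\<close>

definition qcomm :: "'a::complex_star_algebra_1 \<Rightarrow> 'a \<Rightarrow> bool" where
  "qcomm x y \<longleftrightarrow> (\<exists>k. k \<noteq> 0 \<and> x * y = k *\<^sub>C (y * x))"

lemma qcommI: "x * y = k *\<^sub>C (y * x) \<Longrightarrow> k \<noteq> 0 \<Longrightarrow> qcomm x y"
  by (auto simp: qcomm_def)

lemma qcomm_sym:
  assumes "qcomm x y"
  shows "qcomm y x"
proof -
  obtain k where k: "k \<noteq> 0" "x * y = k *\<^sub>C (y * x)"
    using assms by (auto simp: qcomm_def)
  then have "y * x = inverse k *\<^sub>C (x * y)"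
    by (simp add: scaleC_scaleC scaleC_one)
  then show ?thesis
    by (rule qcommI) (use k(1) in simp)
qed

lemma qcomm_star:
  assumes "qcomm x y"
  shows "qcomm (x\<^sup>\<star>) (y\<^sup>\<star>)"
proof -
  obtain k where k: "k \<noteq> 0" "x * y = k *\<^sub>C (y * x)"
    using assms by (auto simp: qcomm_def)
  have "y\<^sup>\<star> * x\<^sup>\<star> = cnj k *\<^sub>C (x\<^sup>\<star> * y\<^sup>\<star>)"
    using arg_cong[OF k(2), of star] by (simp add: star_mult star_scaleC)
  then have "qcomm (y\<^sup>\<star>) (x\<^sup>\<star>)"
    by (rule qcommI) (use k(1) in simp)
  then show ?thesis
    by (rule qcomm_sym)
qed

lemma qcomm_mult_right:
  assumes "qcomm x y" "qcomm x z"
  shows "qcomm x (y * z)"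
proof -
  obtain k l where k: "k \<noteq> 0" "x * y = k *\<^sub>C (y * x)" and l: "l \<noteq> 0" "x * z = l *\<^sub>C (z * x)"
    using assms by (auto simp: qcomm_def)
  have "x * (y * z) = k *\<^sub>C (y * (x * z))"
    by (simp add: k(2) mult_scaleC_left flip: mult.assoc)
  also have "\<dots> = (k * l) *\<^sub>C (y * z * x)"
    by (simp add: l(2) scaleC_mult mult.assoc)
  finally show ?thesis
    by (rule qcommI) (use k(1) l(1) in simp)
qed

lemma qcomm_ipow:
  assumes "qcomm x y" "qcomm x (y\<^sup>\<star>)"
  shows "qcomm x (ipow y n)"
proof -
  have "qcomm x (z ^ m)" if z: "qcomm x z" for z m
  proof (induction m)
    case 0
    show ?case by (rule qcommI[of _ _ 1]) (simp_all add: scaleC_one)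
  qed (simp add: qcomm_mult_right z)
  then show ?thesis
    using assms by (simp add: ipow_def)
qed

section \<open>Rewriting words into normal form\<close>

context uq2_relations
begin

lemma peval_c_ipow_commute:
  assumes "c * y = y * c" "c * y\<^sup>\<star> = y\<^sup>\<star> * c"
  shows "peval c p * ipow y n = ipow y n * peval c p"
proof (rule peval_c_commute)
  have "c * z ^ m = z ^ m * c" if "c * z = z * c" for z m
    using power_commuting_commutes[of z c m] that by simp
  then show "c * ipow y n = ipow y n * c"
    using assms by (simp add: ipow_def)
qed

lemmas peval_c_b = peval_c_ipow_commute[OF c_b c_b'] and peval_c_D = peval_c_ipow_commute[OF c_D c_D']

lemma c_a'pow: "c * (a\<^sup>\<star>) ^ m = inverse (of_real s ^ m) *\<^sub>C ((a\<^sup>\<star>) ^ m * c)"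
  using s_pos by (simp add: a'pow_c scaleC_scaleC scaleC_one)

lemma one_minus_c_peval: "1 - k *\<^sub>C c = peval c [:1, - k:]"
  by (simp add: peval_pCons scaleC_one scaleC_minus_left mult_scaleC_right)

text \<open>For negative \<open>i\<close> a pair \<open>a * a\<^sup>\<star> = 1 - c\<close> is
  created and its \<open>c\<close> pushed to the right, with \<open>c\<close> rescaled by a power of
  \<open>s\<close>.\<close>

lemma a_ipow: "\<exists>r. a * ipow a i = ipow a (i + 1) * peval c r"
proof (cases i rule: int_cases2)
  case (nonneg n)
  then show ?thesis
    by (intro exI[of _ 1]) (simp add: ipow_def nat_add_distrib)
next
  case (nonpos n)
  show ?thesis
  proof (cases n)
    case 0
    then show ?thesis
      using nonpos by (intro exI[of _ 1]) (simp add: ipow_def)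
  next
    case (Suc m)
    have "a * (a\<^sup>\<star>) ^ Suc m = (1 - c) * (a\<^sup>\<star>) ^ m"
      by (simp add: aa'_c flip: mult.assoc)
    also have "\<dots> = (a\<^sup>\<star>) ^ m * (1 - inverse (of_real s ^ m) *\<^sub>C c)"
      by (simp add: left_diff_distrib right_diff_distrib c_a'pow mult_scaleC_right)
    finally have "a * ipow a (- int (Suc m)) = ipow a (- int m) * peval c [:1, - inverse (of_real s ^ m):]"
      by (simp only: ipow_minus_of_nat one_minus_c_peval)
    moreover have "- int (Suc m) + 1 = - int m"
      by simp
    ultimately show ?thesis
      using nonpos Suc by metis
  qed
qed

lemma a'_ipow: "\<exists>r. a\<^sup>\<star> * ipow a i = ipow a (i - 1) * peval c r"
proof (cases i rule: int_cases2)
  case (nonpos n)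
  then have "i - 1 = - int (Suc n)"
    by simp
  then show ?thesis
    by (intro exI[of _ 1]) (simp only: nonpos ipow_minus_of_nat peval_1 mult_1_right power_Suc)
next
  case (nonneg n)
  show ?thesis
  proof (cases n)
    case 0
    then show ?thesis
      using nonneg by (intro exI[of _ 1]) (simp add: ipow_def)
  next
    case (Suc m)
    have "a\<^sup>\<star> * a ^ Suc m = (1 - of_real s *\<^sub>C c) * a ^ m"
      by (simp add: a'a_c flip: mult.assoc)
    also have "\<dots> = a ^ m * (1 - of_real s ^ Suc m *\<^sub>C c)"
      by (simp add: left_diff_distrib right_diff_distrib c_apow scaleC_mult)
    finally have "a\<^sup>\<star> * ipow a (int (Suc m)) = ipow a (int m) * peval c [:1, - (of_real s ^ Suc m):]"
      by (simp only: ipow_of_nat one_minus_c_peval)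
    moreover have "int (Suc m) - 1 = int m"
      by simp
    ultimately show ?thesis
      using nonneg Suc by metis
  qed
qed

text \<open>Serves \<open>b\<close> with polynomial \<open>c\<close> and \<open>D\<close> with
  polynomial 1, for which both products with the star agree. For \<open>a\<close> they differ, hence
  the separate lemmas above.\<close>

lemma ipow_step:
  assumes y: "y * y\<^sup>\<star> = peval c p" "y\<^sup>\<star> * y = peval c p"
  shows "\<exists>r. y * ipow y i = peval c r * ipow y (i + 1)" "\<exists>r. y\<^sup>\<star> * ipow y i = peval c r * ipow y (i - 1)"
proof -
  have up: "\<exists>r. x * ipow x i = peval c r * ipow x (i + 1)" if x: "x * x\<^sup>\<star> = peval c p" for x i
  proof (cases "0 \<le> i")
    case True
    then show ?thesis
      by (intro exI[of _ 1]) (simp add: ipow_def nat_add_distrib)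
  next
    case False
    define m where "m = nat (- i - 1)"
    have i: "i = - int (Suc m)" "i + 1 = - int m"
      using False by (simp_all add: m_def)
    have "ipow x i = (x\<^sup>\<star>) ^ Suc m" "ipow x (i + 1) = (x\<^sup>\<star>) ^ m"
      by (simp_all only: i(2)) (simp_all only: i(1) ipow_minus_of_nat)
    then show ?thesis
      by (intro exI[of _ p]) (simp only: power_Suc mult.assoc[symmetric] x)
  qed
  show "\<exists>r. y * ipow y i = peval c r * ipow y (i + 1)"
    by (rule up[OF y(1)])
  have flip: "ipow (y\<^sup>\<star>) k = ipow y (- k)" for k
    by (cases k rule: int_cases2) (simp_all add: star_star ipow_def)
  show "\<exists>r. y\<^sup>\<star> * ipow y i = peval c r * ipow y (i - 1)"
    using up[of "y\<^sup>\<star>" "- i"] y(2) by (simp add: star_star flip)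
qed

lemmas b_ipow = ipow_step[of b "[:0, 1:]", unfolded peval_X, OF c_def[symmetric] c_alt[symmetric]]

lemmas D_ipow = ipow_step[of D 1, unfolded peval_1, OF DD' D'D]

text \<open>The integers \<open>i\<close>, \<open>j\<close>, \<open>l\<close> are the weights under
  rescaling of the generators; everything of weight zero is collected in the polynomial in
  \<open>c\<close>.\<close>

definition nf :: "int \<Rightarrow> int \<Rightarrow> int \<Rightarrow> complex poly \<Rightarrow> 'a" where
  "nf i j l p = ipow a i * ipow b j * ipow D l * peval c p"

lemma nf_add: "nf i j l p + nf i j l r = nf i j l (p + r)"
  by (simp add: nf_def peval_add distrib_left)

lemma nf_scaleC: "k *\<^sub>C nf i j l p = nf i j l (smult k p)"
  by (simp add: nf_def peval_smult mult_scaleC_right)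

lemma subspace_nf: "subspace (range (nf i j l))"
proof (rule subspaceI)
  show "0 \<in> range (nf i j l)"
    using rangeI[of "nf i j l" 0] by (simp add: nf_def)
qed (auto simp: nf_add scaleR_scaleC nf_scaleC)

lemma q_nz: "q \<noteq> 0"
  using q_pos by auto

lemma \<omega>_nz: "\<omega> \<noteq> 0"
  using norm_\<omega> by auto

lemma qcomm_b_a: "qcomm b a" "qcomm b (a\<^sup>\<star>)" "qcomm (b\<^sup>\<star>) a" "qcomm (b\<^sup>\<star>) (a\<^sup>\<star>)"
proof -
  show 1: "qcomm b a"
    using ba q_nz by (rule qcommI)
  have "qcomm (a\<^sup>\<star>) b"
    using a'b q_nz by (rule qcommI)
  then show 2: "qcomm b (a\<^sup>\<star>)"
    by (rule qcomm_sym)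
  show "qcomm (b\<^sup>\<star>) a"
    using qcomm_star[OF 2] by (simp add: star_star)
  show "qcomm (b\<^sup>\<star>) (a\<^sup>\<star>)"
    using qcomm_star[OF 1] .
qed

lemma qcomm_D: "qcomm D a" "qcomm D (a\<^sup>\<star>)" "qcomm (D\<^sup>\<star>) a" "qcomm (D\<^sup>\<star>) (a\<^sup>\<star>)"
  "qcomm D b" "qcomm D (b\<^sup>\<star>)" "qcomm (D\<^sup>\<star>) b" "qcomm (D\<^sup>\<star>) (b\<^sup>\<star>)"
proof -
  show 1: "qcomm D a" and 2: "qcomm (D\<^sup>\<star>) a"
    by (rule qcommI[of _ _ 1]; simp add: scaleC_one aD D'a)+
  have "qcomm b D"
    using bD_\<omega> \<omega>_nz by (rule qcommI)
  then show 3: "qcomm D b"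
    by (rule qcomm_sym)
  have "qcomm b (D\<^sup>\<star>)"
    using bD' by (rule qcommI) (use \<omega>_nz in simp)
  then show 4: "qcomm (D\<^sup>\<star>) b"
    by (rule qcomm_sym)
  show "qcomm D (a\<^sup>\<star>)" "qcomm (D\<^sup>\<star>) (a\<^sup>\<star>)" "qcomm D (b\<^sup>\<star>)" "qcomm (D\<^sup>\<star>) (b\<^sup>\<star>)"
    using qcomm_star[OF 1] qcomm_star[OF 2] qcomm_star[OF 3] qcomm_star[OF 4] by (simp_all add: star_star)
qed

lemma a_nf:
  assumes "\<exists>r. x * ipow a i = ipow a i' * peval c r"
  shows "x * nf i j l p \<in> range (nf i' j l)"
proof -
  obtain r where "x * ipow a i = ipow a i' * peval c r"
    using assms by blast
  then have "x * nf i j l p = ipow a i' * (peval c r * ipow b j) * ipow D l * peval c p"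
    by (simp add: nf_def flip: mult.assoc)
  also have "\<dots> = ipow a i' * ipow b j * (peval c r * ipow D l) * peval c p"
    by (simp add: peval_c_b mult.assoc)
  also have "\<dots> = nf i' j l (r * p)"
    by (simp add: peval_c_D nf_def peval_mult mult.assoc)
  finally show ?thesis by simp
qed

lemma b_nf:
  assumes "qcomm x a" "qcomm x (a\<^sup>\<star>)" and "\<exists>r. x * ipow b j = peval c r * ipow b j'"
  shows "x * nf i j l p \<in> range (nf i j' l)"
proof -
  obtain r where r: "x * ipow b j = peval c r * ipow b j'"
    using assms(3) by blast
  obtain k where k: "x * ipow a i = k *\<^sub>C (ipow a i * x)"
    using qcomm_ipow[OF assms(1,2)] by (auto simp: qcomm_def)
  have "x * nf i j l p = k *\<^sub>C (ipow a i * (x * ipow b j) * ipow D l * peval c p)"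
    by (simp add: nf_def k mult_scaleC_left flip: mult.assoc)
  also have "\<dots> = k *\<^sub>C (ipow a i * ipow b j' * (peval c r * ipow D l) * peval c p)"
    by (simp add: r peval_c_b mult.assoc)
  also have "\<dots> = nf i j' l (smult k (r * p))"
    by (simp add: peval_c_D nf_def peval_mult mult.assoc peval_smult mult_scaleC_right)
  finally show ?thesis by simp
qed

lemma D_nf:
  assumes "qcomm x a" "qcomm x (a\<^sup>\<star>)" "qcomm x b" "qcomm x (b\<^sup>\<star>)"
    and "\<exists>r. x * ipow D l = peval c r * ipow D l'"
  shows "x * nf i j l p \<in> range (nf i j l')"
proof -
  obtain r where r: "x * ipow D l = peval c r * ipow D l'"
    using assms(5) by blast
  have "qcomm x (ipow a i * ipow b j)"
    by (intro qcomm_mult_right qcomm_ipow assms)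
  then obtain k where k: "x * (ipow a i * ipow b j) = k *\<^sub>C (ipow a i * ipow b j * x)"
    by (auto simp: qcomm_def)
  have "x * nf i j l p = x * (ipow a i * ipow b j) * (ipow D l * peval c p)"
    by (simp add: nf_def mult.assoc)
  also have "\<dots> = k *\<^sub>C (ipow a i * ipow b j * (x * ipow D l) * peval c p)"
    by (simp add: k mult_scaleC_left mult.assoc)
  also have "\<dots> = nf i j l' (smult k (r * p))"
    by (simp add: r peval_c_D nf_def peval_mult mult.assoc peval_smult mult_scaleC_right)
  finally show ?thesis by simp
qed

definition nf_span :: "'a set" where
  "nf_span = span (\<Union>i j l. range (nf i j l))"

lemma nf_in_span: "x \<in> range (nf i j l) \<Longrightarrow> x \<in> nf_span"
  unfolding nf_span_def by (rule span_base) blast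

lemma letter_mult_nf_span:
  assumes x: "x \<in> {a, a\<^sup>\<star>, b, b\<^sup>\<star>, D, D\<^sup>\<star>}" and y: "y \<in> nf_span"
  shows "x * y \<in> nf_span"
  using y unfolding nf_span_def
proof (induction rule: span_induct)
  case base
  show ?case
    by (rule subspaceI)
      (auto simp: distrib_left span_zero intro: span_add span_scale)
next
  case (step y)
  then obtain i j l p where y: "y = nf i j l p"
    by blast
  consider "x = a" | "x = a\<^sup>\<star>" | "x = b" | "x = b\<^sup>\<star>" | "x = D" | "x = D\<^sup>\<star>"
    using x by blast
  then have "x * y \<in> nf_span"
  proof cases
    case 1
    show ?thesis unfolding y 1 by (rule nf_in_span[OF a_nf[OF a_ipow]])
  next
    case 2
    show ?thesis unfolding y 2 by (rule nf_in_span[OF a_nf[OF a'_ipow]])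
  next
    case 3
    show ?thesis unfolding y 3 by (rule nf_in_span[OF b_nf[OF qcomm_b_a(1,2) b_ipow(1)]])
  next
    case 4
    show ?thesis unfolding y 4 by (rule nf_in_span[OF b_nf[OF qcomm_b_a(3,4) b_ipow(2)]])
  next
    case 5
    show ?thesis unfolding y 5 by (rule nf_in_span[OF D_nf[OF qcomm_D(1,2,5,6) D_ipow(1)]])
  next
    case 6
    show ?thesis unfolding y 6 by (rule nf_in_span[OF D_nf[OF qcomm_D(3,4,7,8) D_ipow(2)]])
  qed
  then show ?case
    by (simp add: nf_span_def)
qed

text \<open>\<open>span\<close> is the real span; complex scalars preserve it because they preserve
  each \<open>range (nf i j l)\<close>.\<close>

lemma nf_span_scaleC:
  assumes "y \<in> nf_span"
  shows "k *\<^sub>C y \<in> nf_span"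
  using assms unfolding nf_span_def
proof (induction rule: span_induct)
  case base
  have "k *\<^sub>C (r *\<^sub>R x) = r *\<^sub>R (k *\<^sub>C x)" for r and x :: 'a
    by (simp add: scaleR_scaleC scaleC_scaleC mult.commute)
  then show ?case
    by (intro subspaceI)
      (auto simp: scaleC_zero_right scaleC_add_right span_zero intro: span_add span_scale)
next
  case (step y)
  then obtain i j l p where "y = nf i j l p"
    by blast
  then show ?case
    using nf_in_span[of "k *\<^sub>C y" i j l] by (simp add: nf_scaleC nf_span_def)
qed

lemma eval_free_in_nf_span: "eval_free (case_uq2_generator a b D) x \<in> nf_span"
proof -
  have "prod_list (map (\<lambda>(g, t). if t then (case_uq2_generator a b D g)\<^sup>\<star> else case_uq2_generator a b D g) w)
      \<in> nf_span" for w
  proof (induction w)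
    case Nil
    have "1 = nf 0 0 0 1"
      by (simp add: nf_def ipow_def)
    then show ?case
      using nf_in_span[OF rangeI] by (metis list.map(1) prod_list.Nil)
  next
    case (Cons gt w)
    obtain g t where gt: "gt = (g, t)"
      by force
    have "(if t then (case_uq2_generator a b D g)\<^sup>\<star> else case_uq2_generator a b D g) \<in> {a, a\<^sup>\<star>, b, b\<^sup>\<star>, D, D\<^sup>\<star>}"
      by (cases g) auto
    from letter_mult_nf_span[OF this Cons] show ?case
      by (simp add: gt)
  qed
  then show ?thesis
    unfolding eval_free_def eval_word_def nf_span_def
    by (intro span_sum nf_span_scaleC[unfolded nf_span_def]) (simp add: nf_span_def)
qed

lemma star_mult_ipow:
  "\<exists>r. (ipow a i)\<^sup>\<star> * ipow a i = peval c r" "\<exists>r. (ipow b i)\<^sup>\<star> * ipow b i = peval c r"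
  "(ipow D i)\<^sup>\<star> * ipow D i = 1"
proof -
  have a'pow: "\<exists>r. a ^ m * (a\<^sup>\<star>) ^ m = peval c r" for m
  proof (induction m)
    case 0
    show ?case by (rule exI[of _ 1]) simp
  next
    case (Suc m)
    then obtain r where r: "a ^ m * (a\<^sup>\<star>) ^ m = peval c r" by blast
    have "a ^ Suc m * (a\<^sup>\<star>) ^ Suc m = a ^ m * ((a * a\<^sup>\<star>) * (a\<^sup>\<star>) ^ m)"
      by (simp only: power_Suc2[of a] power_Suc[of "a\<^sup>\<star>"] mult.assoc)
    also have "\<dots> = peval c r * (1 - inverse (of_real s ^ m) *\<^sub>C c)"
      by (simp add: aa'_c left_diff_distrib right_diff_distrib c_a'pow mult_scaleC_right flip: r mult.assoc)
    finally show ?case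
      by (metis one_minus_c_peval peval_mult)
  qed
  show "\<exists>r. (ipow a i)\<^sup>\<star> * ipow a i = peval c r"
    using a'pow a'pow_apow by (cases i rule: int_cases2) (auto simp: star_power star_star)
  have cpow: "c ^ m = peval c ([:0, 1:] ^ m)" for m
    by (simp add: peval_power peval_X)
  have b'pow: "(b\<^sup>\<star>) ^ m * b ^ m = c ^ m" for m
  proof -
    have "b\<^sup>\<star> * b ^ m = b ^ m * b\<^sup>\<star>" for m
      using power_commuting_commutes[of b "b\<^sup>\<star>" m] b_normal by simp
    then have "b ^ m * (b\<^sup>\<star>) ^ m = (b\<^sup>\<star>) ^ m * b ^ m"
      using power_commuting_commutes[of "b\<^sup>\<star>" "b ^ m" m] by simp
    then show ?thesis
      by (simp add: bpow_b'pow)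
  qed
  show "\<exists>r. (ipow b i)\<^sup>\<star> * ipow b i = peval c r"
    using cpow by (cases i rule: int_cases2) (auto simp: star_power star_star b'pow bpow_b'pow)
  have cancel: "y ^ m * (y\<^sup>\<star>) ^ m = 1" if y: "y * y\<^sup>\<star> = 1" for y :: 'a and m
  proof (induction m)
    case (Suc m)
    have "y ^ Suc m * (y\<^sup>\<star>) ^ Suc m = y ^ m * ((y * y\<^sup>\<star>) * (y\<^sup>\<star>) ^ m)"
      by (simp only: power_Suc2[of y] power_Suc[of "y\<^sup>\<star>"] mult.assoc)
    then show ?case
      by (simp add: y Suc)
  qed simp
  show "(ipow D i)\<^sup>\<star> * ipow D i = 1"
    using cancel[OF DD'] cancel[of "D\<^sup>\<star>"] D'D
    by (cases i rule: int_cases2) (simp_all add: star_power star_star)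
qed

text \<open>The product collapses from the middle outwards: the pairs for \<open>a\<close> and
  \<open>b\<close> become polynomials in \<open>c\<close>, which pass through the powers of
  \<open>b\<close> and \<open>D\<close>, and the unitary \<open>D\<close> cancels. Hence only
  \<open>c\<close> survives.\<close>

lemma star_mult_nf: "\<exists>r. (nf i j l p)\<^sup>\<star> * nf i j l p = peval c r"
proof -
  obtain r where r: "(ipow a i)\<^sup>\<star> * ipow a i = peval c r"
    using star_mult_ipow(1) by blast
  obtain t where t: "(ipow b j)\<^sup>\<star> * ipow b j = peval c t"
    using star_mult_ipow(2) by blast
  let ?A = "ipow a i" and ?B = "ipow b j" and ?D = "ipow D l" and ?P = "peval c p"
  have "(nf i j l p)\<^sup>\<star> * nf i j l p = ?P\<^sup>\<star> * ?D\<^sup>\<star> * ?B\<^sup>\<star> * (?A\<^sup>\<star> * ?A) * ?B * ?D * ?P"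
    by (simp add: nf_def star_mult mult.assoc)
  also have "\<dots> = ?P\<^sup>\<star> * ?D\<^sup>\<star> * (?B\<^sup>\<star> * ?B) * (peval c r * ?D) * ?P"
    by (simp add: r peval_c_b mult.assoc)
  also have "\<dots> = ?P\<^sup>\<star> * ?D\<^sup>\<star> * (peval c t * ?D) * peval c r * ?P"
    by (simp add: t peval_c_D[of r l] mult.assoc)
  also have "\<dots> = ?P\<^sup>\<star> * (?D\<^sup>\<star> * ?D) * peval c t * peval c r * ?P"
    by (subst peval_c_D[of t l]) (simp add: mult.assoc)
  also have "\<dots> = peval c (map_poly cnj p * t * r * p)"
    by (simp add: star_mult_ipow(3) star_peval[OF c_star] peval_mult)
  finally show ?thesis by blast
qed

lemma star_hom_nf:
  assumes f: "star_hom f" and z: "cmod z1 = 1" "cmod z2 = 1" "cmod z3 = 1"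
    and gens: "f a = z1 *\<^sub>C a" "f b = z2 *\<^sub>C b" "f D = z3 *\<^sub>C D"
  shows "f (nf i j l p) = (z1 powi i * z2 powi j * z3 powi l) *\<^sub>C nf i j l p"
proof -
  have mult: "f (x * y) = f x * f y" and star: "f (x\<^sup>\<star>) = (f x)\<^sup>\<star>" for x y
    using f by (simp_all add: star_hom_def)
  have "z2 * cnj z2 = 1"
    using complex_norm_square[of z2] z by simp
  then have "cnj z2 * z2 = 1"
    by (simp add: mult.commute)
  then have "f c = c"
    by (simp add: c_def mult star gens star_scaleC scaleC_mult scaleC_one)
  then show ?thesis
    by (simp add: nf_def mult star_hom_ipow[OF f] star_hom_peval[OF f] gens ipow_scaleC z scaleC_mult mult_ac)
qed

end

section \<open>Gauge invariance and faithfulness\<close>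

context uq2_relations
begin

lemma peval_c_mult_annihilated:
  assumes "c * z = 0"
  shows "peval c p * z = poly p 0 *\<^sub>C z"
proof -
  have "peval c p * (c * z) = c * (peval c p * z)" for p
    by (simp add: peval_c_commute flip: mult.assoc)
  then show ?thesis
    using assms by (cases p) (simp add: peval_pCons distrib_right mult_scaleC_left mult.assoc flip: mult.assoc)
qed

text \<open>Vanishing at all \<open>s ^ m\<close> gives \<open>c * f = 0\<close>, so
  \<open>peval c (r k)\<close> acts on \<open>f\<close> as the scalar \<open>poly (r k) 0\<close>.
  These scalars tend to 0, and \<open>f * f\<close> is the limit of their multiples of
  \<open>f\<close>.\<close>

lemma limit_peval_c_eq_0:
  assumes nz: "e \<noteq> 0" and lim: "(\<lambda>k. peval c (r k)) \<longlonglongrightarrow> f"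
    and zero: "\<And>m. (\<lambda>k. poly (r k) (of_real (s ^ m))) \<longlonglongrightarrow> 0" and self: "f\<^sup>\<star> = f"
  shows "f = 0"
proof -
  have annih: "e * (a\<^sup>\<star>) ^ m * f = 0" for m
  proof (rule LIMSEQ_unique)
    show "(\<lambda>k. e * (a\<^sup>\<star>) ^ m * peval c (r k)) \<longlonglongrightarrow> e * (a\<^sup>\<star>) ^ m * f"
      by (intro tendsto_intros lim)
    have "(\<lambda>k. poly (r k) (of_real (s ^ m)) *\<^sub>C (e * (a\<^sup>\<star>) ^ m)) \<longlonglongrightarrow> 0 *\<^sub>C (e * (a\<^sup>\<star>) ^ m)"
      by (intro tendsto_intros zero)
    then show "(\<lambda>k. e * (a\<^sup>\<star>) ^ m * peval c (r k)) \<longlonglongrightarrow> 0"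
      by (simp only: e_a'pow_peval scaleC_zero_left)
  qed
  then have "c * f = 0"
    by (rule c_mult_eq_0)
  \<comment> \<open>\<open>e * (a\<^sup>\<star>) ^ m\<close> annihilates \<open>f\<close> and
    evaluates \<open>peval c (r k)\<close>; since it is nonzero, its norm cancels and the bound is
    independent of \<open>m\<close>.\<close>
  have at: "cmod (poly (r k) (of_real (s ^ m))) \<le> norm (peval c (r k) - f)" for k m
  proof -
    let ?E = "e * (a\<^sup>\<star>) ^ m"
    have eq: "?E * (peval c (r k) - f) = poly (r k) (of_real (s ^ m)) *\<^sub>C ?E"
      by (simp only: right_diff_distrib e_a'pow_peval annih diff_zero)
    have "cmod (poly (r k) (of_real (s ^ m))) * norm ?E = norm (?E * (peval c (r k) - f))"
      by (simp only: eq norm_scaleC)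
    also have "\<dots> \<le> norm (peval c (r k) - f) * norm ?E"
      using norm_mult_ineq[of ?E "peval c (r k) - f"] by (simp only: mult.commute)
    finally have "cmod (poly (r k) (of_real (s ^ m))) * norm ?E \<le> norm (peval c (r k) - f) * norm ?E" .
    then show ?thesis
      using e_a'pow_nonzero[OF nz, of m] by simp
  qed
  \<comment> \<open>Here the accumulation of the points \<open>s ^ m\<close> at 0 enters: the
    uniform bound passes to the limit in \<open>m\<close>.\<close>
  have at0: "cmod (poly (r k) 0) \<le> norm (peval c (r k) - f)" for k
  proof (rule LIMSEQ_le_const2)
    have "(\<lambda>m. complex_of_real (s ^ m)) \<longlonglongrightarrow> of_real 0"
      using s_pos s_less_1 by (intro tendsto_of_real LIMSEQ_power_zero) simp
    then show "(\<lambda>m. cmod (poly (r k) (of_real (s ^ m)))) \<longlonglongrightarrow> cmod (poly (r k) 0)"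
      by (intro tendsto_norm tendsto_poly) simp
  qed (use at in blast)
  have "(\<lambda>k. norm (peval c (r k) - f)) \<longlonglongrightarrow> 0"
    using lim by (simp add: LIM_zero tendsto_norm_zero)
  then have "(\<lambda>k. poly (r k) 0) \<longlonglongrightarrow> 0"
    by (rule Lim_null_comparison[rotated]) (simp add: at0)
  then have "(\<lambda>k. poly (r k) 0 *\<^sub>C f) \<longlonglongrightarrow> 0 *\<^sub>C f"
    by (intro tendsto_intros)
  moreover have "(\<lambda>k. poly (r k) 0 *\<^sub>C f) \<longlonglongrightarrow> f * f"
    using tendsto_mult_right[OF lim, of f] by (simp add: peval_c_mult_annihilated[OF \<open>c * f = 0\<close>])
  ultimately have "f * f = 0"
    by (simp add: scaleC_zero_left LIMSEQ_unique)
  then show ?thesis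
    using star_mult_self_eq_0[of f] by (simp add: self)
qed

end

section \<open>The gauge action and its relation to the comultiplication\<close>

context uq2_haar
begin

abbreviation gens :: "uq2_generator \<Rightarrow> 'a" where
  "gens \<equiv> case_uq2_generator a b D"

lemma universal: "universal_cstar_algebra (uq2_relators q) gens"
  using C_Uq2 by (simp add: C_Uq2_def)

lemma closure_eval_free: "closure (range (eval_free gens)) = UNIV"
  using universal by (simp add: universal_cstar_algebra_def)

lemma closure_nf_span: "closure nf_span = UNIV"
proof -
  have "range (eval_free gens) \<subseteq> nf_span"
    using eval_free_in_nf_span by blast
  then show ?thesis
    using closure_mono[of "range (eval_free gens)" nf_span] closure_eval_free by auto
qed

text \<open>Meaningful for unimodular scalars, where the universal property provides such a map; the
  choice keeps it total.\<close>

definition gauge :: "complex \<Rightarrow> complex \<Rightarrow> complex \<Rightarrow> 'a \<Rightarrow> 'a" where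
  "gauge z1 z2 z3 = (SOME f. star_hom f \<and> continuous_on UNIV f \<and>
     (\<forall>g. f (gens g) = case_uq2_generator (z1 *\<^sub>C a) (z2 *\<^sub>C b) (z3 *\<^sub>C D) g))"

context
  fixes z1 z2 z3 :: complex
  assumes z: "cmod z1 = 1" "cmod z2 = 1" "cmod z3 = 1"
begin

lemma gauge_relators:
  assumes "r \<in> uq2_relators q"
  shows "eval_free (case_uq2_generator (z1 *\<^sub>C a) (z2 *\<^sub>C b) (z3 *\<^sub>C D)) r = 0"
proof -
  have unit: "z1 * cnj z1 = 1" "z2 * cnj z2 = 1" "z3 * cnj z3 = 1" "cnj z1 * z1 = 1" "cnj z2 * z2 = 1" "cnj z3 * z3 = 1"
    using complex_norm_square[of z1] complex_norm_square[of z2] complex_norm_square[of z3] z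
    by (simp_all add: mult.commute)
  show ?thesis
  proof (rule eval_free_uq2_relators[OF _ _ _ _ _ _ _ _ _ assms])
    show "z1 *\<^sub>C a * (z1 *\<^sub>C a)\<^sup>\<star> + z2 *\<^sub>C b * (z2 *\<^sub>C b)\<^sup>\<star> = 1"
      by (simp add: star_scaleC scaleC_mult unit scaleC_one aa')
    show "(z1 *\<^sub>C a)\<^sup>\<star> * z1 *\<^sub>C a + of_real ((cmod q)\<^sup>2) *\<^sub>C ((z2 *\<^sub>C b)\<^sup>\<star> * z2 *\<^sub>C b) = 1"
      using a'a by (simp add: star_scaleC scaleC_mult unit scaleC_one mult.assoc)
    show "z2 *\<^sub>C b * (z2 *\<^sub>C b)\<^sup>\<star> = (z2 *\<^sub>C b)\<^sup>\<star> * z2 *\<^sub>C b"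
      by (simp add: star_scaleC scaleC_mult unit b_normal)
    show "z3 *\<^sub>C D * (z3 *\<^sub>C D)\<^sup>\<star> = 1" "(z3 *\<^sub>C D)\<^sup>\<star> * z3 *\<^sub>C D = 1"
      by (simp_all add: star_scaleC scaleC_mult unit scaleC_one DD' D'D)
    show "z2 *\<^sub>C b * z1 *\<^sub>C a = q *\<^sub>C (z1 *\<^sub>C a * z2 *\<^sub>C b)"
      by (simp add: scaleC_mult ba mult_ac)
    show "(z1 *\<^sub>C a)\<^sup>\<star> * z2 *\<^sub>C b = q *\<^sub>C (z2 *\<^sub>C b * (z1 *\<^sub>C a)\<^sup>\<star>)"
      by (simp add: star_scaleC scaleC_mult a'b mult_ac)
    show "z1 *\<^sub>C a * z3 *\<^sub>C D = z3 *\<^sub>C D * z1 *\<^sub>C a"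
      by (simp add: scaleC_mult aD mult_ac)
    show "z2 *\<^sub>C b * z3 *\<^sub>C D = (q\<^sup>2 / of_real ((cmod q)\<^sup>2)) *\<^sub>C (z3 *\<^sub>C D * z2 *\<^sub>C b)"
      by (simp add: scaleC_mult bD mult_ac)
  qed
qed

lemma gauge: "star_hom (gauge z1 z2 z3) \<and> continuous_on UNIV (gauge z1 z2 z3) \<and>
   (\<forall>g. gauge z1 z2 z3 (gens g) = case_uq2_generator (z1 *\<^sub>C a) (z2 *\<^sub>C b) (z3 *\<^sub>C D) g)"
proof -
  have "\<exists>f. star_hom f \<and> continuous_on UNIV f \<and>
      (\<forall>g. f (gens g) = case_uq2_generator (z1 *\<^sub>C a) (z2 *\<^sub>C b) (z3 *\<^sub>C D) g)"
    using universal_property[OF universal gauge_relators] by blast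
  then show ?thesis
    unfolding gauge_def by (rule someI_ex)
qed

lemma star_hom_gauge: "star_hom (gauge z1 z2 z3)"
  and continuous_gauge: "continuous_on UNIV (gauge z1 z2 z3)"
  and gauge_a: "gauge z1 z2 z3 a = z1 *\<^sub>C a"
  and gauge_b: "gauge z1 z2 z3 b = z2 *\<^sub>C b"
  and gauge_D: "gauge z1 z2 z3 D = z3 *\<^sub>C D"
  using gauge spec[OF conjunct2[OF conjunct2[OF gauge]], of Gen_a]
    spec[OF conjunct2[OF conjunct2[OF gauge]], of Gen_b]
    spec[OF conjunct2[OF conjunct2[OF gauge]], of Gen_D] by simp_all

text \<open>The rescaled generators satisfy the relators, so the seminorm they induce on the free
  algebra lies below the universal norm.\<close>

lemma norm_gauge_le: "norm (gauge z1 z2 z3 x) \<le> norm x"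
proof -
  let ?v = "case_uq2_generator (z1 *\<^sub>C a) (z2 *\<^sub>C b) (z3 *\<^sub>C D)"
  have "gauge z1 z2 z3 (eval_free gens y) = eval_free ?v y" for y
    using gauge star_hom_eval_free_comp[OF star_hom_gauge, of gens y] by simp
  moreover have "norm (eval_free ?v y) \<le> norm (eval_free gens y)" for y
  proof -
    have "\<forall>p. cstar_seminorm_on UNIV p \<and> (\<forall>r\<in>uq2_relators q. p r = 0) \<longrightarrow> (\<forall>x. p x \<le> norm (eval_free gens x))"
      using universal unfolding universal_cstar_algebra_def by (elim conjE)
    from spec[OF this, of "\<lambda>x. norm (eval_free ?v x)"] show ?thesis
      using cstar_seminorm_eval_free[of ?v] by (simp add: gauge_relators)
  qed
  ultimately have "range (eval_free gens) \<subseteq> {x. norm (gauge z1 z2 z3 x) \<le> norm x}"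
    by auto
  moreover have "closed {x. norm (gauge z1 z2 z3 x) \<le> norm x}"
    by (intro closed_Collect_le continuous_intros continuous_gauge)
  ultimately show ?thesis
    using closure_minimal closure_eval_free by blast
qed

lemma gauge_nf: "gauge z1 z2 z3 (nf i j l p) = (z1 powi i * z2 powi j * z3 powi l) *\<^sub>C nf i j l p"
  by (rule star_hom_nf[OF star_hom_gauge z gauge_a gauge_b gauge_D])

end

text \<open>Points of the diagonal torus. Comparing the relations for
  \<open>a * a\<^sup>\<star>\<close> and \<open>a\<^sup>\<star> * a\<close> shows that a character
  must send \<open>b\<close> to 0.\<close>

lemma character:
  assumes "cmod \<mu> = 1" "cmod \<nu> = 1"
  obtains \<psi> :: "'a \<Rightarrow> complex" where "star_hom \<psi>" "\<psi> a = \<mu>" "\<psi> b = 0" "\<psi> D = \<nu>"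
proof -
  have unit: "\<mu> * cnj \<mu> = 1" "\<nu> * cnj \<nu> = 1"
    using complex_norm_square[of \<mu>] complex_norm_square[of \<nu>] assms by simp_all
  have "eval_free (case_uq2_generator \<mu> 0 \<nu>) r = 0" if "r \<in> uq2_relators q" for r
    by (rule eval_free_uq2_relators[OF _ _ _ _ _ _ _ _ _ that])
      (use unit in \<open>simp_all add: star_complex_def scaleC_complex_def mult.commute\<close>)
  from universal_property[OF universal this]
  obtain \<psi> where "star_hom \<psi>" "\<And>g. \<psi> (gens g) = case_uq2_generator \<mu> 0 \<nu> g"
    by blast
  from this(1) this(2)[of Gen_a] this(2)[of Gen_b] this(2)[of Gen_D] show ?thesis
    by (intro that[of \<psi>]) simp_all
qed

text \<open>The two maps are the slices of \<open>\<Delta>\<close> by the character on the left and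
  on the right, as seen on generators. Applying the character to \<open>h x *\<^sub>C 1\<close>,
  written as a slice of \<open>\<Delta> x\<close> by \<open>h\<close>, and exchanging the order of
  slices gives invariance.\<close>

lemma h_gauge_slices:
  assumes \<mu>: "cmod \<mu> = 1" and \<nu>: "cmod \<nu> = 1"
  shows "h (gauge \<mu> \<mu> \<nu> x) = h x" "h (gauge \<mu> (cnj \<mu> * \<nu>) \<nu> x) = h x"
proof -
  obtain \<psi> :: "'a \<Rightarrow> complex" where \<psi>: "star_hom \<psi>" and vals: "\<psi> a = \<mu>" "\<psi> b = 0" "\<psi> D = \<nu>"
    using character[OF \<mu> \<nu>] by blast
  note char = char_add[OF \<psi>] char_scale[OF \<psi>] char_mult[OF \<psi>] char_star[OF \<psi>] char_one[OF \<psi>]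
  have \<psi>_diff: "\<psi> (x - y) = \<psi> x - \<psi> y" for x y
    using char_add[OF \<psi>, of "x - y" y] by simp
  have unit: "cmod (cnj \<mu> * \<nu>) = 1"
    using \<mu> \<nu> by (simp add: norm_mult)
  let ?L = "gauge \<mu> \<mu> \<nu>" and ?R = "gauge \<mu> (cnj \<mu> * \<nu>) \<nu>"
  have L: "star_hom ?L" and R: "star_hom ?R"
    using \<mu> \<nu> unit by (simp_all add: star_hom_gauge)
  have gen_slices: "char_slices \<psi> (\<Delta> (gens g)) (?L (gens g)) (?R (gens g))" for g
  proof (cases g)
    case Gen_a
    have "char_slices \<psi> (ten a a + (- cnj q) *\<^sub>C ten b (D * b\<^sup>\<star>))
        (\<psi> a *\<^sub>C a + (- cnj q) *\<^sub>C (\<psi> b *\<^sub>C (D * b\<^sup>\<star>))) (\<psi> a *\<^sub>C a + (- cnj q) *\<^sub>C (\<psi> (D * b\<^sup>\<star>) *\<^sub>C b))"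
      by (intro char_slices.intros char_slices_scale \<psi>)
    then show ?thesis
      using \<mu> \<nu> unit
      by (simp add: Gen_a \<Delta>_a gauge_a char vals scaleC_zero_left scaleC_zero_right scaleC_minus_left)
  next
    case Gen_b
    have "char_slices \<psi> (ten a b + ten b (D * a\<^sup>\<star>))
        (\<psi> a *\<^sub>C b + \<psi> b *\<^sub>C (D * a\<^sup>\<star>)) (\<psi> b *\<^sub>C a + \<psi> (D * a\<^sup>\<star>) *\<^sub>C b)"
      by (intro char_slices.intros)
    then show ?thesis
      using \<mu> \<nu> unit by (simp add: Gen_b \<Delta>_b gauge_b char vals scaleC_zero_left mult.commute)
  next
    case Gen_D
    have "char_slices \<psi> (ten D D) (\<psi> D *\<^sub>C D) (\<psi> D *\<^sub>C D)"
      by (rule char_slices.intros)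
    then show ?thesis
      using \<mu> \<nu> unit by (simp add: Gen_D \<Delta>_D gauge_D vals)
  qed
  have slices: "char_slices \<psi> (\<Delta> (eval_free gens y)) (?L (eval_free gens y)) (?R (eval_free gens y))" for y
  proof (rule eval_free_induct[where P = "\<lambda>x. char_slices \<psi> (\<Delta> x) (?L x) (?R x)"])
    show "char_slices \<psi> (\<Delta> 1) (?L 1) (?R 1)"
      using L R char_slices_one[OF \<psi>] by (simp add: \<Delta>_one star_hom_def)
  qed (use L R gen_slices in \<open>simp_all add: \<Delta>_mult \<Delta>_add \<Delta>_star \<Delta>_scale star_hom_def clinear_map_def
      char_slices_mult[OF \<psi>] char_slices.add char_slices_star[OF \<psi>] char_slices_scale[OF \<psi>]\<close>)
  obtain SR where SR: "right_slice ten h SR" "\<And>x. SR (\<Delta> x) = h x *\<^sub>C 1"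
    using haar by (auto simp: haar_state_def)
  obtain SL where SL: "left_slice ten h SL" "\<And>x. SL (\<Delta> x) = h x *\<^sub>C 1"
    using haar by (auto simp: haar_state_def)
  have ext: "h (f x) = h x" if f: "continuous_on UNIV f" and eq: "\<And>y. h (f (eval_free gens y)) = h (eval_free gens y)" for f
  proof -
    have "continuous_on UNIV (\<lambda>x. h (f x))"
      using continuous_on_compose2[OF linear_continuous_on[OF bounded_linear_h, of UNIV] f] by simp
    then have "closed {x. h (f x) = h x}"
      by (rule closed_Collect_eq[OF _ linear_continuous_on[OF bounded_linear_h]])
    moreover have "range (eval_free gens) \<subseteq> {x. h (f x) = h x}"
      using eq by auto
    ultimately show ?thesis
      using closure_minimal closure_eval_free by blast
  qed
  show "h (?L x) = h x"
  proof (rule ext)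
    show "h (?L (eval_free gens y)) = h (eval_free gens y)" for y
      using char_slices_right[OF \<psi> SR(1) slices clinear_h, of y] by (simp add: SR(2) char)
  qed (simp add: continuous_gauge \<mu> \<nu>)
  show "h (?R x) = h x"
  proof (rule ext)
    show "h (?R (eval_free gens y)) = h (eval_free gens y)" for y
      using char_slices_left[OF \<psi> SL(1) slices clinear_h, of y] by (simp add: SL(2) char)
  qed (simp add: continuous_gauge \<mu> \<nu> unit)
qed

lemma circle_action_gauge: "circle_action (\<lambda>z. gauge (z powi n1) (z powi n2) (z powi n3))"
  (is "circle_action ?\<gamma>")
proof
  fix z :: complex and x y k assume "cmod z = 1"
  then have z: "cmod (z powi n1) = 1" "cmod (z powi n2) = 1" "cmod (z powi n3) = 1"
    by (simp_all add: norm_power_int)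
  show "?\<gamma> z (x + y) = ?\<gamma> z x + ?\<gamma> z y" "?\<gamma> z (k *\<^sub>C x) = k *\<^sub>C ?\<gamma> z x"
    using star_hom_gauge[OF z] by (simp_all add: star_hom_def clinear_map_def)
  show "norm (?\<gamma> z x) \<le> norm x"
    by (rule norm_gauge_le[OF z])
next
  have "range (nf i j l) \<subseteq> (\<Union>n. {y. \<forall>z. cmod z = 1 \<longrightarrow> ?\<gamma> z y = z powi n *\<^sub>C y})" for i j l
  proof
    fix y assume "y \<in> range (nf i j l)"
    then have "?\<gamma> z y = z powi (n1 * i + n2 * j + n3 * l) *\<^sub>C y" if "cmod z = 1" for z
    proof -
      have "z \<noteq> 0"
        using that by auto
      then show ?thesis
        using that \<open>y \<in> range (nf i j l)\<close>
        by (auto simp: gauge_nf norm_power_int power_int_add power_int_mult)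
    qed
    then show "y \<in> (\<Union>n. {y. \<forall>z. cmod z = 1 \<longrightarrow> ?\<gamma> z y = z powi n *\<^sub>C y})"
      by blast
  qed
  then have "nf_span \<subseteq> span (\<Union>n. {y. \<forall>z. cmod z = 1 \<longrightarrow> ?\<gamma> z y = z powi n *\<^sub>C y})"
    unfolding nf_span_def by (intro span_mono) blast
  from closure_mono[OF this] show "closure (span (\<Union>n. {y. \<forall>z. cmod z = 1 \<longrightarrow> ?\<gamma> z y = z powi n *\<^sub>C y})) = UNIV"
    by (simp add: closure_nf_span top.extremum_unique)
qed

section \<open>The null space of the Haar state\<close>

definition null_space :: "'a set" where
  "null_space = {x. h (x\<^sup>\<star> * x) = 0}"

text \<open>The degenerate Cauchy-Schwarz inequality turns a quadratic condition into linear ones,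
  from which subspace, left ideal and closedness are immediate.\<close>

lemma null_space_alt: "null_space = {x. \<forall>y. h (y * x) = 0}"
  using state_cauchy_schwarz_zero[OF state_h] by (auto simp: null_space_def)

lemma null_space_mult: "x \<in> null_space \<Longrightarrow> y * x \<in> null_space"
  by (auto simp: null_space_alt simp flip: mult.assoc)

lemma null_space_scaleC: "x \<in> null_space \<Longrightarrow> k *\<^sub>C x \<in> null_space"
  by (simp add: null_space_alt mult_scaleC_right h_scale)

lemma subspace_null_space: "subspace null_space"
proof (rule subspaceI)
  show "0 \<in> null_space"
    using h_scale[of 0 0] by (simp add: null_space_def scaleC_zero_left)
qed (auto simp: null_space_alt distrib_left h_add scaleR_scaleC mult_scaleC_right h_scale)

lemma closed_null_space: "closed null_space"
proof -
  have "bounded_linear (\<lambda>x. h (y * x))" for y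
    by (rule bounded_linear_compose[OF bounded_linear_h bounded_linear_mult_right])
  then have "closed {x. h (y * x) = 0}" for y
    by (intro closed_Collect_eq linear_continuous_on continuous_on_const)
  then have "closed (\<Inter>y. {x. h (y * x) = 0})"
    by (intro closed_INT) simp
  moreover have "null_space = (\<Inter>y. {x. h (y * x) = 0})"
    by (auto simp: null_space_alt)
  ultimately show ?thesis by simp
qed

lemma null_space_invariant:
  assumes "star_hom f" "\<And>x. h (f x) = h x" "x \<in> null_space"
  shows "f x \<in> null_space"
proof -
  have "(f x)\<^sup>\<star> * f x = f (x\<^sup>\<star> * x)"
    using assms(1) by (simp add: star_hom_def)
  then show ?thesis
    using assms(2,3) by (simp add: null_space_def)
qed

text \<open>Three circles whose degrees on \<open>nf i j l p\<close> are \<open>l\<close>,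
  \<open>i - j\<close> and \<open>j + l\<close>. Each is directly one of the slices in
  \<open>h_gauge_slices\<close>, and the degrees together determine \<open>i\<close>,
  \<open>j\<close>, \<open>l\<close>.\<close>

lemma null_space_gauge:
  assumes z: "cmod z = 1" and y: "y \<in> null_space"
  shows "gauge 1 1 z y \<in> null_space" "gauge z (cnj z) 1 y \<in> null_space" "gauge 1 z z y \<in> null_space"
proof -
  have h: "h (gauge 1 1 z x) = h x" "h (gauge z (cnj z) 1 x) = h x" "h (gauge 1 z z x) = h x" for x
    using h_gauge_slices(1)[of 1 z] h_gauge_slices(2)[of z 1] h_gauge_slices(2)[of 1 z] z by simp_all
  show "gauge 1 1 z y \<in> null_space" "gauge z (cnj z) 1 y \<in> null_space" "gauge 1 z z y \<in> null_space"
    using z by (auto intro!: null_space_invariant[OF _ h(1) y] null_space_invariant[OF _ h(2) y]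
        null_space_invariant[OF _ h(3) y] star_hom_gauge)
qed

theorem haar_faithful:
  assumes "h (x\<^sup>\<star> * x) = 0"
  shows "x = 0"
proof (rule ccontr)
  assume "x \<noteq> 0"
  interpret A1: circle_action "\<lambda>z. gauge (z powi 0) (z powi 0) (z powi 1)"
    by (rule circle_action_gauge)
  interpret A2: circle_action "\<lambda>z. gauge (z powi 1) (z powi (- 1)) (z powi 0)"
    by (rule circle_action_gauge)
  interpret A3: circle_action "\<lambda>z. gauge (z powi 0) (z powi 1) (z powi 1)"
    by (rule circle_action_gauge)
  have unit: "cmod (z powi n) = 1" if "cmod z = 1" for z n
    using that by (simp add: norm_power_int)
  have inv: "gauge (z powi 0) (z powi 0) (z powi 1) y \<in> null_space"
    "gauge (z powi 1) (z powi (- 1)) (z powi 0) y \<in> null_space"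
    "gauge (z powi 0) (z powi 1) (z powi 1) y \<in> null_space"
    if z: "cmod z = 1" and y: "y \<in> null_space" for z y
  proof -
    have "z powi (- 1) = cnj z"
      using cnj_power_int_unit(1)[OF z] by (simp add: power_int_minus)
    then show "gauge (z powi 0) (z powi 0) (z powi 1) y \<in> null_space"
      "gauge (z powi 1) (z powi (- 1)) (z powi 0) y \<in> null_space"
      "gauge (z powi 0) (z powi 1) (z powi 1) y \<in> null_space"
      using null_space_gauge[OF z y] by simp_all
  qed
  note closed = closed_null_space subspace_null_space null_space_scaleC
  have x: "x \<in> null_space"
    using assms by (simp add: null_space_def)
  obtain n1 where n1: "A1.component n1 x \<noteq> 0"
    using A1.eq_0_if_components_0 \<open>x \<noteq> 0\<close> by blast
  obtain n2 where n2: "A2.component n2 (A1.component n1 x) \<noteq> 0"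
    using A2.eq_0_if_components_0 n1 by blast
  obtain n3 where n3: "A3.component n3 (A2.component n2 (A1.component n1 x)) \<noteq> 0"
    using A3.eq_0_if_components_0 n2 by blast
  define P where "P y = A3.component n3 (A2.component n2 (A1.component n1 y))" for y
  have null: "P x \<in> null_space"
    unfolding P_def
    by (intro A1.component_closed_invariant A2.component_closed_invariant A3.component_closed_invariant
        closed inv x)
  have bl: "bounded_linear P"
    unfolding P_def
    by (intro bounded_linear_compose[OF A3.bounded_linear_component]
        bounded_linear_compose[OF A2.bounded_linear_component] A1.bounded_linear_component)
  \<comment> \<open>The solution of \<open>l = n1\<close>, \<open>i - j = n2\<close>,
    \<open>j + l = n3\<close>.\<close>
  define j0 where "j0 = n3 - n1"
  define i0 where "i0 = n2 + j0"
  let ?M = "range (nf i0 j0 n1)"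
  have gauge_powi: "gauge (z powi m1) (z powi m2) (z powi m3) (nf i j l p)
      = z powi (m1 * i + m2 * j + m3 * l) *\<^sub>C nf i j l p" if "cmod z = 1" for z m1 m2 m3 i j l p
  proof -
    have "z \<noteq> 0"
      using that by auto
    then show ?thesis
      by (simp add: gauge_nf unit that power_int_add power_int_mult)
  qed
  have comp: "A1.component n (nf i j l p) = (if l = n then nf i j l p else 0)"
    "A2.component n (nf i j l p) = (if i - j = n then nf i j l p else 0)"
    "A3.component n (nf i j l p) = (if j + l = n then nf i j l p else 0)" for n i j l p
  proof -
    have "nf i j l p \<in> A1.homog l"
      unfolding A1.homog_def using gauge_powi[where ?m1.0 = 0 and ?m2.0 = 0 and ?m3.0 = 1] by simp
    then show "A1.component n (nf i j l p) = (if l = n then nf i j l p else 0)"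
      by (rule A1.component_homog)
    have "nf i j l p \<in> A2.homog (i - j)"
      unfolding A2.homog_def using gauge_powi[where ?m1.0 = 1 and ?m2.0 = "- 1" and ?m3.0 = 0] by simp
    then show "A2.component n (nf i j l p) = (if i - j = n then nf i j l p else 0)"
      by (rule A2.component_homog)
    have "nf i j l p \<in> A3.homog (j + l)"
      unfolding A3.homog_def using gauge_powi[where ?m1.0 = 0 and ?m2.0 = 1 and ?m3.0 = 1] by simp
    then show "A3.component n (nf i j l p) = (if j + l = n then nf i j l p else 0)"
      by (rule A3.component_homog)
  qed
  have zero: "A2.component n 0 = 0" "A3.component n 0 = 0" for n
    using A2.bounded_linear_component A3.bounded_linear_component
    by (simp_all add: linear_0 bounded_linear.linear)
  have P_nf: "P (nf i j l p) \<in> ?M" for i j l p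
  proof -
    have "P (nf i j l p) = (if l = n1 \<and> i - j = n2 \<and> j + l = n3 then nf i j l p else 0)"
      unfolding P_def by (cases "l = n1"; cases "i - j = n2"; simp only: comp zero simp_thms if_True if_False)
    then show ?thesis
      using subspace_0[OF subspace_nf] by (auto simp: i0_def j0_def)
  qed
  have P_span: "P y \<in> ?M" if "y \<in> nf_span" for y
    using that unfolding nf_span_def
  proof (induction rule: span_induct)
    case base
    show ?case
      using subspace_nf[of i0 j0 n1] bl
      by (intro subspaceI)
        (auto simp only: mem_Collect_eq linear_0 linear_add linear_scale bounded_linear.linear
          intro!: subspace_0 subspace_add subspace_scale)
  next
    case (step y)
    then show ?case using P_nf by blast
  qed
  \<comment> \<open>\<open>P x\<close> itself need not be a normal form, only a limit of normal
    forms of one fixed weight, so the argument runs through approximants.\<close>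
  obtain y where y: "\<And>k. y k \<in> nf_span" "y \<longlonglongrightarrow> x"
    using closure_nf_span closure_sequential[of x nf_span] by auto
  have "\<exists>r. (P (y k))\<^sup>\<star> * P (y k) = peval c r" for k
  proof -
    obtain p where "P (y k) = nf i0 j0 n1 p"
      using P_span[OF y(1)[of k]] by blast
    then show ?thesis
      using star_mult_nf by simp
  qed
  then obtain r where r: "\<And>k. (P (y k))\<^sup>\<star> * P (y k) = peval c (r k)"
    by metis
  have "(\<lambda>k. P (y k)) \<longlonglongrightarrow> P x"
    using y(2) by (rule bounded_linear.tendsto[OF bl])
  then have "(\<lambda>k. (P (y k))\<^sup>\<star> * P (y k)) \<longlonglongrightarrow> (P x)\<^sup>\<star> * P x"
    by (intro tendsto_intros)
  then have lim: "(\<lambda>k. peval c (r k)) \<longlonglongrightarrow> (P x)\<^sup>\<star> * P x"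
    by (simp only: r)
  define f where "f = (P x)\<^sup>\<star> * P x"
  \<comment> \<open>The null space is a left ideal, so it contains \<open>f\<close> along with
    \<open>P x\<close>. Passing to \<open>f\<close> makes the integrand in \<open>h_peval_ge\<close>
    the square of a polynomial in \<open>c\<close> itself.\<close>
  have "h (f\<^sup>\<star> * f) = 0"
    using null_space_mult[OF null, of "(P x)\<^sup>\<star>"] by (simp add: null_space_def f_def)
  moreover have "(\<lambda>k. (peval c (r k))\<^sup>\<star> * peval c (r k)) \<longlonglongrightarrow> f\<^sup>\<star> * f"
    unfolding f_def by (intro tendsto_intros lim)
  ultimately have h0: "(\<lambda>k. h ((peval c (r k))\<^sup>\<star> * peval c (r k))) \<longlonglongrightarrow> 0"
    using bounded_linear.tendsto[OF bounded_linear_h] by metis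
  have "(\<lambda>k. poly (r k) (of_real (s ^ m))) \<longlonglongrightarrow> 0" for m
  proof -
    obtain w where w: "w > 0" "\<And>p. w * (cmod (poly p (of_real (s ^ m))))\<^sup>2 \<le> Re (h ((peval c p)\<^sup>\<star> * peval c p))"
      using h_peval_ge by blast
    have le: "(cmod (poly p (of_real (s ^ m))))\<^sup>2 \<le> Re (h ((peval c p)\<^sup>\<star> * peval c p)) / w" for p
      using w(2)[of p] by (simp only: pos_le_divide_eq[OF w(1)] mult.commute)
    have "(\<lambda>k. Re (h ((peval c (r k))\<^sup>\<star> * peval c (r k))) / w) \<longlonglongrightarrow> Re 0 / w"
      using w(1) by (intro tendsto_intros h0) simp
    then have "(\<lambda>k. Re (h ((peval c (r k))\<^sup>\<star> * peval c (r k))) / w) \<longlonglongrightarrow> 0"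
      by simp
    then have "(\<lambda>k. (cmod (poly (r k) (of_real (s ^ m))))\<^sup>2) \<longlonglongrightarrow> 0"
      by (rule tendsto_sandwich[OF always_eventually always_eventually tendsto_const, rotated 2])
        (simp_all only: le zero_le_power2 simp_thms)
    then have "(\<lambda>k. sqrt ((cmod (poly (r k) (of_real (s ^ m))))\<^sup>2)) \<longlonglongrightarrow> sqrt 0"
      by (rule tendsto_real_sqrt)
    then show ?thesis
      by (simp add: tendsto_norm_zero_iff)
  qed
  then have "(P x)\<^sup>\<star> * P x = 0"
    by (intro limit_peval_c_eq_0[OF e_nz lim]) (simp_all add: star_mult star_star)
  then show False
    using n3 by (simp add: star_mult_self_eq_0 P_def)
qed

end

theorem theorem2p8:
  fixes q :: complex
    and a b D :: "'a::cstar_algebra"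
    and ten :: "'a \<Rightarrow> 'a \<Rightarrow> 't::cstar_algebra"
    and \<Delta> :: "'a \<Rightarrow> 't"
    and h :: "'a \<Rightarrow> complex"
  assumes "0 < cmod q" "cmod q < 1"
    and "C_Uq2 q a b D"
    and "minimal_tensor_product ten"
    and "uq2_comultiplication q a b D ten \<Delta>"
    and "haar_state ten \<Delta> h"
  shows "\<forall>x. h (x\<^sup>\<star> * x) = 0 \<longrightarrow> x = 0"
proof -
  interpret uq2_haar q a b D ten \<Delta> h
    using assms C_Uq2_relations[OF assms(3)] by unfold_locales
  show ?thesis
    using haar_faithful by blast
qed

end
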